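(* Let $p,q,r$ be distinct primes, let $\alpha,\beta,\gamma$ be nonnegative integers, and let $A,B\subset\mathbb{Z}$ be finite sets with $|A|=p^{\alpha}q^{\beta}r^{\gamma}$ and $|B|=pqr$. Assume that $A\oplus B=\mathbb{Z}/M\mathbb{Z}$, where $M=|A|\,|B|$. If $\Phi_p(x)$, $\Phi_q(x)$, $\Phi_r(x)$ all divide $A(x)$, then $\Phi_{pq}(x)$, $\Phi_{pr}(x)$, $\Phi_{qr}(x)$, $\Phi_{pqr}(x)$ all divide $A(x)$.
   Context: For finite $A,B\subset\mathbb{Z}$ and a positive integer $M$, $A\oplus B=\mathbb{Z}/M\mathbb{Z}$ means that $|A|\,|B|=M$ and every integer $n$ can be written in a unique way as $n=a+c$ with $a\in A$ and $c\in B+M\mathbb{Z}$ (equivalently, every residue class mod $M$ contains $a+b$ for exactly one pair $(a,b)\in A\times B$). $\Phi_s(x)$ denotes the $s$-th cyclotomic polynomial. The characteristic polynomial of a finite set $A\subset\mathbb{Z}$ is $A(x)=\sum_{a\in A}x^a$. If $A$ contains negative integers this is a Laurent polynomial, and "$\Phi_s(x)$ divides $A(x)$" is understood in $\mathbb{Z}[x,x^{-1}]$; in all cases it is equivalent to $A(\zeta)=0$ for every primitive $s$-th root of unity $\zeta$. *)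

theory Defs
  imports
    "HOL-Library.Poly_Mapping"
    "HOL-Computational_Algebra.Computational_Algebra"
begin

definition primitive_root_unity :: "nat \<Rightarrow> complex \<Rightarrow> bool" where
  "primitive_root_unity s z \<longleftrightarrow> s > 0 \<and> z ^ s = 1 \<and> (\<forall>k. 0 < k \<and> k < s \<longrightarrow> z ^ k \<noteq> 1)"

text \<open>Existence of the integer polynomial in this definition is shown in
  \<open>map_poly_cyclotomic\<close> below; uniqueness is immediate.\<close>

definition cyclotomic :: "nat \<Rightarrow> int poly" where
  "cyclotomic s = (THE f. map_poly of_int f = (\<Prod>z | primitive_root_unity s z. [:- z, 1:]))"

text \<open>
  The Laurent polynomial ring \<open>\<int>[x, x\<^sup>-\<^sup>1]\<close> is the group ring of \<open>(\<int>, +)\<close>, i.e. the type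
  \<^typ>\<open>int \<Rightarrow>\<^sub>0 int\<close> with convolution product; \<open>Poly_Mapping.single k c\<close> is \<open>c x\<^sup>k\<close>.
  Divisibility in it is the \<open>dvd\<close> of this ring.
\<close>

type_synonym laurent = "int \<Rightarrow>\<^sub>0 int"

definition laurent_of_poly :: "int poly \<Rightarrow> laurent" where
  "laurent_of_poly f = (\<Sum>i\<le>degree f. Poly_Mapping.single (int i) (coeff f i))"

definition char_poly_set :: "int set \<Rightarrow> laurent" where
  "char_poly_set A = (\<Sum>a\<in>A. Poly_Mapping.single a 1)"

definition tiles_cyclic :: "int set \<Rightarrow> int set \<Rightarrow> nat \<Rightarrow> bool" where
  "tiles_cyclic A B M \<longleftrightarrow>
     finite A \<and> finite B \<and> M > 0 \<and> card A * card B = M \<and>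
     (\<forall>n. \<exists>!ac. ac \<in> A \<times> {b + int M * k | b k. b \<in> B} \<and> n = fst ac + snd ac)"

lemma finite_primitive_root_unity: "finite {z. primitive_root_unity s z}"
proof (cases "s = 0")
  case False
  have "{z. primitive_root_unity s z} \<subseteq> {z. z ^ s = 1}"
    by (auto simp: primitive_root_unity_def)
  with False show ?thesis
    using finite_roots_unity[of s, where 'a = complex] by (auto intro: finite_subset)
qed (auto simp: primitive_root_unity_def)

lemma primitive_root_unity_power_eq_1_iff:
  assumes "primitive_root_unity d z"
  shows "z ^ n = 1 \<longleftrightarrow> d dvd n"
proof -
  have d: "d > 0" "z ^ d = 1" "\<And>k. 0 < k \<Longrightarrow> k < d \<Longrightarrow> z ^ k \<noteq> 1"
    using assms by (auto simp: primitive_root_unity_def)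
  have "z ^ n = z ^ (d * (n div d) + n mod d)" by simp
  also have "\<dots> = z ^ (n mod d)"
    unfolding power_add power_mult using d(2) by simp
  finally have "z ^ n = z ^ (n mod d)" .
  moreover have "n mod d < d" using d(1) by simp
  ultimately show ?thesis using d(3)[of "n mod d"]
    by (cases "n mod d = 0") (auto simp: dvd_eq_mod_eq_0)
qed

lemma primitive_root_unity_unique:
  assumes "primitive_root_unity d z" "primitive_root_unity e z"
  shows "d = e"
  using assms primitive_root_unity_power_eq_1_iff[OF assms(1), of e]
    primitive_root_unity_power_eq_1_iff[OF assms(2), of d]
  by (auto simp: primitive_root_unity_def intro: dvd_antisym)

lemma roots_unity_eq_UN_primitive:
  assumes "n > 0"
  shows "{z::complex. z ^ n = 1} = (\<Union>d\<in>{d. d dvd n}. {z. primitive_root_unity d z})"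
proof (intro equalityI subsetI)
  fix z :: complex assume "z \<in> {z. z ^ n = 1}"
  hence z: "z ^ n = 1" by simp
  define d where "d = (LEAST k. 0 < k \<and> z ^ k = 1)"
  have "0 < d \<and> z ^ d = 1"
    unfolding d_def by (rule LeastI[of _ n]) (use z assms in auto)
  moreover have "\<not> (0 < k \<and> z ^ k = 1)" if "k < d" for k
    using that unfolding d_def by (rule not_less_Least)
  ultimately have p: "primitive_root_unity d z"
    by (auto simp: primitive_root_unity_def)
  with z show "z \<in> (\<Union>d\<in>{d. d dvd n}. {z. primitive_root_unity d z})"
    using primitive_root_unity_power_eq_1_iff by blast
next
  fix z assume "z \<in> (\<Union>d\<in>{d. d dvd n}. {z. primitive_root_unity d z})"
  thus "z \<in> {z. z ^ n = 1}"
    using primitive_root_unity_power_eq_1_iff by blast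
qed

lemma monom_minus_1_eq_prod_primitive:
  assumes "n > 0"
  shows "monom 1 n - 1 = (\<Prod>d | d dvd n. \<Prod>z | primitive_root_unity d z. [:- z, 1:])"
proof -
  let ?f = "monom 1 n - 1 :: complex poly"
  have deg: "degree ?f = n"
    using assms degree_add_eq_left[of "-1" "monom (1::complex) n"] by (simp add: degree_monom_eq)
  have lc: "lead_coeff ?f = 1"
    using assms by (simp add: deg)
  have nz: "?f \<noteq> 0" using lc by force
  have "rsquarefree ?f"
    unfolding rsquarefree_roots
  proof (intro allI notI, elim conjE)
    fix a assume a: "poly ?f a = 0" "poly (pderiv ?f) a = 0"
    from a(1) have "a ^ n = 1" by (simp add: poly_monom)
    moreover from a(2) have "of_nat n * a ^ (n - 1) = 0"
      by (simp add: pderiv_diff pderiv_monom poly_monom)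
    ultimately show False using assms by (auto simp: power_0_left)
  qed
  from complex_poly_decompose_rsquarefree[OF this]
  have "?f = (\<Prod>z | z ^ n = 1. [:- z, 1:])"
    unfolding lc by (simp add: poly_monom)
  also have "\<dots> = (\<Prod>d | d dvd n. \<Prod>z | primitive_root_unity d z. [:- z, 1:])"
    unfolding roots_unity_eq_UN_primitive[OF assms]
    by (rule prod.UNION_disjoint)
       (use assms finite_primitive_root_unity primitive_root_unity_unique in auto)
  finally show ?thesis .
qed

lemma of_int_poly_add:
  "map_poly of_int (f + g) = (map_poly of_int f + map_poly of_int g :: complex poly)"
  by (auto simp: poly_eq_iff coeff_map_poly)

lemma of_int_poly_mult:
  "map_poly of_int (f * g) = (map_poly of_int f * map_poly of_int g :: complex poly)"
  by (auto simp: poly_eq_iff coeff_map_poly coeff_mult)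

lemma of_int_poly_prod:
  "map_poly of_int (prod F D) = (\<Prod>d\<in>D. map_poly of_int (F d) :: complex poly)"
  by (induction D rule: infinite_finite_induct) (auto simp: of_int_poly_mult)

lemma exists_int_cyclotomic:
  "\<exists>f::int poly. lead_coeff f = 1 \<and>
     map_poly of_int f = (\<Prod>z | primitive_root_unity s z. [:- z, 1:])"
proof (induction s rule: less_induct)
  case (less s)
  let ?c = "\<lambda>d. \<Prod>z | primitive_root_unity d z. [:- z, 1:]"
  show ?case
  proof (cases "s = 0")
    case True
    thus ?thesis by (intro exI[of _ 1]) (simp add: primitive_root_unity_def)
  next
    case False
    from less obtain F where
      F: "\<And>d. d < s \<Longrightarrow> lead_coeff (F d) = 1 \<and> map_poly of_int (F d) = ?c d"
      by metis
    define D where "D = {d. d dvd s} - {s}"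
    have D: "finite D" "d \<in> D \<Longrightarrow> d < s" for d
      using False by (auto simp: D_def dest: dvd_imp_le)
    define g where "g = prod F D"
    have lcg: "lead_coeff g = 1"
      unfolding g_def lead_coeff_prod using F D(2) by (intro prod.neutral) auto
    have mapg: "map_poly of_int g = prod ?c D"
      unfolding g_def of_int_poly_prod using F D(2) by (intro prod.cong) auto
    let ?m = "map_poly of_int :: int poly \<Rightarrow> complex poly"
    obtain q r where qr: "pseudo_divmod (monom 1 s - 1) g = (q, r)"
      by fastforce
    have g0: "g \<noteq> 0" using lcg by force
    have eq: "monom 1 s - 1 = g * q + r"
      using pseudo_divmod(1)[OF g0 qr] lcg by simp
    have degr: "r = 0 \<or> degree r < degree g"
      using pseudo_divmod(2)[OF g0 qr] .
    have "monom 1 s - 1 = ?m (monom 1 s - 1)"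
      by (auto simp: poly_eq_iff coeff_map_poly coeff_monom)
    also have "\<dots> = ?m g * ?m q + ?m r"
      unfolding eq by (simp add: of_int_poly_add of_int_poly_mult)
    finally have "(\<Prod>d | d dvd s. ?c d) = ?m g * ?m q + ?m r"
      using False by (simp add: monom_minus_1_eq_prod_primitive)
    moreover have "(\<Prod>d | d dvd s. ?c d) = ?c s * ?m g"
      unfolding mapg D_def using False by (intro prod.remove) auto
    ultimately have *: "?m r = ?m g * (?c s - ?m q)"
      by (simp add: algebra_simps)
    have degm: "degree (?m h) = degree h" for h
      by (rule degree_map_poly) auto
    have mg0: "?m g \<noteq> 0"
      using g0 by (simp add: map_poly_eq_0_iff)
    have "?c s - ?m q = 0"
    proof (rule ccontr)
      assume nz: "?c s - ?m q \<noteq> 0"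
      hence "degree (?m r) = degree (?m g) + degree (?c s - ?m q)"
        unfolding * using mg0 by (intro degree_mult_eq)
      hence "degree g \<le> degree r" by (simp add: degm)
      with degr have "r = 0" by simp
      with * nz mg0 show False by simp
    qed
    hence q: "?m q = ?c s" by simp
    have "complex_of_int (lead_coeff q) = lead_coeff (?m q)"
      by (simp add: degm coeff_map_poly)
    also have "\<dots> = 1"
      unfolding q lead_coeff_prod by (intro prod.neutral) auto
    finally have "lead_coeff q = 1" by simp
    with q show ?thesis by blast
  qed
qed

lemma map_poly_cyclotomic:
  "map_poly of_int (cyclotomic s) = (\<Prod>z | primitive_root_unity s z. [:- z, 1:])"
proof -
  obtain f :: "int poly" where
    f: "map_poly of_int f = (\<Prod>z | primitive_root_unity s z. [:- z, 1:])"
    using exists_int_cyclotomic by blast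
  have "g = f" if "map_poly of_int g = (map_poly of_int f :: complex poly)" for g
    using that by (auto simp: poly_eq_iff coeff_map_poly)
  hence "cyclotomic s = f"
    unfolding cyclotomic_def f[symmetric] by (intro the_equality refl)
  with f show ?thesis by simp
qed

end

theory Submission
  imports Defs "HOL-Number_Theory.Cong" "HOL-Library.FuncSet"
begin

text \<open>
  Write \<open>\<Phi>\<^sub>s | A\<close> for divisibility of the polynomial of A. For \<open>s = p\<^sup>i q\<^sup>j r\<^sup>k\<close>, \<open>\<Phi>\<^sub>s | A\<close>
  means that \<open>\<Sum>x\<in>A. f x * g x * h x = 0\<close> for all functions f, g, h of levels i, j, k
  in base p, q, r, that is, functions of the residue modulo \<open>p\<^sup>i\<close> with sum 0 over the top
  digit, and so on (\<open>vanishes_test\<close>, \<open>vanishes_intro\<close>). Thus divisibility by cyclotomic polynomials says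
  how evenly a set is distributed over residue classes, and the proof counts elements in classes.
  A class modulo \<open>l\<^sup>i\<^sup>-\<^sup>1\<close> is the union of its l children modulo \<open>l\<^sup>i\<close>, which are siblings;
  rows, columns and cells are the classes modulo p, q and \<open>p q\<close>.

  Two facts on tilings enter: for each \<open>s > 1\<close> dividing M, \<open>\<Phi>\<^sub>s\<close> divides A or B
  (\<open>tiling_dichotomy\<close>), and differences \<open>a - a' \<noteq> 0\<close> in A and \<open>b - b'\<close> in B have different gcds with
  M (\<open>tiling_gcd_differences\<close>). Both hold because a tiling remains one when A is dilated by an
  integer coprime to M. Comparing with the cardinalities, exactly one power \<open>p\<^sup>a\<close> with
  \<open>a \<le> \<alpha> + 1\<close> satisfies \<open>\<Phi>\<^sub>s | B\<close>, the others satisfy \<open>\<Phi>\<^sub>s | A\<close>, and \<open>a \<ge> 2\<close> by hypothesis; similarly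
  \<open>q\<^sup>b\<close> and \<open>r\<^sup>c\<close>. In particular p, q, r divide the counts of B modulo p, q, r.

  The main tool is the following (\<open>holesI\<close>, \<open>holes_lift\<close>). If r is the largest prime and B is
  distributed irregularly with respect to the c-th base-r digit, divisibility of counts forces
  each class modulo \<open>r\<^sup>c\<^sup>-\<^sup>1\<close> to have a child modulo \<open>r\<^sup>c\<close> that A misses. Through such holes, divisibility
  of A at a level with \<open>r\<^sup>c\<close> passes to the same level with \<open>r\<^sup>k\<close>, k < c. So what fails for A at
  \<open>r\<^sup>k\<close> fails at \<open>r\<^sup>c\<close>, and then holds for B at \<open>r\<^sup>c\<close>.

  Suppose \<open>\<Phi>\<^sub>p\<^sub>q\<close> does not divide A. Then it divides B, which determines the counts of B modulo \<open>p q\<close> by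
  those modulo p and q, all of which are multiples of \<open>p q\<close>. This makes r the largest prime and
  produces holes, and the same description for the \<open>p q\<close> elements of B with a fixed c-th digit
  leads to a cell with \<open>-1\<close> elements (\<open>no_vB_110\<close>).

  Suppose \<open>p < q < r\<close> and \<open>\<Phi>\<^sub>p\<^sub>q\<^sub>r\<close> does not divide A. It divides B, and by \<open>no_vB_110\<close> none of
  \<open>\<Phi>\<^sub>p\<^sub>q\<close>, \<open>\<Phi>\<^sub>p\<^sub>r\<close>, \<open>\<Phi>\<^sub>q\<^sub>r\<close> divides B, so B meets all classes modulo p and q. If \<open>\<Phi>\<^sub>s\<close> with
  \<open>s = p r\<^sup>c\<close> does not divide B, there are holes, and the elements of B with a fixed c-th digit
  form an impossible configuration (\<open>vB_10c\<close>). If it does, but \<open>\<Phi>\<^sub>s\<close> with \<open>s = p q r\<^sup>c\<close> divides B too,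
  either the same configuration arises or there are no holes, and then A and B contain differences
  with the same gcd \<open>r\<^sup>c\<^sup>-\<^sup>1\<close> (\<open>not_vB_11c\<close>). Otherwise the latter \<open>\<Phi>\<^sub>s\<close> divides A; there need not be
  holes in A itself, but after fixing sufficiently many base-p digits, including the first, each
  piece of A has them (\<open>pattern_hole\<close>), which again brings divisibility by \<open>\<Phi>\<^sub>s\<close> down from \<open>r\<^sup>c\<close> to r
  (\<open>no_counterexample\<close>).
\<close>

section \<open>Level functions\<close>

text \<open>
  Divisibility by the s-th cyclotomic polynomial, read off at its roots; the translation is
  \<open>cyclotomic_dvd_iff_vanishes\<close> below.
\<close>

definition vanishes :: "int set \<Rightarrow> nat \<Rightarrow> bool" where
  "vanishes A s \<longleftrightarrow> (\<forall>z. primitive_root_unity s z \<longrightarrow> (\<Sum>a\<in>A. z powi a) = 0)"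

definition periodic :: "nat \<Rightarrow> (int \<Rightarrow> 'a) \<Rightarrow> bool" where
  "periodic m f \<longleftrightarrow> (\<forall>x y. [x = y] (mod int m) \<longrightarrow> f x = f y)"

text \<open>
  These are the linear combinations of the characters of order exactly l ^ i (for prime l, see
  \<open>level_expand\<close>). Pairing a set with such functions replaces evaluation at roots of unity by
  counting residue classes.
\<close>

definition level :: "nat \<Rightarrow> nat \<Rightarrow> (int \<Rightarrow> 'a::comm_ring_1) set" where
  "level l i = {f. periodic (l ^ i) f \<and> (i > 0 \<longrightarrow> (\<forall>x. (\<Sum>e<l. f (x + int (e * l ^ (i - 1)))) = 0))}"

definition chi :: "nat \<Rightarrow> int \<Rightarrow> int \<Rightarrow> int" where
  "chi m u x = of_bool ([x = u] (mod int m))"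

abbreviation cnt :: "int set \<Rightarrow> nat \<Rightarrow> int \<Rightarrow> int" where
  "cnt S m u \<equiv> (\<Sum>x\<in>S. chi m u x)"

text \<open>
  Base-l digits are numbered from 1, so that digit i is the top digit of a residue modulo
  l ^ i.
\<close>

definition digit :: "nat \<Rightarrow> nat \<Rightarrow> int \<Rightarrow> int" where
  "digit l i x = (x div int (l ^ (i - 1))) mod int l"

definition digit_ind :: "nat \<Rightarrow> nat \<Rightarrow> int \<Rightarrow> int \<Rightarrow> int" where
  "digit_ind l i j x = of_bool (digit l i x = j)"

lemma perD: "periodic m f \<Longrightarrow> [x = y] (mod int m) \<Longrightarrow> f x = f y"
  by (auto simp: periodic_def)

lemma periodic_dvd: "periodic m f \<Longrightarrow> m dvd n \<Longrightarrow> periodic n f"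
  unfolding periodic_def by (meson cong_dvd_modulus int_dvd_int_iff)

lemma periodic_pow_le: "periodic (l ^ i) f \<Longrightarrow> i \<le> k \<Longrightarrow> periodic (l ^ k) f"
  by (rule periodic_dvd) (auto simp: le_imp_power_dvd)

lemma periodic_const [simp]: "periodic m (\<lambda>_. c)"
  by (simp add: periodic_def)

lemma periodic_mult: "periodic m f \<Longrightarrow> periodic m g \<Longrightarrow> periodic m (\<lambda>x. f x * g x)"
  unfolding periodic_def by metis

lemma periodic_diff: "periodic m f \<Longrightarrow> periodic m g \<Longrightarrow> periodic m (\<lambda>x. f x - g x)"
  unfolding periodic_def by metis

lemma periodic_chi [simp]: "periodic m (chi m u)"
  by (simp add: periodic_def chi_def cong_def)

lemma chi_cong: "[u = v] (mod int m) \<Longrightarrow> chi m u = chi m v"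
  by (simp add: chi_def cong_def fun_eq_iff)

lemma level_periodic: "f \<in> level l i \<Longrightarrow> periodic (l ^ i) f"
  by (simp add: level_def)

lemma level_sum: "f \<in> level l i \<Longrightarrow> i > 0 \<Longrightarrow> (\<Sum>e<l. f (x + int (e * l ^ (i - 1)))) = 0"
  by (simp add: level_def)

lemma level_0: "f \<in> level l 0 \<longleftrightarrow> (\<exists>c. f = (\<lambda>_. c))"
proof
  assume "f \<in> level l 0"
  then have "\<forall>x y. f x = f y" by (simp add: level_def periodic_def)
  then have "f = (\<lambda>_. f 0)" by auto
  then show "\<exists>c. f = (\<lambda>_. c)" by blast
qed (auto simp: level_def)

lemma level_const [simp]: "(\<lambda>_. c) \<in> level l 0"
  by (auto simp: level_0)

lemma level_mult_periodic:
  assumes "f \<in> level l i" "i > 0" "periodic (l ^ (i - 1)) w"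
  shows "(\<lambda>x. w x * f x) \<in> level l i"
proof -
  have w: "w (x + int (e * l ^ (i - 1))) = w x" for x e
    by (rule perD[OF assms(3)]) (simp add: cong_def)
  have "periodic (l ^ i) w" by (rule periodic_pow_le[OF assms(3)]) simp
  then show ?thesis
    using assms(1,2) by (auto simp: level_def w periodic_mult sum_distrib_left[symmetric] simp del: of_nat_mult of_nat_power One_nat_def)
qed

lemma level_diff: "f \<in> level l i \<Longrightarrow> g \<in> level l i \<Longrightarrow> (\<lambda>x. f x - g x) \<in> level l i"
  by (auto simp: level_def sum_subtractf periodic_diff)

lemma digit_add:
  assumes "l > 0"
  shows "digit l i (x + int e * int (l ^ (i - 1))) = (digit l i x + int e) mod int l"
  using assms by (simp add: digit_def mod_simps add.commute)

lemma periodic_digit: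
  assumes "l > 0" "i > 0"
  shows "periodic (l ^ i) (digit l i)"
  unfolding periodic_def
proof (intro allI impI)
  fix x y assume "[x = y] (mod int (l ^ i))"
  then obtain k where k: "x = y + int (l ^ i) * k"
    by (metis cong_iff_lin cong_sym)
  have "int (l ^ i) = int (l ^ (i - 1)) * int l"
    using assms by (cases i) auto
  then have "x = y + (int l * k) * int (l ^ (i - 1))" using k by simp
  then have "x div int (l ^ (i - 1)) = y div int (l ^ (i - 1)) + int l * k"
    using assms by simp
  then show "digit l i x = digit l i y" by (simp add: digit_def)
qed

lemma periodic_digit_ind: "l > 0 \<Longrightarrow> i > 0 \<Longrightarrow> periodic (l ^ i) (digit_ind l i j)"
  using periodic_digit[of l i] by (simp add: periodic_def digit_ind_def)

lemma sum_of_bool_mod: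
  assumes "0 \<le> j" "j < int l"
  shows "(\<Sum>e<l. of_bool ((t + int e) mod int l = j)) = (1::int)"
proof -
  have l: "int l > 0" using assms by linarith
  have "{e. e < l \<and> (t + int e) mod int l = j} = {nat ((j - t) mod int l)}"
  proof (intro equalityI subsetI)
    fix e assume "e \<in> {e. e < l \<and> (t + int e) mod int l = j}"
    then have e: "e < l" "(t + int e) mod int l = j" by auto
    then have "int e mod int l = (j - t) mod int l"
      using mod_diff_left_eq[of "t + int e" "int l" t] by simp
    then have "int e = (j - t) mod int l" using e(1) by simp
    then show "e \<in> {nat ((j - t) mod int l)}" by simp
  next
    fix e assume "e \<in> {nat ((j - t) mod int l)}"
    then have e: "int e = (j - t) mod int l" using l by simp
    then have "int e < int l" using l by simp
    moreover have "(t + int e) mod int l = j"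
      unfolding e using assms by (simp add: mod_simps)
    ultimately show "e \<in> {e. e < l \<and> (t + int e) mod int l = j}" by simp
  qed
  moreover have "{..<l} \<inter> {e. (t + int e) mod int l = j} = {e. e < l \<and> (t + int e) mod int l = j}"
    by auto
  ultimately have "card ({..<l} \<inter> {e. (t + int e) mod int l = j}) = 1" by simp
  then show ?thesis by (subst sum_of_bool_eq) simp_all
qed

text \<open>
  Among the l values of the top digit exactly one is j, so l times the indicator has
  average 1 over the top digit. The lemma \<open>level_chi\<close> below is the same with residue classes.
\<close>

lemma level_digit_ind:
  assumes "l > 0" "i > 0" "0 \<le> j" "j < int l" "periodic (l ^ (i - 1)) w"
  shows "(\<lambda>x. w x * (int l * digit_ind l i j x - 1)) \<in> level l i"
proof (rule level_mult_periodic[OF _ assms(2,5)])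
  have "(\<Sum>e<l. digit_ind l i j (x + int (e * l ^ (i - 1)))) = 1" for x
    unfolding digit_ind_def of_nat_mult digit_add[OF assms(1)]
    by (rule sum_of_bool_mod[OF assms(3,4)])
  then have "(\<Sum>e<l. int l * digit_ind l i j (x + int (e * l ^ (i - 1))) - 1) = 0" for x
    by (simp add: sum_subtractf sum_distrib_left[symmetric] del: of_nat_mult of_nat_power One_nat_def)
  moreover have "periodic (l ^ i) (\<lambda>x. int l * digit_ind l i j x - 1)"
    by (intro periodic_diff periodic_mult periodic_const periodic_digit_ind assms)
  ultimately show "(\<lambda>x. int l * digit_ind l i j x - 1) \<in> level l i"
    by (simp add: level_def)
qed

lemma cong_add_pow_iff:
  assumes "l > 0" "i > 0"
  shows "[x + int e * int (l ^ (i - 1)) = u] (mod int (l ^ i)) \<longleftrightarrow>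
    [x = u] (mod int (l ^ (i - 1))) \<and> ((x - u) div int (l ^ (i - 1)) + int e) mod int l = 0"
proof -
  define m where "m = int (l ^ (i - 1))"
  have m: "m > 0" using assms by (simp add: m_def)
  have li: "int (l ^ i) = m * int l"
    using assms by (cases i) (auto simp: m_def)
  show ?thesis
  proof (cases "m dvd x - u")
    case True
    then obtain k where k: "x - u = m * k" by blast
    have eq: "x + int e * m - u = m * (k + int e)" using k by (simp add: algebra_simps)
    have "[x + int e * m = u] (mod (m * int l)) \<longleftrightarrow> m * int l dvd m * (k + int e)"
      unfolding cong_iff_dvd_diff using eq by simp
    also have "\<dots> \<longleftrightarrow> int l dvd k + int e" using m by simp
    finally show ?thesis
      using True m unfolding li m_def[symmetric] cong_iff_dvd_diff k by (simp add: dvd_eq_mod_eq_0)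
  next
    case False
    have "\<not> m * int l dvd x + int e * m - u"
    proof
      assume "m * int l dvd x + int e * m - u"
      then have "m dvd x + int e * m - u" using dvd_mult_left by blast
      from dvd_diff[OF this, of "int e * m"] have "m dvd x + int e * m - u - int e * m" by simp
      moreover have "x + int e * m - u - int e * m = x - u" by simp
      ultimately show False using False by simp
    qed
    then show ?thesis
      using False unfolding li m_def[symmetric] cong_iff_dvd_diff by simp
  qed
qed

lemma chi_sum_shift:
  assumes "l > 0" "i > 0"
  shows "(\<Sum>e<l. chi (l ^ i) u (x + int (e * l ^ (i - 1)))) = chi (l ^ (i - 1)) u x"
proof -
  have "(\<Sum>e<l. chi (l ^ i) u (x + int (e * l ^ (i - 1)))) =
     (\<Sum>e<l. chi (l ^ (i - 1)) u x * of_bool (((x - u) div int (l ^ (i - 1)) + int e) mod int l = 0))"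
    unfolding chi_def of_nat_mult cong_add_pow_iff[OF assms] by (intro sum.cong) auto
  also have "\<dots> = chi (l ^ (i - 1)) u x"
    unfolding sum_distrib_left[symmetric] using assms by (subst sum_of_bool_mod) auto
  finally show ?thesis .
qed

lemma chi_split:
  assumes "l > 0" "i > 0"
  shows "chi (l ^ (i - 1)) u x = (\<Sum>e<l. chi (l ^ i) (u + int (e * l ^ (i - 1))) x)"
proof -
  have eq: "chi (l ^ i) (u + int e) x = chi (l ^ i) x (u + int e)" for e
    by (auto simp: chi_def cong_def)
  have "chi (l ^ (i - 1)) u x = chi (l ^ (i - 1)) x u"
    by (auto simp: chi_def cong_def)
  then show ?thesis unfolding eq using chi_sum_shift[OF assms, of x u] by simp
qed

lemma level_chi:
  assumes "l > 0" "i > 0" "periodic (l ^ (i - 1)) w"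
  shows "(\<lambda>x. w x * (int l * chi (l ^ i) u x - chi (l ^ (i - 1)) u x)) \<in> level l i"
proof (rule level_mult_periodic[OF _ assms(2,3)])
  have p: "periodic (l ^ i) (chi (l ^ (i - 1)) u)"
    by (rule periodic_pow_le[of l "i - 1"]) auto
  have "chi (l ^ (i - 1)) u (x + int (e * l ^ (i - 1))) = chi (l ^ (i - 1)) u x" for x e
    by (rule perD[OF periodic_chi]) (simp add: cong_def)
  then have "(\<Sum>e<l. int l * chi (l ^ i) u (x + int (e * l ^ (i - 1))) - chi (l ^ (i - 1)) u (x + int (e * l ^ (i - 1)))) = 0" for x
    using chi_sum_shift[OF assms(1,2), of u x]
    by (simp add: sum_subtractf sum_distrib_left[symmetric] del: of_nat_mult of_nat_power One_nat_def)
  moreover have "periodic (l ^ i) (\<lambda>x. int l * chi (l ^ i) u x - chi (l ^ (i - 1)) u x)"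
    by (intro periodic_diff periodic_mult periodic_const periodic_chi p)
  ultimately show "(\<lambda>x. int l * chi (l ^ i) u x - chi (l ^ (i - 1)) u x) \<in> level l i"
    by (simp add: level_def)
qed

lemma level_chi_diff:
  assumes "l > 0" "i > 0" "[u = v] (mod int (l ^ (i - 1)))"
  shows "(\<lambda>x. chi (l ^ i) u x - chi (l ^ i) v x) \<in> level l i"
proof -
  have "(\<Sum>e<l. chi (l ^ i) u (x + int (e * l ^ (i - 1))) - chi (l ^ i) v (x + int (e * l ^ (i - 1)))) = 0" for x
    unfolding sum_subtractf chi_sum_shift[OF assms(1,2)] chi_cong[OF assms(3)] by simp
  then show ?thesis by (simp add: level_def periodic_diff)
qed

lemma sum_linear:
  fixes f :: "'b \<Rightarrow> 'a::comm_ring_1"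
  shows "(\<Sum>a\<in>A. f a * (w a * (c * d a - e a)))
    = c * (\<Sum>a\<in>A. f a * (w a * d a)) - (\<Sum>a\<in>A. f a * (w a * e a))"
  unfolding sum_distrib_left sum_subtractf[symmetric]
  by (intro sum.cong refl) (simp add: algebra_simps)

text \<open>
  Climb from modulus \<open>l ^ K\<close> to l ^ n. At a level i of G the f-mass of w is spread
  evenly over the l values of digit i, so it is l times the mass of the part with digit 0,
  and one continues with that part. Each element of G contributes one factor l.
\<close>

lemma level_dvd:
  assumes "finite A" "l > 0" "G \<subseteq> {K<..n}"
    and "\<And>i g. i \<in> G \<Longrightarrow> g \<in> level l i \<Longrightarrow> (\<Sum>a\<in>A. f a * g a) = 0"
    and "periodic (l ^ K) w"
  shows "int l ^ card G dvd (\<Sum>a\<in>A. f a * w a)"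
  using assms(3-5)
proof (induction "n - K" arbitrary: K G w)
  case 0
  then have "G = {}" by auto
  then show ?case by simp
next
  case (Suc d)
  have d: "d = n - Suc K" using Suc.hyps(2) by simp
  have finG: "finite G" using Suc.prems(1) finite_subset by blast
  have IH: "int l ^ card (G - {Suc K}) dvd (\<Sum>a\<in>A. f a * w' a)" if "periodic (l ^ Suc K) w'" for w'
    by (rule Suc.hyps(1)[OF d _ _ that]) (use Suc.prems(1,2) in auto)
  show ?case
  proof (cases "Suc K \<in> G")
    case False
    then show ?thesis using IH[of w] periodic_pow_le[OF Suc.prems(3), of "Suc K"] by simp
  next
    case True
    let ?w = "\<lambda>x. w x * digit_ind l (Suc K) 0 x"
    have pw: "periodic (l ^ Suc K) ?w"
      by (intro periodic_mult periodic_digit_ind periodic_pow_le[OF Suc.prems(3)]) (use assms in auto)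
    have "(\<lambda>x. w x * (int l * digit_ind l (Suc K) 0 x - 1)) \<in> level l (Suc K)"
      by (rule level_digit_ind) (use assms Suc.prems in auto)
    from Suc.prems(2)[OF True this]
    have "(\<Sum>a\<in>A. f a * w a) = int l * (\<Sum>a\<in>A. f a * ?w a)"
      unfolding sum_linear by simp
    moreover have "card G = Suc (card (G - {Suc K}))"
      by (rule card.remove[OF finG True])
    moreover have "int l * int l ^ card (G - {Suc K}) dvd int l * (\<Sum>a\<in>A. f a * ?w a)"
      by (intro mult_dvd_mono dvd_refl IH[OF pw])
    ultimately show ?thesis by (simp only: power_Suc)
  qed
qed

text \<open>
  If every level from 1 to K is annihilated, the f-mass is equidistributed modulo \<open>l ^ K\<close>.
\<close>

lemma level_even:
  assumes "l > 0"
    and "\<And>i g. 1 \<le> i \<Longrightarrow> i \<le> K \<Longrightarrow> g \<in> level l i \<Longrightarrow> (\<Sum>a\<in>A. f a * g a) = 0"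
  shows "int l ^ K * (\<Sum>a\<in>A. f a * chi (l ^ K) u a) = (\<Sum>a\<in>A. f a)"
  using assms(2)
proof (induction K)
  case 0
  then show ?case by (simp add: chi_def)
next
  case (Suc K)
  have "(\<lambda>x. 1 * (int l * chi (l ^ Suc K) u x - chi (l ^ (Suc K - 1)) u x)) \<in> level l (Suc K)"
    by (rule level_chi) (use assms in auto)
  then have "(\<Sum>a\<in>A. f a * (1 * (int l * chi (l ^ Suc K) u a - chi (l ^ (Suc K - 1)) u a))) = 0"
    by (rule Suc.prems[rotated 2]) auto
  then have "int l * (\<Sum>a\<in>A. f a * chi (l ^ Suc K) u a) = (\<Sum>a\<in>A. f a * chi (l ^ K) u a)"
    unfolding sum_linear by simp
  then have "int l ^ Suc K * (\<Sum>a\<in>A. f a * chi (l ^ Suc K) u a)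
      = int l ^ K * (\<Sum>a\<in>A. f a * chi (l ^ K) u a)"
    by (simp only: power_Suc2 mult.assoc)
  also have "\<dots> = (\<Sum>a\<in>A. f a)"
    by (rule Suc.IH) (use Suc.prems in auto)
  finally show ?case .
qed

section \<open>Roots of unity and level functions\<close>

lemma primitive_root_unityI:
  assumes "s > 0" "\<And>n. z ^ n = 1 \<longleftrightarrow> s dvd n"
  shows "primitive_root_unity s z"
  using assms by (auto simp: primitive_root_unity_def dest: dvd_imp_le)

lemma primitive_root_unity_nonzero: "primitive_root_unity s z \<Longrightarrow> z \<noteq> 0"
  by (auto simp: primitive_root_unity_def power_0_left)

lemma primitive_root_unity_powi_eq_1_iff:
  assumes "primitive_root_unity s z"
  shows "z powi k = 1 \<longleftrightarrow> int s dvd k"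
proof (cases "k \<ge> 0")
  case True
  then show ?thesis
    using primitive_root_unity_power_eq_1_iff[OF assms, of "nat k"]
    by (simp add: power_int_def int_dvd_int_iff[symmetric] del: int_dvd_int_iff)
next
  case False
  have "z powi k = 1 \<longleftrightarrow> z powi (- k) = 1"
    by (simp add: power_int_minus)
  also have "\<dots> \<longleftrightarrow> int s dvd - k"
    using primitive_root_unity_power_eq_1_iff[OF assms, of "nat (- k)"] False
    by (simp add: power_int_def int_dvd_int_iff[symmetric] del: int_dvd_int_iff)
  finally show ?thesis by simp
qed

lemma primitive_root_unity_powi:
  assumes "primitive_root_unity s z" "coprime k (int d)" "s = d * e"
  shows "primitive_root_unity d (z powi (k * int e))"
proof (rule primitive_root_unityI)
  have "s > 0" using assms(1) by (simp add: primitive_root_unity_def)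
  then show d0: "d > 0" using assms(3) by auto
  have e0: "e > 0" using \<open>s > 0\<close> assms(3) by auto
  fix n
  have "(z powi (k * int e)) ^ n = z powi (k * int e * int n)"
    by (simp add: power_int_mult)
  then have "(z powi (k * int e)) ^ n = 1 \<longleftrightarrow> int s dvd k * int e * int n"
    by (simp only: primitive_root_unity_powi_eq_1_iff[OF assms(1)])
  also have "\<dots> \<longleftrightarrow> int e * int d dvd int e * (k * int n)"
    using assms(3) by (simp add: mult_ac)
  also have "\<dots> \<longleftrightarrow> int d dvd k * int n" using e0 by simp
  also have "\<dots> \<longleftrightarrow> int d dvd int n"
    using assms(2) by (simp add: coprime_commute coprime_dvd_mult_right_iff)
  finally show "(z powi (k * int e)) ^ n = 1 \<longleftrightarrow> d dvd n" by simp
qed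

lemma primitive_root_unity_mult:
  assumes "primitive_root_unity d z" "primitive_root_unity e w" "coprime d e"
  shows "primitive_root_unity (d * e) (z * w)"
proof (rule primitive_root_unityI)
  show "d * e > 0" using assms by (simp add: primitive_root_unity_def)
  fix n
  have z: "z ^ m = 1 \<longleftrightarrow> d dvd m" and w: "w ^ m = 1 \<longleftrightarrow> e dvd m" for m
    using assms primitive_root_unity_power_eq_1_iff by blast+
  show "(z * w) ^ n = 1 \<longleftrightarrow> d * e dvd n"
  proof
    assume h: "(z * w) ^ n = 1"
    have "(z * w) ^ (n * e) = 1" "(z * w) ^ (n * d) = 1"
      unfolding power_mult h by simp_all
    moreover have "(z * w) ^ (n * e) = z ^ (n * e)" "(z * w) ^ (n * d) = w ^ (n * d)"
      using w[of "n * e"] z[of "n * d"] by (simp_all add: power_mult_distrib)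
    ultimately have "d dvd n * e" "e dvd n * d" using z w by auto
    then have "d dvd n" "e dvd n"
      using assms(3) by (simp_all add: coprime_dvd_mult_left_iff coprime_commute)
    then show "d * e dvd n" using assms(3) by (simp add: divides_mult)
  next
    assume "d * e dvd n"
    then have "d dvd n" "e dvd n" by (auto intro: dvd_mult_left dvd_mult_right)
    then have "z ^ n = 1" "w ^ n = 1" using z w by blast+
    then show "(z * w) ^ n = 1" by (simp add: power_mult_distrib)
  qed
qed

lemma primitive_root_unity_split:
  assumes "primitive_root_unity (d * e) z" "coprime d e"
  obtains z1 z2 where "primitive_root_unity d z1" "primitive_root_unity e z2" "z = z1 * z2"
proof -
  have "coprime (int d) (int e)" using assms(2) by simp
  then obtain x y where xy: "x * int e + y * int d = 1"
    using bezout_int[of "int e" "int d"] by (auto simp: coprime_iff_gcd_eq_1 gcd.commute)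
  have c1: "coprime x (int d)" using xy
    by (intro coprimeI) (metis dvd_add dvd_mult dvd_mult2)
  have c2: "coprime y (int e)" using xy
    by (intro coprimeI) (metis dvd_add dvd_mult dvd_mult2)
  have z0: "z \<noteq> 0" by (rule primitive_root_unity_nonzero[OF assms(1)])
  show ?thesis
  proof (rule that)
    show "primitive_root_unity d (z powi (x * int e))"
      by (rule primitive_root_unity_powi[OF assms(1) c1]) simp
    show "primitive_root_unity e (z powi (y * int d))"
      by (rule primitive_root_unity_powi[OF assms(1) c2]) simp
    show "z = z powi (x * int e) * z powi (y * int d)"
      using xy z0 by (simp add: power_int_add[symmetric])
  qed
qed

lemma primitive_root_unity_cis:
  assumes "s > 0"
  shows "primitive_root_unity s (cis (2 * pi / real s))"
proof (rule primitive_root_unityI[OF assms])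
  fix n
  have "cis (2 * pi / real s) ^ n = cis (2 * pi * (real n / real s))"
    by (simp add: DeMoivre mult_ac)
  also have "\<dots> = 1 \<longleftrightarrow> s dvd n"
  proof
    assume "cis (2 * pi * (real n / real s)) = 1"
    then have "cos (2 * pi * (real n / real s)) = 1" by (simp add: complex_eq_iff)
    then obtain k :: int where "2 * pi * (real n / real s) = of_int k * 2 * pi"
      using cos_one_2pi_int by blast
    then have "real n = of_int k * real s" using assms by (simp add: field_simps)
    then have "int n = k * int s" by (metis of_int_eq_iff of_int_mult of_int_of_nat_eq)
    then have "int s dvd int n" by simp
    then show "s dvd n" by simp
  next
    assume "s dvd n"
    then obtain k where "n = s * k" by blast
    then have "real n / real s = real k" using assms by simp
    then show "cis (2 * pi * (real n / real s)) = 1"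
      by (simp add: cis_multiple_2pi)
  qed
  finally show "cis (2 * pi / real s) ^ n = 1 \<longleftrightarrow> s dvd n" .
qed

text \<open>
  Moving the top digit multiplies \<open>z powi a\<close> by the powers of \<open>z ^ (l ^ (i - 1))\<close>, an l-th root
  of unity other than 1, and these powers add up to 0.
\<close>

lemma powi_in_level:
  assumes "prime l" "primitive_root_unity (l ^ i) z"
  shows "(\<lambda>a. z powi a) \<in> level l i"
proof -
  have z0: "z \<noteq> 0" by (rule primitive_root_unity_nonzero[OF assms(2)])
  have periodic: "periodic (l ^ i) (\<lambda>a. z powi a)"
    unfolding periodic_def
  proof (intro allI impI)
    fix x y assume "[x = y] (mod int (l ^ i))"
    then have "z powi (x - y) = 1"
      unfolding primitive_root_unity_powi_eq_1_iff[OF assms(2)] cong_iff_dvd_diff .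
    then show "z powi x = z powi y" using z0 by (simp add: power_int_diff)
  qed
  have "(\<Sum>e<l. z powi (x + int (e * l ^ (i - 1)))) = 0" if "i > 0" for x
  proof -
    define w where "w = z powi int (l ^ (i - 1))"
    have li: "l ^ i = l * l ^ (i - 1)" using that by (cases i) auto
    have l1: "l > 1" by (rule prime_gt_1_nat[OF assms(1)])
    have "\<not> int (l ^ i) dvd int (l ^ (i - 1))"
      unfolding int_dvd_int_iff li using l1 by (auto dest!: dvd_imp_le)
    then have w1: "w \<noteq> 1"
      unfolding w_def primitive_root_unity_powi_eq_1_iff[OF assms(2)] .
    have "w ^ l = z powi int (l ^ i)"
      unfolding w_def li by (simp add: power_int_mult[symmetric] mult_ac flip: power_int_of_nat)
    then have wl: "w ^ l = 1" using primitive_root_unity_powi_eq_1_iff[OF assms(2), of "int (l ^ i)"] by simp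
    have "(\<Sum>e<l. z powi (x + int (e * l ^ (i - 1)))) = (\<Sum>e<l. z powi x * w ^ e)"
    proof (intro sum.cong refl)
      fix e
      have "z powi int (e * l ^ (i - 1)) = w ^ e"
        unfolding w_def by (simp add: power_int_mult[symmetric] mult_ac flip: power_int_of_nat)
      then show "z powi (x + int (e * l ^ (i - 1))) = z powi x * w ^ e"
        using z0 by (simp only: power_int_add simp_thms)
    qed
    also have "\<dots> = z powi x * ((w ^ l - 1) / (w - 1))"
      using geometric_sum[OF w1, of l] by (simp add: sum_distrib_left[symmetric])
    finally show ?thesis using wl by simp
  qed
  with periodic show ?thesis by (simp add: level_def)
qed

lemma sum_periodic_shift:
  assumes "periodic N F"
  shows "(\<Sum>u<N. F (int u + int t)) = (\<Sum>u<N. F (int u) :: 'a::comm_ring_1)"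
proof (induction t)
  case (Suc t)
  let ?g = "\<lambda>u. F (int u + int t)"
  have "(\<Sum>u<N. F (int u + int (Suc t))) = (\<Sum>u<N. ?g (Suc u))"
    by (simp add: add_ac)
  also have "\<dots> = (\<Sum>u<Suc N. ?g u) - ?g 0"
    by (subst sum.lessThan_Suc_shift) simp
  also have "?g 0 = ?g N" by (rule perD[OF assms]) (simp add: cong_def)
  also have "(\<Sum>u<Suc N. ?g u) - ?g N = (\<Sum>u<N. ?g u)" by simp
  finally show ?case using Suc by simp
qed simp

lemma periodic_expand:
  assumes "periodic N f" "N > 0"
  shows "f x = (\<Sum>u<N. f (int u) * of_int (chi N (int u) x) :: 'a::comm_ring_1)"
proof -
  define v where "v = nat (x mod int N)"
  have v: "v < N" "int v = x mod int N" using assms(2) by (auto simp: v_def nat_less_iff)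
  have "(\<Sum>u<N. f (int u) * of_int (chi N (int u) x)) = (\<Sum>u<N. if u = v then f (int v) else 0)"
  proof (intro sum.cong refl)
    fix u assume "u \<in> {..<N}"
    then have "[x = int u] (mod int N) \<longleftrightarrow> u = v"
      using v by (auto simp: cong_def)
    then show "f (int u) * of_int (chi N (int u) x) = (if u = v then f (int v) else 0)"
      by (simp add: chi_def)
  qed
  also have "\<dots> = f (int v)" using v(1) by simp
  also have "\<dots> = f x" by (rule perD[OF assms(1)]) (simp add: v(2))
  finally show ?thesis by simp
qed

lemma sum_periodic_zero:
  fixes h :: "int \<Rightarrow> int"
  assumes "N > 0" "periodic N h" "\<And>u. (\<Sum>s\<in>S. w s * chi N u s) = 0"
  shows "(\<Sum>s\<in>S. w s * h s) = 0"
proof -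
  have "(\<Sum>s\<in>S. w s * h s) = (\<Sum>s\<in>S. w s * (\<Sum>u<N. h (int u) * chi N (int u) s))"
    by (intro sum.cong refl, subst periodic_expand[OF assms(2,1)]) simp
  also have "\<dots> = (\<Sum>s\<in>S. \<Sum>u<N. h (int u) * (w s * chi N (int u) s))"
    unfolding sum_distrib_left by (intro sum.cong refl) (simp add: mult_ac)
  also have "\<dots> = 0"
    by (subst sum.swap) (simp only: sum_distrib_left[symmetric] assms mult_zero_right sum.neutral_const)
  finally show ?thesis .
qed

text \<open>
  Fourier inversion modulo l ^ i. A character that is not of order l ^ i does not see the top
  digit, over which f sums to 0, so its Fourier coefficient vanishes.
\<close>

lemma level_expand:
  fixes f :: "int \<Rightarrow> complex"
  assumes l: "prime l" and f: "f \<in> level l i"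
  obtains S c where "finite S" "\<And>z. z \<in> S \<Longrightarrow> primitive_root_unity (l ^ i) z"
    "\<And>x. f x = (\<Sum>z\<in>S. c z * z powi x)"
proof -
  define N where "N = l ^ i"
  define w where "w = cis (2 * pi / real N)"
  have l0: "l > 0" using prime_gt_0_nat[OF l] .
  have N0: "N > 0" using l0 by (simp add: N_def)
  have w: "primitive_root_unity N w" unfolding w_def by (rule primitive_root_unity_cis[OF N0])
  have w0: "w \<noteq> 0" by (rule primitive_root_unity_nonzero[OF w])
  have fper: "periodic N f" unfolding N_def by (rule level_periodic[OF f])
  define c where "c m = (\<Sum>u<N. f (int u) * w powi (- (int m * int u))) / of_nat N" for m
  have geo: "(\<Sum>m<N. w powi (int m * k)) = of_nat N * of_int (chi N 0 k)" for k
  proof (cases "int N dvd k")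
    case True
    then have "w powi (int m * k) = 1" for m
      using primitive_root_unity_powi_eq_1_iff[OF w] by simp
    then show ?thesis using True by (simp add: chi_def cong_0_iff)
  next
    case False
    define y where "y = w powi k"
    have y: "y \<noteq> 1" unfolding y_def primitive_root_unity_powi_eq_1_iff[OF w] using False .
    have "y ^ N = w powi (k * int N)" by (simp add: y_def power_int_mult)
    then have yN: "y ^ N = 1" using primitive_root_unity_powi_eq_1_iff[OF w] by simp
    have "(\<Sum>m<N. w powi (int m * k)) = (\<Sum>m<N. y ^ m)"
      by (intro sum.cong refl) (simp add: y_def power_int_mult mult.commute[of "int _" k])
    also have "\<dots> = 0" using geometric_sum[OF y, of N] yN by simp
    finally show ?thesis using False by (simp add: chi_def cong_0_iff)
  qed
  have inv: "f x = (\<Sum>m<N. c m * (w ^ m) powi x)" for x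
  proof -
    have "(\<Sum>m<N. c m * (w ^ m) powi x)
        = (\<Sum>m<N. \<Sum>u<N. f (int u) * w powi (int m * (x - int u)) / of_nat N)"
    proof (intro sum.cong refl)
      fix m
      have "w powi (- (int m * int u)) * (w ^ m) powi x = w powi (int m * (x - int u))" for u
      proof -
        have "(w ^ m) powi x = w powi (int m * x)" by (simp add: power_int_mult)
        then show ?thesis using w0
          by (simp add: power_int_add[symmetric] right_diff_distrib)
      qed
      then show "c m * (w ^ m) powi x = (\<Sum>u<N. f (int u) * w powi (int m * (x - int u)) / of_nat N)"
        unfolding c_def sum_divide_distrib sum_distrib_right
        by (intro sum.cong refl) (simp add: mult.assoc)
    qed
    also have "\<dots> = (\<Sum>u<N. f (int u) * (\<Sum>m<N. w powi (int m * (x - int u))) / of_nat N)"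
      by (subst sum.swap) (simp add: sum_distrib_left sum_divide_distrib)
    also have "\<dots> = (\<Sum>u<N. f (int u) * of_int (chi N (int u) x))"
    proof (intro sum.cong refl)
      fix u
      have "chi N 0 (x - int u) = chi N (int u) x"
        by (simp add: chi_def cong_iff_dvd_diff)
      then show "f (int u) * (\<Sum>m<N. w powi (int m * (x - int u))) / of_nat N
          = f (int u) * of_int (chi N (int u) x)"
        unfolding geo using N0 by simp
    qed
    also have "\<dots> = f x" by (rule periodic_expand[OF fper N0, symmetric])
    finally show ?thesis by simp
  qed
  have c0: "c m = 0" if m: "\<not> coprime m N" for m
  proof -
    have i: "i > 0" using m by (cases i) (auto simp: N_def)
    have "l dvd m"
      using m prime_imp_coprime[OF l, of m] by (auto simp: N_def coprime_commute)
    then obtain k where k: "m = l * k" by blast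
    have li: "N = l * l ^ (i - 1)" unfolding N_def using i by (cases i) auto
    define F where "F = (\<lambda>x. f x * w powi (- (int m * x)))"
    have wp: "w powi (- (int m * y)) = w powi (- (int m * x))" if "int N dvd int m * (y - x)" for x y
    proof -
      have "w powi (int m * (y - x)) = 1" using that primitive_root_unity_powi_eq_1_iff[OF w] by simp
      moreover have "- (int m * x) = int m * (y - x) + - (int m * y)" by (simp add: right_diff_distrib)
      then have "w powi (- (int m * x)) = w powi (int m * (y - x)) * w powi (- (int m * y))"
        by (metis power_int_add w0)
      ultimately show ?thesis by simp
    qed
    have Fper: "periodic N F"
      unfolding periodic_def
    proof (intro allI impI)
      fix x y assume xy: "[x = y] (mod int N)"
      then have "int N dvd int m * (x - y)" by (simp add: cong_iff_dvd_diff)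
      then show "F x = F y" unfolding F_def using perD[OF fper xy] wp[of x y] by simp
    qed
    have Fsh: "(\<Sum>e<l. F (x + int (e * l ^ (i - 1)))) = 0" for x
    proof -
      have "F (x + int (e * l ^ (i - 1))) = f (x + int (e * l ^ (i - 1))) * w powi (- (int m * x))" for e
      proof -
        have "int N dvd int m * (x + int (e * l ^ (i - 1)) - x)"
          unfolding k li by (simp add: mult_ac)
        from wp[OF this] show ?thesis unfolding F_def by simp
      qed
      then show ?thesis
        using level_sum[OF f i, of x] by (simp only: sum_distrib_right[symmetric]) simp
    qed
    have "of_nat l * (\<Sum>u<N. F (int u)) = (\<Sum>e<l. \<Sum>u<N. F (int u + int (e * l ^ (i - 1))))"
      by (simp only: sum_periodic_shift[OF Fper]) simp
    also have "\<dots> = 0" by (subst sum.swap) (simp only: Fsh sum.neutral_const)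
    finally have "(\<Sum>u<N. F (int u)) = 0" using l0 by simp
    then show ?thesis by (simp add: c_def F_def)
  qed
  define S where "S = (\<lambda>m. w ^ m) ` {m. m < N \<and> coprime m N}"
  have inj: "inj_on (\<lambda>m. w ^ m) {m. m < N \<and> coprime m N}"
  proof (rule inj_onI)
    fix m n assume mn: "m \<in> {m. m < N \<and> coprime m N}" "n \<in> {m. m < N \<and> coprime m N}" "w ^ m = w ^ n"
    have "w powi (int m - int n) = 1" using mn(3) w0 by (simp add: power_int_diff)
    then have "[int m = int n] (mod int N)"
      unfolding primitive_root_unity_powi_eq_1_iff[OF w] by (simp add: cong_iff_dvd_diff)
    then show "m = n" using mn(1,2) by (simp add: cong_int_iff cong_def)
  qed
  show ?thesis
  proof (rule that[of S "\<lambda>z. c (the_inv_into {m. m < N \<and> coprime m N} (\<lambda>m. w ^ m) z)"])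
    show "finite S" by (simp add: S_def)
    show "primitive_root_unity (l ^ i) z" if z: "z \<in> S" for z
    proof -
      obtain m where m: "coprime m N" "z = w ^ m" using z by (auto simp: S_def)
      have "primitive_root_unity N (w powi (int m * int 1))"
        by (rule primitive_root_unity_powi[OF w]) (use m in auto)
      then show ?thesis using m by (simp add: N_def)
    qed
    fix x
    have "f x = (\<Sum>m\<in>{m. m < N \<and> coprime m N}. c m * (w ^ m) powi x)"
      unfolding inv by (intro sum.mono_neutral_right) (auto simp: c0)
    also have "\<dots> = (\<Sum>z\<in>S. c (the_inv_into {m. m < N \<and> coprime m N} (\<lambda>m. w ^ m) z) * z powi x)"
      unfolding S_def sum.reindex[OF inj]
      by (intro sum.cong refl) (simp add: the_inv_into_f_f[OF inj])
    finally show "f x = \<dots>" .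
  qed
qed

text \<open>
  A spanning set of the level consisting of integer functions: differences of the indicators of two
  classes with the same parent class modulo \<open>l ^ (i - 1)\<close>.
\<close>

definition level_gen :: "nat \<Rightarrow> nat \<Rightarrow> (int \<Rightarrow> int) set" where
  "level_gen l i = (if i = 0 then {\<lambda>_. 1}
     else {\<lambda>x. chi (l ^ i) u x - chi (l ^ i) v x | u v. [u = v] (mod int (l ^ (i - 1)))})"

lemma level_gen_subset_level: "l > 0 \<Longrightarrow> level_gen l i \<subseteq> level l i"
  by (auto simp: level_gen_def intro!: level_chi_diff)

text \<open>
  Since f sums to 0 over the top digit, it is the mean of the functions
  \<open>\<lambda>x. f x - f (x + e * l ^ (i - 1))\<close> over e < l; expand each of them over residue classes.
\<close>

lemma level_span:
  fixes f :: "int \<Rightarrow> complex"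
  assumes l: "l > 0" and f: "f \<in> level l i"
  obtains I :: "(nat \<times> nat) set" and c G where "finite I" "\<And>t. t \<in> I \<Longrightarrow> G t \<in> level_gen l i"
    "\<And>x. f x = (\<Sum>t\<in>I. c t * of_int (G t x))"
proof (cases "i = 0")
  case True
  then obtain c where "f = (\<lambda>_. c)" using f level_0 by blast
  then show ?thesis
    by (intro that[of "{(0,0)}" "\<lambda>_ _. 1" "\<lambda>_. c"]) (auto simp: level_gen_def True)
next
  case False
  then have i: "i > 0" by simp
  define m where "m = l ^ (i - 1)"
  define N where "N = l ^ i"
  have N: "N > 0" using l by (simp add: N_def)
  have fper: "periodic N f" unfolding N_def by (rule level_periodic[OF f])
  define G where "G = (\<lambda>(e::nat,u::nat) x. chi N (int u) x - chi N (int u - int (e * m)) x)"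
  have sh: "chi N (int u) (x + int (e * m)) = chi N (int u - int (e * m)) x" for u e x
    unfolding chi_def cong_iff_dvd_diff by (simp add: algebra_simps)
  show ?thesis
  proof (rule that[of "{..<l} \<times> {..<N}" G "\<lambda>(e,u). f (int u) / of_nat l"])
    show "finite ({..<l} \<times> {..<N})" by simp
    fix t assume "t \<in> {..<l} \<times> {..<N}"
    show "G t \<in> level_gen l i"
    proof (cases t)
      case (Pair e u)
      have "[int u = int u - int (e * m)] (mod int m)"
        by (simp add: cong_iff_dvd_diff)
      then show ?thesis
        unfolding Pair level_gen_def G_def prod.case N_def m_def using i by auto
    qed
  next
    fix x
    have "(\<Sum>t\<in>{..<l} \<times> {..<N}. (case t of (e,u) \<Rightarrow> f (int u) / of_nat l) * of_int (G t x))
        = (\<Sum>e<l. \<Sum>u<N. (f (int u) * of_int (chi N (int u) x)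
              - f (int u) * of_int (chi N (int u) (x + int (e * m)))) / of_nat l)"
      unfolding sum.cartesian_product G_def sh
      by (intro sum.cong refl) (auto simp: field_simps)
    also have "\<dots> = (\<Sum>e<l. (f x - f (x + int (e * m))) / of_nat l)"
      unfolding sum_divide_distrib[symmetric] sum_subtractf periodic_expand[OF fper N, symmetric] ..
    also have "\<dots> = (of_nat l * f x - (\<Sum>e<l. f (x + int (e * m)))) / of_nat l"
      by (simp add: sum_divide_distrib[symmetric] sum_subtractf)
    also have "\<dots> = f x" using level_sum[OF f i, of x] l by (simp add: m_def)
    finally show "f x = (\<Sum>t\<in>{..<l} \<times> {..<N}. (case t of (e,u) \<Rightarrow> f (int u) / of_nat l) * of_int (G t x))"
      by simp
  qed
qed

lemma sum_product3:
  fixes f g h :: "_ \<Rightarrow> 'a::comm_ring_1"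
  shows "sum f I * sum g J * sum h K = (\<Sum>s\<in>I. \<Sum>t\<in>J. \<Sum>u\<in>K. f s * g t * h u)"
proof -
  have "sum f I * sum g J * sum h K = (\<Sum>s\<in>I. (\<Sum>t\<in>J. f s * g t) * sum h K)"
    unfolding sum_product[of f I g J] by (rule sum_distrib_right)
  also have "\<dots> = (\<Sum>s\<in>I. \<Sum>t\<in>J. \<Sum>u\<in>K. f s * g t * h u)"
    by (intro sum.cong refl) (simp only: sum_product)
  finally show ?thesis .
qed

lemma sum_swap3:
  fixes f :: "_ \<Rightarrow> _ \<Rightarrow> _ \<Rightarrow> _ \<Rightarrow> 'a::comm_ring_1"
  shows "(\<Sum>a\<in>A. \<Sum>s\<in>I. \<Sum>t\<in>J. \<Sum>u\<in>K. f a s t u) = (\<Sum>s\<in>I. \<Sum>t\<in>J. \<Sum>u\<in>K. \<Sum>a\<in>A. f a s t u)"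
  by (subst sum.swap, intro sum.cong refl, subst sum.swap, intro sum.cong refl, subst sum.swap) (rule refl)

locale three_primes =
  fixes p q r :: nat
  assumes primes: "prime p" "prime q" "prime r"
    and distinct: "p \<noteq> q" "p \<noteq> r" "q \<noteq> r"
begin

lemma coprime_pows: "coprime (p ^ i) (q ^ j)" "coprime (p ^ i * q ^ j) (r ^ k)"
  using primes distinct by (auto simp: primes_coprime)

text \<open>
  A product of level functions is a combination of products of primitive roots of unity of orders
  p ^ i, q ^ j, r ^ k, and such a product is a primitive root of order \<open>p ^ i * q ^ j * r ^ k\<close>.
\<close>

lemma vanishes_test_complex:
  fixes f g h :: "int \<Rightarrow> complex"
  assumes A: "vanishes A (p ^ i * q ^ j * r ^ k)"
    and f: "f \<in> level p i" and g: "g \<in> level q j" and h: "h \<in> level r k"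
  shows "(\<Sum>a\<in>A. f a * g a * h a) = 0"
proof -
  obtain S1 c1 where 1: "finite S1" "\<And>z. z \<in> S1 \<Longrightarrow> primitive_root_unity (p ^ i) z"
    "\<And>x. f x = (\<Sum>z\<in>S1. c1 z * z powi x)" using level_expand[OF primes(1) f] by blast
  obtain S2 c2 where 2: "finite S2" "\<And>z. z \<in> S2 \<Longrightarrow> primitive_root_unity (q ^ j) z"
    "\<And>x. g x = (\<Sum>z\<in>S2. c2 z * z powi x)" using level_expand[OF primes(2) g] by blast
  obtain S3 c3 where 3: "finite S3" "\<And>z. z \<in> S3 \<Longrightarrow> primitive_root_unity (r ^ k) z"
    "\<And>x. h x = (\<Sum>z\<in>S3. c3 z * z powi x)" using level_expand[OF primes(3) h] by blast
  have "f a * g a * h a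
     = (\<Sum>x\<in>S1. \<Sum>y\<in>S2. \<Sum>z\<in>S3. c1 x * c2 y * c3 z * (x * y * z) powi a)" for a
    unfolding 1(3) 2(3) 3(3) sum_product3 power_int_mult_distrib
    by (intro sum.cong refl) (simp only: mult_ac)
  then have "(\<Sum>a\<in>A. f a * g a * h a)
     = (\<Sum>a\<in>A. \<Sum>x\<in>S1. \<Sum>y\<in>S2. \<Sum>z\<in>S3. c1 x * c2 y * c3 z * (x * y * z) powi a)" by simp
  also have "\<dots> = (\<Sum>x\<in>S1. \<Sum>y\<in>S2. \<Sum>z\<in>S3. \<Sum>a\<in>A. c1 x * c2 y * c3 z * (x * y * z) powi a)"
    by (rule sum_swap3)
  also have "\<dots> = 0"
  proof (rule sum.neutral, rule ballI, rule sum.neutral, rule ballI, rule sum.neutral, rule ballI)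
    fix x y z assume "x \<in> S1" "y \<in> S2" "z \<in> S3"
    then have "primitive_root_unity (p ^ i * q ^ j * r ^ k) (x * y * z)"
      by (intro primitive_root_unity_mult 1 2 3 coprime_pows)
    then show "(\<Sum>a\<in>A. c1 x * c2 y * c3 z * (x * y * z) powi a) = 0"
      using A by (simp add: vanishes_def sum_distrib_left[symmetric])
  qed
  finally show ?thesis .
qed

lemma level_of_int: "f \<in> level l i \<Longrightarrow> (\<lambda>x. of_int (f x) :: complex) \<in> level l i"
  by (simp add: level_def periodic_def of_int_sum[symmetric] del: of_int_sum)

lemma vanishes_test:
  fixes f g h :: "int \<Rightarrow> int"
  assumes "vanishes A (p ^ i * q ^ j * r ^ k)" "f \<in> level p i" "g \<in> level q j" "h \<in> level r k"
  shows "(\<Sum>a\<in>A. f a * g a * h a) = 0"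
proof -
  have "of_int (\<Sum>a\<in>A. f a * g a * h a) = (0::complex)"
    using vanishes_test_complex[OF assms(1) level_of_int[OF assms(2)] level_of_int[OF assms(3)] level_of_int[OF assms(4)]]
    by simp
  then show ?thesis by (simp only: of_int_eq_0_iff)
qed

text \<open>
  Conversely, every primitive root of order \<open>p ^ i * q ^ j * r ^ k\<close> is such a product, and its factors
  lie in the spans of the generators.
\<close>

lemma vanishes_intro:
  assumes *: "\<And>f g h. f \<in> level_gen p i \<Longrightarrow> g \<in> level_gen q j \<Longrightarrow> h \<in> level_gen r k \<Longrightarrow> (\<Sum>a\<in>A. f a * g a * h a) = 0"
  shows "vanishes A (p ^ i * q ^ j * r ^ k)"
  unfolding vanishes_def
proof (intro allI impI)
  fix w assume w: "primitive_root_unity (p ^ i * q ^ j * r ^ k) w"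
  obtain w' z where z: "primitive_root_unity (p ^ i * q ^ j) w'" "primitive_root_unity (r ^ k) z" "w = w' * z"
    using primitive_root_unity_split[OF w coprime_pows(2)] by blast
  obtain x y where xy: "primitive_root_unity (p ^ i) x" "primitive_root_unity (q ^ j) y" "w' = x * y"
    using primitive_root_unity_split[OF z(1) coprime_pows(1)] by blast
  have pos: "p > 0" "q > 0" "r > 0" using primes prime_gt_0_nat by auto
  obtain I1 :: "(nat \<times> nat) set" and c1 G1 where 1: "finite I1" "\<And>t. t \<in> I1 \<Longrightarrow> G1 t \<in> level_gen p i"
    "\<And>a. x powi a = (\<Sum>t\<in>I1. c1 t * of_int (G1 t a))"
    by (rule level_span[OF pos(1) powi_in_level[OF primes(1) xy(1)]]) (rule that)
  obtain I2 :: "(nat \<times> nat) set" and c2 G2 where 2: "finite I2" "\<And>t. t \<in> I2 \<Longrightarrow> G2 t \<in> level_gen q j"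
    "\<And>a. y powi a = (\<Sum>t\<in>I2. c2 t * of_int (G2 t a))"
    by (rule level_span[OF pos(2) powi_in_level[OF primes(2) xy(2)]]) (rule that)
  obtain I3 :: "(nat \<times> nat) set" and c3 G3 where 3: "finite I3" "\<And>t. t \<in> I3 \<Longrightarrow> G3 t \<in> level_gen r k"
    "\<And>a. z powi a = (\<Sum>t\<in>I3. c3 t * of_int (G3 t a))"
    by (rule level_span[OF pos(3) powi_in_level[OF primes(3) z(2)]]) (rule that)
  have "w powi a = (\<Sum>s\<in>I1. \<Sum>t\<in>I2. \<Sum>u\<in>I3. c1 s * c2 t * c3 u * of_int (G1 s a * G2 t a * G3 u a))" for a
    unfolding z(3) xy(3) power_int_mult_distrib 1(3) 2(3) 3(3) sum_product3 of_int_mult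
    by (intro sum.cong refl) (simp only: mult_ac)
  then have "(\<Sum>a\<in>A. w powi a)
     = (\<Sum>a\<in>A. \<Sum>s\<in>I1. \<Sum>t\<in>I2. \<Sum>u\<in>I3. c1 s * c2 t * c3 u * of_int (G1 s a * G2 t a * G3 u a))" by simp
  also have "\<dots> = (\<Sum>s\<in>I1. \<Sum>t\<in>I2. \<Sum>u\<in>I3. \<Sum>a\<in>A. c1 s * c2 t * c3 u * of_int (G1 s a * G2 t a * G3 u a))"
    by (rule sum_swap3)
  also have "\<dots> = 0"
  proof (rule sum.neutral, rule ballI, rule sum.neutral, rule ballI, rule sum.neutral, rule ballI)
    fix s t u assume "s \<in> I1" "t \<in> I2" "u \<in> I3"
    then have "(\<Sum>a\<in>A. G1 s a * G2 t a * G3 u a) = 0" by (intro * 1 2 3)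
    then have "(of_int (\<Sum>a\<in>A. G1 s a * G2 t a * G3 u a) :: complex) = 0" by simp
    then show "(\<Sum>a\<in>A. c1 s * c2 t * c3 u * of_int (G1 s a * G2 t a * G3 u a)) = 0"
      by (simp only: sum_distrib_left[symmetric] of_int_sum[symmetric]) simp
  qed
  finally show "(\<Sum>a\<in>A. w powi a) = 0" .
qed

end

section \<open>Cyclotomic divisors of Laurent polynomials\<close>

text \<open>
  The linear extension of \<open>single k 1 \<mapsto> g k\<close>. It is evaluation at z for \<open>g k = z powi k\<close>, and it
  counts exponents in a residue class for \<open>g = chi m u\<close>.
\<close>

definition lin_ext :: "(int \<Rightarrow> 'a::comm_ring_1) \<Rightarrow> laurent \<Rightarrow> 'a" where
  "lin_ext g L = (\<Sum>k\<in>Poly_Mapping.keys L. of_int (Poly_Mapping.lookup L k) * g k)"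

lemma lin_ext_add: "lin_ext g (K + L) = lin_ext g K + lin_ext g L"
  unfolding lin_ext_def by (rule setsum_keys_plus_distrib) (auto simp: distrib_right)

lemma lin_ext_0 [simp]: "lin_ext g 0 = 0"
  by (simp add: lin_ext_def)

lemma lin_ext_diff: "lin_ext g (K - L) = lin_ext g K - lin_ext g L"
  using lin_ext_add[of g "K - L" L] by simp

lemma lin_ext_single: "lin_ext g (Poly_Mapping.single a c) = of_int c * g a"
  by (cases "c = 0") (auto simp: lin_ext_def)

lemma lin_ext_sum: "lin_ext g (\<Sum>i\<in>I. F i) = (\<Sum>i\<in>I. lin_ext g (F i))"
  by (induction I rule: infinite_finite_induct) (auto simp: lin_ext_add)

lemma lin_ext_char: "lin_ext g (char_poly_set A) = (\<Sum>a\<in>A. g a)"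
  by (simp add: char_poly_set_def lin_ext_sum lin_ext_single)

lemma laurent_induct [case_names zero one diff]:
  fixes L :: laurent
  assumes "P 0" "\<And>x. P (Poly_Mapping.single x 1)" "\<And>a b. P a \<Longrightarrow> P b \<Longrightarrow> P (a - b)"
  shows "P L"
  by (rule frag_induction[of L UNIV]) (use assms in auto)

lemma lin_ext_mult_single: "lin_ext g (Poly_Mapping.single a 1 * L) = lin_ext (\<lambda>k. g (a + k)) L"
  by (induction L rule: laurent_induct) (auto simp: mult_single lin_ext_single lin_ext_diff right_diff_distrib)

lemma lin_ext_hom:
  assumes "\<And>a b. g (a + b) = g a * g b"
  shows "lin_ext g (K * L) = lin_ext g K * lin_ext g L"
proof (induction K rule: laurent_induct)
  case (one x)
  have "lin_ext (\<lambda>k. g x * g k) L = g x * lin_ext g L"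
    by (simp add: lin_ext_def sum_distrib_left mult_ac)
  then show ?case by (simp add: lin_ext_mult_single assms lin_ext_single)
qed (auto simp: left_diff_distrib lin_ext_diff)

lemma laurent_of_poly_ge:
  assumes "degree f \<le> n"
  shows "laurent_of_poly f = (\<Sum>i\<le>n. Poly_Mapping.single (int i) (coeff f i))"
  unfolding laurent_of_poly_def
  by (rule sum.mono_neutral_left) (use assms in \<open>auto simp: coeff_eq_0\<close>)

lemma laurent_of_poly_add: "laurent_of_poly (f + g) = laurent_of_poly f + laurent_of_poly g"
proof -
  let ?n = "max (degree f) (degree g)"
  have "degree (f + g) \<le> ?n" by (rule degree_add_le) auto
  then show ?thesis
    by (simp add: laurent_of_poly_ge[of _ ?n] single_add sum.distrib)
qed

lemma laurent_of_poly_smult: "laurent_of_poly (smult c f) = Poly_Mapping.single 0 c * laurent_of_poly f"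
  by (subst (1 2) laurent_of_poly_ge[of _ "degree f"]) (auto simp: degree_smult_le sum_distrib_left mult_single)

lemma laurent_of_poly_pCons: "laurent_of_poly (pCons c f) = Poly_Mapping.single 0 c + Poly_Mapping.single 1 1 * laurent_of_poly f"
proof -
  have "laurent_of_poly (pCons c f) = (\<Sum>i\<le>Suc (degree f). Poly_Mapping.single (int i) (coeff (pCons c f) i))"
    by (rule laurent_of_poly_ge) (simp add: degree_pCons_le)
  also have "\<dots> = Poly_Mapping.single 0 c + (\<Sum>i\<le>degree f. Poly_Mapping.single (int (Suc i)) (coeff f i))"
    by (subst sum.atMost_Suc_shift) simp
  also have "(\<Sum>i\<le>degree f. Poly_Mapping.single (int (Suc i)) (coeff f i)) = Poly_Mapping.single 1 1 * laurent_of_poly f"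
    by (simp add: laurent_of_poly_def sum_distrib_left mult_single)
  finally show ?thesis .
qed

lemma laurent_of_poly_0 [simp]: "laurent_of_poly 0 = 0"
  by (simp add: laurent_of_poly_def)

lemma laurent_of_poly_mult: "laurent_of_poly (f * g) = laurent_of_poly f * laurent_of_poly g"
proof (induction f)
  case (pCons a f)
  have "laurent_of_poly (pCons a f * g) = laurent_of_poly (smult a g) + laurent_of_poly (pCons 0 (f * g))"
    by (simp add: laurent_of_poly_add)
  also have "\<dots> = laurent_of_poly (pCons a f) * laurent_of_poly g"
    unfolding laurent_of_poly_pCons laurent_of_poly_smult pCons.IH by (simp add: algebra_simps)
  finally show ?case .
qed simp

lemma laurent_of_poly_monom: "laurent_of_poly (monom 1 n) = Poly_Mapping.single (int n) 1"
  by (subst laurent_of_poly_ge[of _ n]) (auto simp: degree_monom_eq if_distrib sum.delta cong: if_cong)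

lemma laurent_of_poly_sum: "laurent_of_poly (\<Sum>i\<in>I. F i) = (\<Sum>i\<in>I. laurent_of_poly (F i))"
  by (induction I rule: infinite_finite_induct) (auto simp: laurent_of_poly_add)

lemma lin_ext_laurent_of_poly: "lin_ext (\<lambda>k. z powi k) (laurent_of_poly f) = poly (map_poly of_int f) (z::complex)"
proof -
  have "degree (map_poly of_int f :: complex poly) = degree f" by (rule degree_map_poly) auto
  then show ?thesis
    by (simp add: laurent_of_poly_def lin_ext_sum lin_ext_single poly_altdef coeff_map_poly)
qed

lemma poly_cyclotomic_0:
  "poly (map_poly of_int (cyclotomic s)) z = 0 \<longleftrightarrow> primitive_root_unity s z"
  using finite_primitive_root_unity[of s] by (simp add: map_poly_cyclotomic poly_prod)

lemma lead_coeff_cyclotomic: "lead_coeff (cyclotomic s) = 1"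
proof -
  obtain f :: "int poly" where f: "lead_coeff f = 1"
    "map_poly of_int f = (\<Prod>z | primitive_root_unity s z. [:- z, 1:])"
    using exists_int_cyclotomic by blast
  have "map_poly of_int f = (map_poly of_int (cyclotomic s) :: complex poly)"
    using f(2) map_poly_cyclotomic by simp
  then have "f = cyclotomic s" by (auto simp: poly_eq_iff coeff_map_poly)
  with f show ?thesis by simp
qed

lemma degree_cyclotomic: "degree (cyclotomic s) = card {z. primitive_root_unity s z}"
proof -
  have "degree (cyclotomic s) = degree (map_poly of_int (cyclotomic s) :: complex poly)"
    by (rule degree_map_poly[symmetric]) auto
  also have "\<dots> = card {z. primitive_root_unity s z}"
    unfolding map_poly_cyclotomic by (subst degree_prod_eq_sum_degree) auto
  finally show ?thesis .
qed

text \<open>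
  For the implication from right to left, multiply by a monomial to get an ordinary polynomial and
  divide it by the monic polynomial \<open>cyclotomic s\<close>: the remainder vanishes at all the roots of
  \<open>cyclotomic s\<close>, which are more than its degree allows.
\<close>

lemma cyclotomic_dvd_iff_vanishes:
  assumes fin: "finite A"
  shows "laurent_of_poly (cyclotomic s) dvd char_poly_set A \<longleftrightarrow> vanishes A s"
proof
  assume "laurent_of_poly (cyclotomic s) dvd char_poly_set A"
  then obtain K where K: "char_poly_set A = laurent_of_poly (cyclotomic s) * K" by blast
  show "vanishes A s" unfolding vanishes_def
  proof (intro allI impI)
    fix z assume z: "primitive_root_unity s z"
    have z0: "z \<noteq> 0" by (rule primitive_root_unity_nonzero[OF z])
    have "(\<Sum>a\<in>A. z powi a) = lin_ext (\<lambda>k. z powi k) (laurent_of_poly (cyclotomic s) * K)"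
      unfolding K[symmetric] lin_ext_char ..
    also have "\<dots> = 0"
      using z z0 by (simp add: lin_ext_hom power_int_add lin_ext_laurent_of_poly poly_cyclotomic_0)
    finally show "(\<Sum>a\<in>A. z powi a) = 0" .
  qed
next
  assume vanishes: "vanishes A s"
  define N where "N = (\<Sum>a\<in>A. \<bar>a\<bar>)"
  have N: "a + N \<ge> 0" if "a \<in> A" for a
    using member_le_sum[OF that _ fin, of abs] by (simp add: N_def)
  define P :: "int poly" where "P = (\<Sum>a\<in>A. monom 1 (nat (a + N)))"
  let ?m = "map_poly of_int :: int poly \<Rightarrow> complex poly"
  have lofP: "laurent_of_poly P = Poly_Mapping.single N 1 * char_poly_set A"
    unfolding P_def laurent_of_poly_sum laurent_of_poly_monom char_poly_set_def sum_distrib_left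
    by (intro sum.cong refl) (simp add: N mult_single add.commute)
  obtain Q R where qr: "pseudo_divmod P (cyclotomic s) = (Q, R)" by fastforce
  have c0: "cyclotomic s \<noteq> 0" using lead_coeff_cyclotomic[of s] by force
  have eq: "P = cyclotomic s * Q + R"
    using pseudo_divmod(1)[OF c0 qr] by (simp add: lead_coeff_cyclotomic)
  have degR: "R = 0 \<or> degree R < degree (cyclotomic s)" using pseudo_divmod(2)[OF c0 qr] .
  have root: "poly (?m R) z = 0" if z: "primitive_root_unity s z" for z
  proof -
    have z0: "z \<noteq> 0" by (rule primitive_root_unity_nonzero[OF z])
    have "poly (?m P) z = lin_ext (\<lambda>k. z powi k) (Poly_Mapping.single N 1 * char_poly_set A)"
      unfolding lofP[symmetric] lin_ext_laurent_of_poly ..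
    also have "\<dots> = 0"
      using vanishes z z0 by (simp add: lin_ext_hom power_int_add lin_ext_char vanishes_def)
    finally have "poly (?m (cyclotomic s * Q + R)) z = 0" unfolding eq .
    then show ?thesis
      using z poly_cyclotomic_0[of s z] by (simp add: of_int_poly_add of_int_poly_mult)
  qed
  have "R = 0"
  proof (rule ccontr)
    assume R: "R \<noteq> 0"
    then have mR: "?m R \<noteq> 0" by (simp add: map_poly_eq_0_iff)
    have "card {z. primitive_root_unity s z} \<le> card {z. poly (?m R) z = 0}"
      by (rule card_mono) (use mR root in \<open>auto simp: poly_roots_finite\<close>)
    also have "\<dots> \<le> degree (?m R)" by (rule card_poly_roots_bound[OF mR])
    also have "\<dots> = degree R" by (rule degree_map_poly) auto
    finally show False using degR R degree_cyclotomic[of s] by simp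
  qed
  then have "Poly_Mapping.single N 1 * char_poly_set A = laurent_of_poly (cyclotomic s) * laurent_of_poly Q"
    using eq lofP laurent_of_poly_mult by simp
  then have "Poly_Mapping.single (- N) 1 * (Poly_Mapping.single N 1 * char_poly_set A)
     = laurent_of_poly (cyclotomic s) * (Poly_Mapping.single (- N) 1 * laurent_of_poly Q)"
    by (simp add: mult_ac)
  then have "char_poly_set A = laurent_of_poly (cyclotomic s) * (Poly_Mapping.single (- N) 1 * laurent_of_poly Q)"
    by (simp add: mult.assoc[symmetric] mult_single)
  then show "laurent_of_poly (cyclotomic s) dvd char_poly_set A" by (rule dvdI)
qed

section \<open>Tilings and their dilates\<close>

text \<open>
  Given the cardinalities, unique representation modulo M amounts to injectivity of addition,
  which by counting can also be checked through surjectivity (\<open>tiling_surjI\<close>).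
\<close>

definition tiling :: "int set \<Rightarrow> int set \<Rightarrow> nat \<Rightarrow> bool" where
  "tiling A B M \<longleftrightarrow> finite A \<and> finite B \<and> M > 0 \<and> card A * card B = M \<and>
     inj_on (\<lambda>(a, b). (a + b) mod int M) (A \<times> B)"

lemma tiling_surjI:
  assumes "finite A" "finite B" "M > 0" "card A * card B = M"
    and surj: "\<And>u. \<exists>a\<in>A. \<exists>b\<in>B. [a + b = u] (mod int M)"
  shows "tiling A B M"
proof -
  let ?f = "\<lambda>(a, b). (a + b) mod int M"
  have "{0..<int M} \<subseteq> ?f ` (A \<times> B)"
  proof
    fix u assume u: "u \<in> {0..<int M}"
    obtain a b where "a \<in> A" "b \<in> B" "[a + b = u] (mod int M)" using surj by blast
    then show "u \<in> ?f ` (A \<times> B)"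
      using u by (intro rev_image_eqI[of "(a, b)"]) (auto simp: cong_def)
  qed
  moreover have "?f ` (A \<times> B) \<subseteq> {0..<int M}" using assms(3) by auto
  ultimately have "?f ` (A \<times> B) = {0..<int M}" by blast
  then have "card (?f ` (A \<times> B)) = M" by simp
  then have "inj_on ?f (A \<times> B)"
    using assms by (intro eq_card_imp_inj_on) (auto simp: card_cartesian_product)
  then show ?thesis using assms by (simp add: tiling_def)
qed

lemma tiling_image:
  assumes "tiling A B M"
  shows "(\<lambda>(a, b). (a + b) mod int M) ` (A \<times> B) = {0..<int M}"
proof (rule card_subset_eq)
  show "(\<lambda>(a, b). (a + b) mod int M) ` (A \<times> B) \<subseteq> {0..<int M}"
    using assms by (auto simp: tiling_def)
  show "card ((\<lambda>(a, b). (a + b) mod int M) ` (A \<times> B)) = card {0..<int M}"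
    using assms unfolding tiling_def by (subst card_image) (auto simp: card_cartesian_product)
qed simp

lemma tiling_sum:
  assumes "tiling A B M" and periodic: "periodic M f"
  shows "(\<Sum>a\<in>A. \<Sum>b\<in>B. f (a + b)) = (\<Sum>u\<in>{0..<int M}. f u :: 'a::comm_ring_1)"
proof -
  have inj: "inj_on (\<lambda>(a, b). (a + b) mod int M) (A \<times> B)" using assms(1) by (simp add: tiling_def)
  have "(\<Sum>u\<in>{0..<int M}. f u) = (\<Sum>(a, b)\<in>A \<times> B. f ((a + b) mod int M))"
    unfolding tiling_image[OF assms(1), symmetric] sum.reindex[OF inj] by (simp add: case_prod_unfold)
  also have "\<dots> = (\<Sum>(a, b)\<in>A \<times> B. f (a + b))"
    by (intro sum.cong refl) (auto intro!: perD[OF periodic] simp: cong_def)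
  finally show ?thesis by (simp add: sum.cartesian_product)
qed

lemma tiles_cyclic_tiling: "tiles_cyclic A B M \<Longrightarrow> tiling A B M"
proof (rule tiling_surjI)
  assume t: "tiles_cyclic A B M"
  then show "finite A" "finite B" "M > 0" "card A * card B = M" by (auto simp: tiles_cyclic_def)
  fix u
  obtain ac where ac: "ac \<in> A \<times> {b + int M * k | b k. b \<in> B}" "u = fst ac + snd ac"
    using t unfolding tiles_cyclic_def by blast
  then have "snd ac \<in> {b + int M * k | b k. b \<in> B}" by (simp add: mem_Times_iff)
  then obtain b k where b: "b \<in> B" "snd ac = b + int M * k" by blast
  have "[fst ac + b = u] (mod int M)"
    unfolding ac(2) b(2) by (simp add: cong_iff_dvd_diff)
  then show "\<exists>a\<in>A. \<exists>b\<in>B. [a + b = u] (mod int M)" using ac b by (auto simp: mem_Times_iff)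
qed

lemma single_power: "(Poly_Mapping.single a 1 :: laurent) ^ n = Poly_Mapping.single (int n * a) 1"
  by (induction n) (auto simp: mult_single algebra_simps)

lemma add_power_prime:
  fixes x y :: "'a::comm_ring_1"
  assumes "prime l"
  shows "\<exists>z. (x + y) ^ l = x ^ l + y ^ l + of_nat l * z"
proof -
  have l: "l > 1" by (rule prime_gt_1_nat[OF assms])
  have "(x + y) ^ l = (\<Sum>k\<le>l. of_nat (l choose k) * x ^ k * y ^ (l - k))" by (rule binomial_ring)
  also have "{..l} = insert 0 (insert l {0<..<l})" using l by auto
  also have "(\<Sum>k\<in>insert 0 (insert l {0<..<l}). of_nat (l choose k) * x ^ k * y ^ (l - k))
     = x ^ l + y ^ l + (\<Sum>k\<in>{0<..<l}. of_nat (l choose k) * x ^ k * y ^ (l - k))"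
    using l by simp
  also have "(\<Sum>k\<in>{0<..<l}. of_nat (l choose k) * x ^ k * y ^ (l - k))
     = (\<Sum>k\<in>{0<..<l}. of_nat l * (of_nat ((l choose k) div l) * x ^ k * y ^ (l - k)))"
  proof (intro sum.cong refl)
    fix k assume "k \<in> {0<..<l}"
    then have "l dvd (l choose k)" using assms by (intro dvd_choose_prime) auto
    then have "of_nat (l choose k) = (of_nat l * of_nat ((l choose k) div l) :: 'a)"
      by (metis dvd_mult_div_cancel of_nat_mult)
    then show "of_nat (l choose k) * x ^ k * y ^ (l - k)
        = of_nat l * (of_nat ((l choose k) div l) * x ^ k * y ^ (l - k))"
      by (simp add: mult.assoc)
  qed
  finally show ?thesis unfolding sum_distrib_left[symmetric] by blast
qed

lemma char_power_prime:
  assumes "prime l" "finite A"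
  shows "\<exists>Z. char_poly_set A ^ l = (\<Sum>a\<in>A. Poly_Mapping.single (int l * a) 1) + of_nat l * Z"
  using assms(2)
proof (induction A)
  case empty
  have "(0::laurent) ^ l = 0" using prime_gt_0_nat[OF assms(1)] by simp
  then show ?case by (intro exI[of _ 0]) (simp add: char_poly_set_def)
next
  case (insert x A)
  obtain Z where Z: "char_poly_set A ^ l = (\<Sum>a\<in>A. Poly_Mapping.single (int l * a) 1) + of_nat l * Z"
    using insert.IH by blast
  have "char_poly_set (insert x A) = Poly_Mapping.single x 1 + char_poly_set A"
    using insert.hyps by (simp add: char_poly_set_def)
  moreover obtain z where "(Poly_Mapping.single x 1 + char_poly_set A) ^ l
     = Poly_Mapping.single x 1 ^ l + char_poly_set A ^ l + of_nat l * z"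
    using add_power_prime[OF assms(1)] by blast
  ultimately have "char_poly_set (insert x A) ^ l
     = (\<Sum>a\<in>insert x A. Poly_Mapping.single (int l * a) 1) + of_nat l * (Z + z)"
    using insert.hyps unfolding Z single_power by (simp add: algebra_simps)
  then show ?case by blast
qed

lemma lin_ext_char_mult: "lin_ext g (char_poly_set A * char_poly_set B) = (\<Sum>a\<in>A. \<Sum>b\<in>B. g (a + b))"
  unfolding char_poly_set_def[of A] sum_distrib_right lin_ext_sum lin_ext_mult_single lin_ext_char ..

lemma tiling_chi_sum:
  assumes "tiling A B M"
  shows "(\<Sum>a\<in>A. \<Sum>b\<in>B. chi M u (a + b)) = 1"
proof -
  have M: "int M > 0" using assms by (simp add: tiling_def)
  have "(\<Sum>x\<in>{0..<int M}. chi M u x) = (\<Sum>x\<in>{0..<int M}. if x = u mod int M then 1 else 0)"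
    by (intro sum.cong refl) (auto simp: chi_def cong_def)
  also have "\<dots> = 1" using M by simp
  finally show ?thesis using tiling_sum[OF assms periodic_chi[of M u]] by simp
qed

lemma tiling_lin_ext_mult:
  assumes "tiling A B M"
  shows "lin_ext (chi M u) (K * (char_poly_set A * char_poly_set B)) = lin_ext (\<lambda>_. 1) K"
proof (induction K rule: laurent_induct)
  case (one x)
  have "chi M u (x + k) = chi M (u - x) k" for k
    by (simp add: chi_def cong_iff_dvd_diff algebra_simps)
  then have "lin_ext (chi M u) (Poly_Mapping.single x 1 * (char_poly_set A * char_poly_set B)) = 1"
    unfolding lin_ext_mult_single by (simp add: lin_ext_char_mult tiling_chi_sum[OF assms])
  then show ?case by (simp add: lin_ext_single)
qed (auto simp: left_diff_distrib lin_ext_diff)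

lemma lin_ext_of_nat_mult: "lin_ext g (of_nat l * K) = of_nat l * lin_ext g K"
  by (induction l) (auto simp: distrib_right lin_ext_add)

text \<open>
  Modulo the prime l, the polynomial of the dilate of A by l is the l-th power of \<open>A(x)\<close>. So
  the number of representations of a class u by the dilate and B is congruent modulo l to the
  mass that \<open>A(x) ^ (l - 1) * (A(x) * B(x))\<close> puts on u. As \<open>A(x) * B(x)\<close> has mass 1 on every
  class, this is \<open>card A ^ (l - 1)\<close>, which is nonzero modulo l: every class is represented.
\<close>

lemma tiling_dilate_prime:
  assumes t: "tiling A B M" and l: "prime l" "\<not> l dvd M"
  shows "tiling ((\<lambda>a. int l * a) ` A) B M"
proof (rule tiling_surjI)
  show "finite ((\<lambda>a. int l * a) ` A)" "finite B" "M > 0" using t by (auto simp: tiling_def)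
  have inj: "inj_on (\<lambda>a. int l * a) A" using prime_gt_0_nat[OF l(1)] by (auto intro: inj_onI)
  then show "card ((\<lambda>a. int l * a) ` A) * card B = M" using t by (simp add: tiling_def card_image)
  fix u
  obtain Z where Z: "char_poly_set A ^ l = (\<Sum>a\<in>A. Poly_Mapping.single (int l * a) 1) + of_nat l * Z"
    using char_power_prime[OF l(1), of A] t by (auto simp: tiling_def)
  have A': "char_poly_set ((\<lambda>a. int l * a) ` A) = char_poly_set A ^ l - of_nat l * Z"
  proof -
    have "char_poly_set ((\<lambda>a. int l * a) ` A) = (\<Sum>a\<in>A. Poly_Mapping.single (int l * a) 1)"
      unfolding char_poly_set_def sum.reindex[OF inj] by simp
    with Z show ?thesis by simp
  qed
  have "char_poly_set A ^ l = char_poly_set A ^ (l - 1) * char_poly_set A"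
    using prime_gt_0_nat[OF l(1)] by (cases l) (auto simp: mult.commute)
  then have "char_poly_set ((\<lambda>a. int l * a) ` A) * char_poly_set B
     = char_poly_set A ^ (l - 1) * (char_poly_set A * char_poly_set B) - of_nat l * (Z * char_poly_set B)"
    unfolding A' by (simp add: left_diff_distrib mult.assoc)
  then have "lin_ext (chi M u) (char_poly_set ((\<lambda>a. int l * a) ` A) * char_poly_set B)
     = lin_ext (\<lambda>_. 1) (char_poly_set A ^ (l - 1)) - int l * lin_ext (chi M u) (Z * char_poly_set B)"
    by (simp add: lin_ext_diff tiling_lin_ext_mult[OF t] lin_ext_of_nat_mult)
  also have "lin_ext (\<lambda>_. 1) (char_poly_set A ^ n) = int (card A) ^ n" for n
    by (induction n) (auto simp: lin_ext_hom lin_ext_char lin_ext_single[of _ 0 1, simplified])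
  finally have eq: "(\<Sum>a\<in>(\<lambda>a. int l * a) ` A. \<Sum>b\<in>B. chi M u (a + b))
     = int (card A) ^ (l - 1) - int l * lin_ext (chi M u) (Z * char_poly_set B)"
    unfolding lin_ext_char_mult .
  have "(\<Sum>a\<in>(\<lambda>a. int l * a) ` A. \<Sum>b\<in>B. chi M u (a + b)) \<noteq> 0"
  proof
    assume "(\<Sum>a\<in>(\<lambda>a. int l * a) ` A. \<Sum>b\<in>B. chi M u (a + b)) = 0"
    then have "int l dvd int (card A) ^ (l - 1)" unfolding eq by (simp add: dvd_def)
    then have "l dvd card A ^ (l - 1)" by (metis of_nat_power int_dvd_int_iff)
    then have "l dvd card A" using l(1) prime_dvd_power by blast
    moreover have "card A dvd M" using t by (auto simp: tiling_def)
    ultimately show False using l(2) dvd_trans by blast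
  qed
  then obtain a where a: "a \<in> (\<lambda>a. int l * a) ` A" "(\<Sum>b\<in>B. chi M u (a + b)) \<noteq> 0"
    by (meson sum.neutral)
  then obtain b where b: "b \<in> B" "chi M u (a + b) \<noteq> 0" by (meson sum.neutral)
  then show "\<exists>a\<in>(\<lambda>a. int l * a) ` A. \<exists>b\<in>B. [a + b = u] (mod int M)"
    using a by (auto simp: chi_def)
qed

lemma tiling_dilate:
  assumes "tiling A B M" "coprime n M" "n > 0"
  shows "tiling ((\<lambda>a. int n * a) ` A) B M"
  using assms(3,2,1)
proof (induction n arbitrary: A rule: prime_divisors_induct)
  case (factor l n)
  have "l dvd l * n" by simp
  then have "\<not> l dvd M"
    using factor.prems(2) factor.hyps prime_gt_1_nat[of l] not_prime_unit
    by (metis coprime_common_divisor)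
  then have 1: "tiling ((\<lambda>a. int l * a) ` A) B M" using tiling_dilate_prime factor by blast
  have "tiling ((\<lambda>a. int n * a) ` (\<lambda>a. int l * a) ` A) B M"
    by (rule factor.IH[OF _ _ 1]) (use factor.prems in auto)
  then show ?case by (simp add: image_image mult_ac)
qed auto

text \<open>
  Add to m the multiple \<open>s * k\<close> of s, where k is the product of the primes that divide M
  but not m; a further multiple of M covers the degenerate value 0.
\<close>

lemma coprime_lift:
  fixes m s M :: nat
  assumes "coprime m s" "M > 0"
  obtains n where "n > 0" "coprime n M" "[n = m] (mod s)"
proof -
  define k where "k = \<Prod>{l. prime l \<and> l dvd M \<and> \<not> l dvd m}"
  have fin: "finite {l. prime l \<and> l dvd M \<and> \<not> l dvd m}"
    by (rule finite_subset[of _ "{..M}"]) (use assms in \<open>auto dest: dvd_imp_le\<close>)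
  have notdvd: "\<not> l dvd m + s * k" if l: "prime l" "l dvd M" for l
  proof (cases "l dvd m")
    case True
    then have "\<not> l dvd s" using assms(1) l by (metis coprime_common_divisor not_prime_unit)
    moreover have "\<not> l dvd k"
    proof
      assume "l dvd k"
      then obtain l' where "prime l'" "\<not> l' dvd m" "l dvd l'"
        unfolding k_def using prime_dvd_prod_iff[OF fin l(1), of id] by auto
      then show False using True l(1) primes_dvd_imp_eq by blast
    qed
    ultimately show ?thesis using True l(1) by (simp add: dvd_add_right_iff prime_dvd_mult_iff)
  next
    case False
    then have "l dvd k" unfolding k_def using l fin by (intro dvd_prodI) auto
    then show ?thesis using False by (simp add: dvd_add_left_iff)
  qed
  show ?thesis
  proof (rule that[of "m + s * k + s * M * (if m + s * k = 0 then 1 else 0)"])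
    show "[m + s * k + s * M * (if m + s * k = 0 then 1 else 0) = m] (mod s)"
      by (auto simp: cong_def)
    have "coprime (m + s * k) M"
    proof (rule ccontr)
      assume "\<not> coprime (m + s * k) M"
      then obtain l where "prime l" "l dvd gcd (m + s * k) M"
        using prime_factor_nat[of "gcd (m + s * k) M"] by (auto simp: coprime_iff_gcd_eq_1)
      then show False using notdvd[of l] by simp
    qed
    then show "coprime (m + s * k + s * M * (if m + s * k = 0 then 1 else 0)) M"
      by (cases "m + s * k = 0") auto
    show "0 < m + s * k + s * M * (if m + s * k = 0 then 1 else 0)"
      using assms by (cases "s = 0") auto
  qed
qed

text \<open>
  Every root of unity of order dividing M other than 1 annihilates the product \<open>A(x) * B(x)\<close> of a
  tiling. If y, z are primitive s-th roots with \<open>A(y) \<noteq> 0\<close>, \<open>B(z) \<noteq> 0\<close>, write \<open>y = z ^ n\<close> with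
  n coprime to M; then the tiling by the dilate of A by n and B violates this at z.
\<close>

lemma tiling_dichotomy:
  assumes t: "tiling A B M" and s: "s dvd M" "s > 1"
  shows "vanishes A s \<or> vanishes B s"
proof (rule ccontr)
  assume "\<not> (vanishes A s \<or> vanishes B s)"
  then obtain y z where z: "primitive_root_unity s z" "(\<Sum>b\<in>B. z powi b) \<noteq> 0"
    and y: "primitive_root_unity s y" "(\<Sum>a\<in>A. y powi a) \<noteq> 0" by (auto simp: vanishes_def)
  have M: "M > 0" using t by (simp add: tiling_def)
  have z0: "z \<noteq> 0" by (rule primitive_root_unity_nonzero[OF z(1)])
  have inj: "inj_on (\<lambda>m. z ^ m) {..<s}"
  proof (rule inj_onI)
    fix m n assume mn: "m \<in> {..<s}" "n \<in> {..<s}" "z ^ m = z ^ n"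
    have "z powi (int m - int n) = 1" using mn(3) z0 by (simp add: power_int_diff)
    then have "[int m = int n] (mod int s)"
      unfolding primitive_root_unity_powi_eq_1_iff[OF z(1)] by (simp add: cong_iff_dvd_diff)
    then show "m = n" using mn(1,2) by (simp add: cong_int_iff cong_def)
  qed
  have "(\<lambda>m. z ^ m) ` {..<s} = {x. x ^ s = 1}"
  proof (rule card_seteq)
    show "finite {x::complex. x ^ s = 1}" using finite_roots_unity[of s, where 'a = complex] s by simp
    have "(z ^ m) ^ s = 1" for m
      using z(1) unfolding power_mult[symmetric] mult.commute[of m] by (simp add: power_mult primitive_root_unity_def)
    then show "(\<lambda>m. z ^ m) ` {..<s} \<subseteq> {x. x ^ s = 1}" by auto
    show "card {x::complex. x ^ s = 1} \<le> card ((\<lambda>m. z ^ m) ` {..<s})"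
      using card_roots_unity[of s, where 'a = complex] s by (simp add: card_image[OF inj])
  qed
  moreover have "y ^ s = 1" using y(1) by (simp add: primitive_root_unity_def)
  ultimately obtain m where m: "y = z ^ m" by auto
  have cop: "coprime m s"
  proof (rule ccontr)
    assume "\<not> coprime m s"
    then obtain d where d: "d dvd m" "d dvd s" "d > 1"
      using s by (metis coprime_iff_gcd_eq_1 gcd_dvd1 gcd_dvd2 gcd_pos_nat less_one linorder_neqE_nat not_gr_zero)
    then obtain m' s' where ms: "m = d * m'" "s = d * s'" by (auto elim!: dvdE)
    have "y ^ s' = z ^ (s * m')" by (simp add: m ms mult_ac flip: power_mult)
    also have "\<dots> = 1" using z(1) by (simp add: power_mult primitive_root_unity_def)
    finally have "s dvd s'" using primitive_root_unity_power_eq_1_iff[OF y(1)] by blast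
    then show False using ms s d by (auto dest!: dvd_imp_le)
  qed
  obtain n where n: "n > 0" "coprime n M" "[n = m] (mod s)" using coprime_lift[OF cop M] by blast
  have "z powi (int n - int m) = 1"
    unfolding primitive_root_unity_powi_eq_1_iff[OF z(1)]
    using n(3) by (simp add: cong_int_iff[symmetric] cong_iff_dvd_diff)
  then have yn: "y = z ^ n" using z0 by (simp add: m power_int_diff)
  have t': "tiling ((\<lambda>a. int n * a) ` A) B M" by (rule tiling_dilate[OF t n(2,1)])
  have zM: "z powi k = 1 \<longleftrightarrow> int s dvd k" for k by (rule primitive_root_unity_powi_eq_1_iff[OF z(1)])
  have periodic: "periodic M (\<lambda>u. z powi u)"
    unfolding periodic_def
  proof (intro allI impI)
    fix u v assume "[u = v] (mod int M)"
    then have "int M dvd u - v" by (simp add: cong_iff_dvd_diff)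
    then have "int s dvd u - v" using s(1) by (meson dvd_trans int_dvd_int_iff)
    then have "z powi (u - v) = 1" using zM by blast
    then show "z powi u = z powi v" using z0 by (simp add: power_int_diff)
  qed
  have z1: "z \<noteq> 1" using zM[of 1] s by auto
  have "(\<Sum>u\<in>{0..<int M}. z powi u) = (\<Sum>u<M. z ^ u)"
    by (rule sum.reindex_bij_witness[of _ int nat]) (auto simp: power_int_def)
  also have "\<dots> = 0" using geometric_sum[OF z1, of M] zM[of "int M"] s(1) by simp
  finally have "(\<Sum>a\<in>(\<lambda>a. int n * a) ` A. \<Sum>b\<in>B. z powi (a + b)) = 0"
    using tiling_sum[OF t' periodic] by simp
  moreover have "(\<Sum>a\<in>(\<lambda>a. int n * a) ` A. \<Sum>b\<in>B. z powi (a + b))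
     = (\<Sum>a\<in>A. y powi a) * (\<Sum>b\<in>B. z powi b)"
  proof -
    have i: "inj_on (\<lambda>a. int n * a) A" using n(1) by (auto intro: inj_onI)
    show ?thesis
      unfolding sum.reindex[OF i] sum_product
      using z0 by (simp add: yn power_int_add power_int_mult)
  qed
  ultimately show False using y z by simp
qed

text \<open>
  Two integers with the same gcd with M differ modulo M by a factor n coprime to M. With
  \<open>n * (a - a') = b' - b\<close> modulo M, the sums \<open>n * a + b\<close> and \<open>n * a' + b'\<close> coincide in the tiling by
  the dilate of A by n and B.
\<close>

lemma tiling_gcd_differences:
  assumes t: "tiling A B M" and el: "a \<in> A" "a' \<in> A" "b \<in> B" "b' \<in> B"
    and g: "gcd (a - a') (int M) = gcd (b - b') (int M)"
  shows "a = a'"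
proof -
  have M: "M > 0" using t by (simp add: tiling_def)
  define d where "d = gcd (a - a') (int M)"
  have d0: "d > 0" using M by (simp add: d_def)
  obtain u where u: "a - a' = d * u" unfolding d_def by (meson gcd_dvd1 dvdE)
  obtain v where v: "b' - b = d * v"
    using gcd_dvd1[of "b - b'" "int M"] unfolding g[symmetric] d_def[symmetric]
    by (metis dvdE dvd_diff_commute)
  obtain N where N: "int M = d * N" unfolding d_def by (meson gcd_dvd2 dvdE)
  have N0: "N > 0" using N M d0 by (metis of_nat_0_less_iff zero_less_mult_pos)
  have "gcd (d * u) (d * N) = d" using d_def u N by simp
  then have cu: "coprime u N" using d0 by (simp add: gcd_mult_left coprime_iff_gcd_eq_1)
  have "gcd (d * v) (d * N) = d" using g d_def v N by (metis gcd_neg1 minus_diff_eq)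
  then have cv: "coprime v N" using d0 by (simp add: gcd_mult_left coprime_iff_gcd_eq_1)
  obtain w where w: "[u * w = 1] (mod N)" using cong_solve_coprime_int[OF cu] by blast
  then have "[w * u = 1] (mod N)" by (simp only: mult.commute)
  then have cw: "coprime w N" unfolding coprime_iff_invertible_int by blast
  define m where "m = nat ((w * v) mod N)"
  have m: "int m = (w * v) mod N" using N0 by (simp add: m_def)
  have "coprime (int m) N" unfolding m using cw cv N0 by (subst coprime_mod_left_iff) auto
  then have "coprime m (nat N)" using N0 coprime_int_iff[of m "nat N"] by simp
  then obtain n where n: "n > 0" "coprime n M" "[n = m] (mod nat N)" using coprime_lift[OF _ M] by blast
  have "[int n = int m] (mod N)" using n(3) N0 cong_int_iff[of n m "nat N"] by simp
  then have "[int n = w * v] (mod N)" unfolding m by (simp add: cong_def)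
  then have "[int n * u = w * v * u] (mod N)" by (rule cong_scalar_right)
  also have "[w * v * u = 1 * v] (mod N)" using cong_scalar_right[OF w, of v] by (simp add: mult_ac)
  finally have "N dvd int n * u - v" by (simp add: cong_iff_dvd_diff)
  then have "d * N dvd d * (int n * u - v)" by (intro mult_dvd_mono) auto
  then have c: "[int n * a + b = int n * a' + b'] (mod int M)"
    unfolding N cong_iff_dvd_diff using u v by (simp add: algebra_simps)
  have inj: "inj_on (\<lambda>(a, b). (a + b) mod int M) ((\<lambda>a. int n * a) ` A \<times> B)"
    using tiling_dilate[OF t n(2,1)] by (simp add: tiling_def)
  have "(int n * a, b) = (int n * a', b')"
    by (rule inj_onD[OF inj]) (use c el in \<open>auto simp: cong_def\<close>)
  then show ?thesis using n(1) by simp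
qed

section \<open>Counting in two coordinates\<close>

lemma dvd_of_dvd_diff: "d dvd x - y \<Longrightarrow> d dvd y \<Longrightarrow> d dvd (x::int)"
  using dvd_add[of d "x - y" y] by simp

lemma dvd_level1:
  assumes "finite S" "l > 0" "K < i" and "\<And>g. g \<in> level l i \<Longrightarrow> (\<Sum>x\<in>S. f x * g x) = 0"
    and "periodic (l ^ K) w"
  shows "int l dvd (\<Sum>x\<in>S. f x * w x)"
  using level_dvd[of S l "{i}" K i f w] assms by auto

lemma sum_chi_all:
  assumes "l > 0"
  shows "(\<Sum>u<l. chi l (int u) x) = 1"
  using periodic_expand[of l "\<lambda>_. 1 :: int" x] assms by simp

lemma chi_nonneg [simp]: "chi m u x \<ge> 0" and chi_le1 [simp]: "chi m u x \<le> 1"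
  by (auto simp: chi_def)

lemma digit_ind_nonneg [simp]: "digit_ind l i j x \<ge> 0" and digit_ind_le1 [simp]: "digit_ind l i j x \<le> 1"
  by (auto simp: digit_ind_def)

lemma level_chi1: "l > 0 \<Longrightarrow> (\<lambda>x. int l * chi l u x - 1) \<in> level l 1"
  using level_chi[of l 1 "\<lambda>_. 1" u] by (simp add: chi_def)

lemma level_chi_top:
  assumes "l > 0" "i > 0"
  shows "(\<lambda>x. int l * chi (l ^ i) u x - chi (l ^ (i - 1)) u x) \<in> level l i"
  using level_chi[OF assms, of "\<lambda>_. 1" u] by simp

lemma level_digit_ind_top:
  assumes "l > 0" "i > 0"
  shows "(\<lambda>x. int l * digit_ind l i 0 x - 1) \<in> level l i"
  using level_digit_ind[OF assms, of 0 "\<lambda>_. 1"] assms by simp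

text \<open>
  Expand the vanishing sum of \<open>(p * chi p x - 1) * (q * chi q y - 1)\<close>: the joint count on a cell
  is determined by the two marginal counts.
\<close>

lemma two_prime_identity:
  fixes w :: "int \<Rightarrow> int"
  assumes "p > 0" "q > 0"
    and vanishes: "\<And>f g. f \<in> level p 1 \<Longrightarrow> g \<in> level q 1 \<Longrightarrow> (\<Sum>s\<in>S. w s * (f s * g s)) = 0"
  shows "int p * (\<Sum>s\<in>S. w s * chi p x s) + int q * (\<Sum>s\<in>S. w s * chi q y s)
     = int p * int q * (\<Sum>s\<in>S. w s * (chi p x s * chi q y s)) + (\<Sum>s\<in>S. w s)"
proof -
  have "0 = (\<Sum>s\<in>S. w s * ((int p * chi p x s - 1) * (int q * chi q y s - 1)))"
    by (rule vanishes[symmetric]) (use assms level_chi1 in auto)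
  also have "\<dots> = (\<Sum>s\<in>S. int p * int q * (w s * (chi p x s * chi q y s)) + w s
       - (int p * (w s * chi p x s) + int q * (w s * chi q y s)))"
    by (intro sum.cong refl) (simp add: algebra_simps)
  also have "\<dots> = int p * int q * (\<Sum>s\<in>S. w s * (chi p x s * chi q y s)) + (\<Sum>s\<in>S. w s)
      - (int p * (\<Sum>s\<in>S. w s * chi p x s) + int q * (\<Sum>s\<in>S. w s * chi q y s))"
    by (simp only: sum.distrib sum_subtractf sum_distrib_left)
  finally show ?thesis by simp
qed

lemma sum_rows:
  fixes w :: "int \<Rightarrow> int"
  assumes "l > 0"
  shows "(\<Sum>u<l. \<Sum>s\<in>S. w s * chi l (int u) s) = (\<Sum>s\<in>S. w s)"
  by (subst sum.swap) (simp add: sum_distrib_left[symmetric] sum_chi_all[OF assms])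

text \<open>
  In \<open>two_prime_identity\<close>, reduction modulo q shows that q divides the counts modulo p, and vice
  versa, so with \<open>dp\<close> and \<open>dq\<close> all marginal counts are multiples of \<open>p * q\<close>.
\<close>

lemma two_prime_structure:
  fixes w :: "int \<Rightarrow> int"
  assumes pq: "prime p" "prime q" "p \<noteq> q"
    and vanishes: "\<And>f g. f \<in> level p 1 \<Longrightarrow> g \<in> level q 1 \<Longrightarrow> (\<Sum>s\<in>S. w s * (f s * g s)) = 0"
    and tot: "(\<Sum>s\<in>S. w s) = int p * int q * N"
    and dp: "\<And>x. int p dvd (\<Sum>s\<in>S. w s * chi p x s)"
    and dq: "\<And>y. int q dvd (\<Sum>s\<in>S. w s * chi q y s)"
  obtains \<rho> \<sigma> where
    "\<And>x. (\<Sum>s\<in>S. w s * chi p x s) = int p * int q * \<rho> x"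
    "\<And>y. (\<Sum>s\<in>S. w s * chi q y s) = int p * int q * \<sigma> y"
    "\<And>x y. (\<Sum>s\<in>S. w s * (chi p x s * chi q y s)) = int p * \<rho> x + int q * \<sigma> y - N"
    "(\<Sum>x<p. \<rho> (int x)) = N" "(\<Sum>y<q. \<sigma> (int y)) = N"
proof -
  have pos: "p > 0" "q > 0" using pq prime_gt_0_nat by auto
  have cop: "coprime (int p) (int q)" using pq by (simp add: primes_coprime)
  define R where "R x = (\<Sum>s\<in>S. w s * chi p x s)" for x
  define C where "C y = (\<Sum>s\<in>S. w s * chi q y s)" for y
  define W where "W x y = (\<Sum>s\<in>S. w s * (chi p x s * chi q y s))" for x y
  have id: "int p * R x + int q * C y = int p * int q * (W x y + N)" for x y
    using two_prime_identity[OF pos vanishes, of x y] by (simp add: R_def C_def W_def tot algebra_simps)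
  have qR: "int q dvd R x" for x
  proof -
    have "int p * R x = int q * (int p * (W x 0 + N) - C 0)"
      using id[of x 0] by (simp add: algebra_simps)
    then have "int q dvd int p * R x" by simp
    then show ?thesis using cop by (metis coprime_commute coprime_dvd_mult_right_iff)
  qed
  have pC: "int p dvd C y" for y
  proof -
    have "int q * C y = int p * (int q * (W 0 y + N) - R 0)"
      using id[of 0 y] by (simp add: algebra_simps)
    then have "int p dvd int q * C y" by simp
    then show ?thesis using cop by (metis coprime_dvd_mult_right_iff)
  qed
  have "int p * int q dvd R x" for x
    using qR[of x] dp[of x] cop by (simp add: R_def divides_mult)
  then obtain \<rho> where \<rho>: "R x = int p * int q * \<rho> x" for x unfolding dvd_def by metis
  have "int p * int q dvd C y" for y
    using pC[of y] dq[of y] cop by (simp add: C_def divides_mult)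
  then obtain \<sigma> where \<sigma>: "C y = int p * int q * \<sigma> y" for y unfolding dvd_def by metis
  have W: "W x y = int p * \<rho> x + int q * \<sigma> y - N" for x y
  proof -
    have "int p * int q * (int p * \<rho> x + int q * \<sigma> y) = int p * int q * (W x y + N)"
      using id[of x y] unfolding \<rho> \<sigma> by (simp add: algebra_simps)
    then show ?thesis using pos by simp
  qed
  have "int p * int q * (\<Sum>x<p. \<rho> (int x)) = int p * int q * N"
    using sum_rows[OF pos(1), of w S] \<rho> tot unfolding R_def by (simp add: sum_distrib_left)
  then have s1: "(\<Sum>x<p. \<rho> (int x)) = N" using pos by simp
  have "int p * int q * (\<Sum>x<q. \<sigma> (int x)) = int p * int q * N"
    using sum_rows[OF pos(2), of w S] \<sigma> tot unfolding C_def by (simp add: sum_distrib_left)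
  then have s2: "(\<Sum>x<q. \<sigma> (int x)) = N" using pos by simp
  show ?thesis
    by (rule that[of \<rho> \<sigma>]) (use \<rho> \<sigma> W s1 s2 in \<open>auto simp: R_def C_def W_def\<close>)
qed

section \<open>Two primes\<close>

text \<open>
  What is used of the tiling. The exponents \<open>a\<close>, b, c are the unique levels of pure prime powers
  at which A does not vanish; that they are at least 2 is the hypothesis on the three cyclotomic
  polynomials. The conditions are symmetric in the primes (\<open>swap12\<close>, \<open>swap23\<close>), so each lemma below
  is also available for the other orders.
\<close>

locale three_prime_tiling = three_primes p q r for p q r +
  fixes \<alpha> \<beta> \<gamma> a b c :: nat and A B :: "int set"
  assumes finA: "finite A" and finB: "finite B"
    and cardA: "card A = p ^ \<alpha> * q ^ \<beta> * r ^ \<gamma>"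
    and cardB: "card B = p * q * r"
    and dichotomy: "\<And>i j k. i \<le> Suc \<alpha> \<Longrightarrow> j \<le> Suc \<beta> \<Longrightarrow> k \<le> Suc \<gamma> \<Longrightarrow> (i, j, k) \<noteq> (0, 0, 0) \<Longrightarrow>
      vanishes A (p ^ i * q ^ j * r ^ k) \<or> vanishes B (p ^ i * q ^ j * r ^ k)"
    and gcd_differences: "\<And>x x' y y'. x \<in> A \<Longrightarrow> x' \<in> A \<Longrightarrow> y \<in> B \<Longrightarrow> y' \<in> B \<Longrightarrow>
      gcd (x - x') (int (p ^ Suc \<alpha> * q ^ Suc \<beta> * r ^ Suc \<gamma>))
        = gcd (y - y') (int (p ^ Suc \<alpha> * q ^ Suc \<beta> * r ^ Suc \<gamma>)) \<Longrightarrow> x = x'"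
    and a: "2 \<le> a" "a \<le> Suc \<alpha>" "vanishes B (p ^ a)" "\<not> vanishes A (p ^ a)"
      "\<And>i. 1 \<le> i \<Longrightarrow> i \<le> Suc \<alpha> \<Longrightarrow> i \<noteq> a \<Longrightarrow> vanishes A (p ^ i) \<and> \<not> vanishes B (p ^ i)"
    and b: "2 \<le> b" "b \<le> Suc \<beta>" "vanishes B (q ^ b)" "\<not> vanishes A (q ^ b)"
      "\<And>i. 1 \<le> i \<Longrightarrow> i \<le> Suc \<beta> \<Longrightarrow> i \<noteq> b \<Longrightarrow> vanishes A (q ^ i) \<and> \<not> vanishes B (q ^ i)"
    and c: "2 \<le> c" "c \<le> Suc \<gamma>" "vanishes B (r ^ c)" "\<not> vanishes A (r ^ c)"
      "\<And>i. 1 \<le> i \<Longrightarrow> i \<le> Suc \<gamma> \<Longrightarrow> i \<noteq> c \<Longrightarrow> vanishes A (r ^ i) \<and> \<not> vanishes B (r ^ i)"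
begin

abbreviation vA where "vA i j k \<equiv> vanishes A (p ^ i * q ^ j * r ^ k)"
abbreviation vB where "vB i j k \<equiv> vanishes B (p ^ i * q ^ j * r ^ k)"

lemma swap12: "three_prime_tiling q p r \<beta> \<alpha> \<gamma> b a c A B"
proof -
  interpret t: three_primes q p r using primes distinct by unfold_locales auto
  show ?thesis
  proof unfold_locales
    show "vanishes A (q ^ i * p ^ j * r ^ k) \<or> vanishes B (q ^ i * p ^ j * r ^ k)"
      if "i \<le> Suc \<beta>" "j \<le> Suc \<alpha>" "k \<le> Suc \<gamma>" "(i, j, k) \<noteq> (0, 0, 0)" for i j k
      using dichotomy[of j i k] that by (auto simp: mult_ac)
    show "x = x'" if "x \<in> A" "x' \<in> A" "y \<in> B" "y' \<in> B"
      "gcd (x - x') (int (q ^ Suc \<beta> * p ^ Suc \<alpha> * r ^ Suc \<gamma>))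
        = gcd (y - y') (int (q ^ Suc \<beta> * p ^ Suc \<alpha> * r ^ Suc \<gamma>))" for x x' y y'
      by (rule gcd_differences[OF that(1-4)]) (use that(5) in \<open>simp only: mult.commute[of "q ^ Suc \<beta>"]\<close>)
  qed (use finA finB cardA cardB a b c in \<open>auto simp: mult_ac\<close>)
qed

lemma swap23: "three_prime_tiling p r q \<alpha> \<gamma> \<beta> a c b A B"
proof -
  interpret t: three_primes p r q using primes distinct by unfold_locales auto
  show ?thesis
  proof unfold_locales
    show "vanishes A (p ^ i * r ^ j * q ^ k) \<or> vanishes B (p ^ i * r ^ j * q ^ k)"
      if "i \<le> Suc \<alpha>" "j \<le> Suc \<gamma>" "k \<le> Suc \<beta>" "(i, j, k) \<noteq> (0, 0, 0)" for i j k
      using dichotomy[of i k j] that by (auto simp: mult_ac)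
    show "x = x'" if "x \<in> A" "x' \<in> A" "y \<in> B" "y' \<in> B"
      "gcd (x - x') (int (p ^ Suc \<alpha> * r ^ Suc \<gamma> * q ^ Suc \<beta>))
        = gcd (y - y') (int (p ^ Suc \<alpha> * r ^ Suc \<gamma> * q ^ Suc \<beta>))" for x x' y y'
      by (rule gcd_differences[OF that(1-4)]) (use that(5) in \<open>simp only: mult.assoc mult.commute[of "q ^ Suc \<beta>"]\<close>)
  qed (use finA finB cardA cardB a b c in \<open>auto simp: mult_ac\<close>)
qed

lemma pos: "p > 0" "q > 0" "r > 0" "p > 1" "q > 1" "r > 1"
  using primes prime_gt_0_nat prime_gt_1_nat by auto

lemma coprimes: "coprime (int p) (int q)" "coprime (int p) (int r)" "coprime (int q) (int r)"
  using primes distinct by (auto simp: primes_coprime)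

lemma testA:
  "vA i j k \<Longrightarrow> f \<in> level p i \<Longrightarrow> g \<in> level q j \<Longrightarrow> h \<in> level r k \<Longrightarrow> (\<Sum>x\<in>A. f x * g x * h x) = (0::int)"
  by (rule vanishes_test)

lemma testB:
  "vB i j k \<Longrightarrow> f \<in> level p i \<Longrightarrow> g \<in> level q j \<Longrightarrow> h \<in> level r k \<Longrightarrow> (\<Sum>x\<in>B. f x * g x * h x) = (0::int)"
  by (rule vanishes_test)

lemma vB_00: "vB a 0 0" "vB 0 b 0" "vB 0 0 c"
  using a b c by simp_all

lemma vA_00: "1 \<le> k \<Longrightarrow> k \<le> Suc \<gamma> \<Longrightarrow> k \<noteq> c \<Longrightarrow> vA 0 0 k"
  "1 \<le> k \<Longrightarrow> k \<le> Suc \<alpha> \<Longrightarrow> k \<noteq> a \<Longrightarrow> vA k 0 0"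
  "1 \<le> k \<Longrightarrow> k \<le> Suc \<beta> \<Longrightarrow> k \<noteq> b \<Longrightarrow> vA 0 k 0"
  using a b c by simp_all

lemma not_vA_00: "\<not> vA a 0 0" "\<not> vA 0 b 0" "\<not> vA 0 0 c"
  using a b c by simp_all

text \<open>
  Above modulus p ^ i with i < a there is still the level \<open>a\<close>, over whose digit B is evenly
  distributed.
\<close>

lemma B_count_dvd:
  assumes "periodic (p ^ i) w" "i < a"
  shows "int p dvd (\<Sum>x\<in>B. w x)"
proof -
  have "(\<Sum>x\<in>B. 1 * g x) = 0" if "g \<in> level p a" for g :: "int \<Rightarrow> int"
    using testB[OF vB_00(1) that, of "\<lambda>_. 1" "\<lambda>_. 1"] by simp
  from dvd_level1[OF finB pos(1) assms(2) this assms(1)] show ?thesis by simp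
qed

lemma B_row_dvd: "int p dvd cnt B p x"
  by (rule B_count_dvd[of 1]) (use a in auto)

text \<open>
  As B vanishes at r ^ c, its elements are evenly distributed over the values of the c-th
  digit in base r, so one value singles out \<open>p * q\<close> of them.
\<close>

definition slice where "slice = {x \<in> B. digit r c x = 0}"

lemma fin_slice: "finite slice"
  using finB by (auto simp: slice_def)

lemma sum_slice: "(\<Sum>x\<in>slice. f x) = (\<Sum>x\<in>B. f x * digit_ind r c 0 x :: int)"
proof -
  have "(\<Sum>x\<in>slice. f x) = (\<Sum>x\<in>B. if digit r c x = 0 then f x else 0)"
    unfolding slice_def by (subst sum.inter_filter[OF finB]) simp
  also have "\<dots> = (\<Sum>x\<in>B. f x * digit_ind r c 0 x)"
    by (intro sum.cong) (auto simp: digit_ind_def)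
  finally show ?thesis .
qed

lemma sum_slice_eq:
  assumes "(\<Sum>x\<in>B. f x * (int r * digit_ind r c 0 x - 1)) = 0"
  shows "int r * (\<Sum>x\<in>slice. f x) = (\<Sum>x\<in>B. f x)"
  using assms sum_linear[of f "\<lambda>_. 1" "int r" "digit_ind r c 0" "\<lambda>_. 1" B] by (simp add: sum_slice)

lemma level_slice: "periodic (r ^ (c - 1)) w \<Longrightarrow> (\<lambda>x. w x * (int r * digit_ind r c 0 x - 1)) \<in> level r c"
  by (rule level_digit_ind) (use pos c in auto)

lemma level_slice_1: "(\<lambda>x. int r * digit_ind r c 0 x - 1) \<in> level r c"
  by (rule level_digit_ind_top) (use pos c in auto)

text \<open>
  Sums over the slice are \<open>1 / r\<close> of sums over B whenever B vanishes at the corresponding level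
  with r ^ c; the lemmas on the slice below are instances.
\<close>

lemma slice_test:
  assumes "vB i j c" "f \<in> level p i" "g \<in> level q j"
  shows "int r * (\<Sum>x\<in>slice. f x * g x) = (\<Sum>x\<in>B. f x * g x)"
  by (rule sum_slice_eq) (use testB[OF assms level_slice_1] in simp)

lemma card_slice: "int (card slice) = int p * int q"
proof -
  have "int r * (\<Sum>x\<in>slice. 1 * 1) = (\<Sum>x\<in>B. 1 * 1)"
    by (rule slice_test[OF vB_00(3)]) auto
  then have "int r * int (card slice) = int r * (int p * int q)" by (simp add: cardB mult_ac)
  then show ?thesis using pos by simp
qed

lemma slice_vanishes_110:
  fixes f g :: "int \<Rightarrow> int"
  assumes "vB 1 1 0" "vB 1 1 c" "f \<in> level p 1" "g \<in> level q 1"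
  shows "(\<Sum>x\<in>slice. f x * g x) = 0"
proof -
  have "(\<Sum>x\<in>B. f x * g x) = 0"
    using testB[OF assms(1,3,4), of "\<lambda>_. 1"] by simp
  then show ?thesis using slice_test[OF assms(2,3,4)] pos by simp
qed

lemma slice_vanishes_111:
  fixes f g h :: "int \<Rightarrow> int"
  assumes "vB 1 1 1" "vB 1 1 c" "f \<in> level p 1" "g \<in> level q 1" "h \<in> level r 1"
  shows "(\<Sum>x\<in>slice. f x * g x * h x) = 0"
proof -
  have "periodic (r ^ (c - 1)) h"
    by (rule periodic_pow_le[OF level_periodic[OF assms(5)]]) (use c in auto)
  from testB[OF assms(2,3,4) level_slice[OF this]]
  have "(\<Sum>x\<in>B. f x * g x * h x * (int r * digit_ind r c 0 x - 1)) = 0" by (simp only: mult.assoc)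
  from sum_slice_eq[OF this] testB[OF assms(1,3,4,5)] show ?thesis using pos by simp
qed

lemma digit_row:
  assumes "vB 1 0 c" "0 \<le> j" "j < int r"
  shows "int r * (\<Sum>s\<in>B. chi p x s * digit_ind r c j s) = cnt B p x"
proof -
  have h: "(\<lambda>s. int r * digit_ind r c j s - 1) \<in> level r c"
    using level_digit_ind[OF pos(3), of c j "\<lambda>_. 1"] assms c by simp
  have "(\<Sum>s\<in>B. (int p * chi p x s - 1) * 1 * (int r * digit_ind r c j s - 1)) = 0"
    by (rule testB[OF assms(1) level_chi1[OF pos(1)] level_const h])
  moreover have "(\<Sum>s\<in>B. 1 * 1 * (int r * digit_ind r c j s - 1)) = 0"
    by (rule testB[OF vB_00(3) level_const level_const h])
  ultimately have "0 = (\<Sum>s\<in>B. (int p * chi p x s - 1) * 1 * (int r * digit_ind r c j s - 1))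
    + (\<Sum>s\<in>B. 1 * 1 * (int r * digit_ind r c j s - 1))" by simp
  also have "\<dots> = int p * (int r * (\<Sum>s\<in>B. chi p x s * digit_ind r c j s) - cnt B p x)"
    unfolding sum_distrib_left sum_subtractf[symmetric] sum.distrib[symmetric]
    by (intro sum.cong refl) (simp add: algebra_simps)
  finally show ?thesis using pos by simp
qed

lemma slice_row:
  assumes "vB 1 0 c"
  shows "int r * cnt slice p u = cnt B p u"
  using digit_row[OF assms, of 0 u] pos by (simp add: sum_slice)

text \<open>
  For \<open>i = 1\<close> the rows of the slice are \<open>1 / r\<close> of the rows of B, which p divides. For \<open>i > 1\<close>
  level i lies above modulus p and yields a factor p in the deviation of the slice from its
  expected share.
\<close>

lemma slice_row_dvd:
  assumes "vB i 0 c" "1 \<le> i"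
  shows "int p dvd cnt slice p u"
proof -
  have "int p dvd int r * cnt slice p u"
  proof (cases "i = 1")
    case True
    then show ?thesis using slice_row[of u] assms(1) B_row_dvd[of u] by simp
  next
    case False
    have "int p dvd (\<Sum>x\<in>B. (int r * digit_ind r c 0 x - 1) * chi p u x)"
    proof (rule dvd_level1[OF finB pos(1), of 1 i])
      fix g :: "int \<Rightarrow> int" assume "g \<in> level p i"
      from testB[OF assms(1) this level_const[of 1] level_slice_1]
      show "(\<Sum>x\<in>B. (int r * digit_ind r c 0 x - 1) * g x) = 0" by (simp add: mult.commute)
    qed (use False assms in auto)
    moreover have "(\<Sum>x\<in>B. (int r * digit_ind r c 0 x - 1) * chi p u x)
        = int r * cnt slice p u - cnt B p u"
      unfolding sum_slice sum_distrib_left sum_subtractf[symmetric]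
      by (intro sum.cong refl) (simp add: algebra_simps)
    ultimately show ?thesis using B_row_dvd[of u] by (metis diff_add_cancel dvd_add)
  qed
  then show ?thesis using coprimes by (simp add: coprime_dvd_mult_right_iff)
qed

definition missed where "missed = {i \<in> {1..Suc \<alpha>}. \<not> vA i 0 c}"

lemma B_chi_c: "int r * cnt B (r ^ c) u = cnt B (r ^ (c - 1)) u"
proof -
  have "(\<Sum>x\<in>B. 1 * 1 * (int r * chi (r ^ c) u x - chi (r ^ (c - 1)) u x)) = 0"
    by (rule testB[OF vB_00(3)]) (use level_chi_top pos c in auto)
  then show ?thesis by (simp add: sum_subtractf sum_distrib_left[symmetric])
qed

lemma B_chi_c_le: "cnt B (r ^ c) u \<le> int p * int q"
proof -
  have "cnt B (r ^ (c - 1)) u \<le> (\<Sum>x\<in>B. 1)" by (intro sum_mono) simp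
  then have "int r * cnt B (r ^ c) u \<le> int r * (int p * int q)"
    unfolding B_chi_c by (simp add: cardB mult_ac)
  then show ?thesis using pos by simp
qed

lemma abs_diff_chi_le:
  assumes "\<And>u. (\<Sum>x\<in>S. w x * chi m u x) \<le> K" "\<And>x. x \<in> S \<Longrightarrow> 0 \<le> w x"
  shows "\<bar>\<Sum>x\<in>S. (chi m u x - chi m v x) * w x\<bar> \<le> (K::int)"
proof -
  have "(\<Sum>x\<in>S. (chi m u x - chi m v x) * w x) = (\<Sum>x\<in>S. w x * chi m u x) - (\<Sum>x\<in>S. w x * chi m v x)"
    unfolding sum_subtractf[symmetric] by (intro sum.cong refl) (simp add: algebra_simps)
  moreover have nn: "0 \<le> (\<Sum>x\<in>S. w x * chi m t x)" for t
    by (intro sum_nonneg mult_nonneg_nonneg) (use assms in auto)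
  ultimately show ?thesis using assms(1)[of u] assms(1)[of v] nn[of u] nn[of v] by linarith
qed

lemma dich_missed: "i \<in> missed \<Longrightarrow> vB i 0 c"
  using dichotomy[of i 0 c] c by (auto simp: missed_def)

lemma not_vB_10c:
  assumes "\<not> vB 1 0 c"
  obtains x u v where "[u = v] (mod int (r ^ (c - 1)))"
    "(\<Sum>s\<in>B. (chi (r ^ c) u s - chi (r ^ c) v s) * chi p x s) \<noteq> 0"
proof -
  obtain f h where fh: "f \<in> level_gen p 1" "h \<in> level_gen r c" "(\<Sum>x\<in>B. f x * 1 * h x) \<noteq> 0"
    using assms vanishes_intro[of 1 0 c B] by (auto simp: level_gen_def[of q])
  obtain x x' where f: "f = (\<lambda>s. chi p x s - chi p x' s)" using fh(1) by (auto simp: level_gen_def)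
  obtain u v where h: "h = (\<lambda>s. chi (r ^ c) u s - chi (r ^ c) v s)" "[u = v] (mod int (r ^ (c - 1)))"
    using fh(2) c by (auto simp: level_gen_def split: if_splits)
  have "(\<Sum>s\<in>B. h s * chi p x s) - (\<Sum>s\<in>B. h s * chi p x' s) = (\<Sum>s\<in>B. f s * 1 * h s)"
    unfolding sum_subtractf[symmetric] f by (intro sum.cong refl) (simp add: algebra_simps)
  then have "(\<Sum>s\<in>B. h s * chi p x s) \<noteq> 0 \<or> (\<Sum>s\<in>B. h s * chi p x' s) \<noteq> 0" using fh(3) by auto
  then show ?thesis using that h by blast
qed

text \<open>
  Let B be unevenly distributed between two sibling classes modulo r ^ c on some class modulo p.
  The difference of the two counts is a nonzero multiple of \<open>p ^ card missed\<close>, and a class modulo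
  r ^ c has at most \<open>p * q\<close> elements of B.
\<close>

lemma missed_bound:
  assumes "\<not> vB 1 0 c"
  shows "p ^ card missed \<le> p * q"
proof -
  obtain x u v where uv: "[u = v] (mod int (r ^ (c - 1)))"
    and nz: "(\<Sum>s\<in>B. (chi (r ^ c) u s - chi (r ^ c) v s) * chi p x s) \<noteq> 0" (is "?d \<noteq> 0")
    using not_vB_10c[OF assms] by blast
  have h: "(\<lambda>s. chi (r ^ c) u s - chi (r ^ c) v s) \<in> level r c"
    by (rule level_chi_diff) (use pos c uv in auto)
  have "int p ^ card missed dvd ?d"
  proof (rule level_dvd[OF finB pos(1), of missed 1 "Suc \<alpha>"])
    show "missed \<subseteq> {1<..Suc \<alpha>}"
    proof
      fix i assume i: "i \<in> missed"
      then have "i \<noteq> 1" using dich_missed[OF i] assms by auto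
      then show "i \<in> {1<..Suc \<alpha>}" using i by (auto simp: missed_def)
    qed
    fix i and g :: "int \<Rightarrow> int" assume i: "i \<in> missed" and g: "g \<in> level p i"
    from testB[OF dich_missed[OF i] g level_const[of 1] h]
    show "(\<Sum>s\<in>B. (chi (r ^ c) u s - chi (r ^ c) v s) * g s) = 0" by (simp add: mult.commute)
  qed simp
  from dvd_imp_le_int[OF nz this] have "int p ^ card missed \<le> \<bar>?d\<bar>" by simp
  also have "\<dots> \<le> int p * int q"
  proof (rule abs_diff_chi_le)
    fix t
    have "(\<Sum>s\<in>B. chi p x s * chi (r ^ c) t s) \<le> (\<Sum>s\<in>B. 1 * chi (r ^ c) t s)"
      by (intro sum_mono mult_right_mono) auto
    then show "(\<Sum>s\<in>B. chi p x s * chi (r ^ c) t s) \<le> int p * int q"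
      using B_chi_c_le[of t] by simp
  qed simp
  finally show ?thesis by (metis of_nat_le_iff of_nat_mult of_nat_power)
qed

text \<open>
  A vanishes at \<open>r, \<dots>, r ^ (c - 1)\<close>, hence is equidistributed modulo \<open>r ^ (c - 1)\<close>.
\<close>

lemma A_parent: "cnt A (r ^ (c - 1)) u = int (p ^ \<alpha> * q ^ \<beta> * r ^ (Suc \<gamma> - c))"
proof -
  have "int r ^ (c - 1) * (\<Sum>x\<in>A. 1 * chi (r ^ (c - 1)) u x) = (\<Sum>x\<in>A. 1)"
  proof (rule level_even[OF pos(3)])
    fix i and g :: "int \<Rightarrow> int" assume i: "1 \<le> i" "i \<le> c - 1" and g: "g \<in> level r i"
    have "vA 0 0 i" by (rule vA_00(1)) (use i c in auto)
    from testA[OF this level_const[of 1] level_const[of 1] g] show "(\<Sum>x\<in>A. 1 * g x) = 0" by simp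
  qed
  also have "(\<Sum>x\<in>A. 1) = int (p ^ \<alpha> * q ^ \<beta> * r ^ \<gamma>)" by (simp add: cardA)
  also have "r ^ \<gamma> = r ^ (c - 1) * r ^ (Suc \<gamma> - c)"
    using c by (simp add: power_add[symmetric])
  finally have "int r ^ (c - 1) * cnt A (r ^ (c - 1)) u
      = int r ^ (c - 1) * int (p ^ \<alpha> * q ^ \<beta> * r ^ (Suc \<gamma> - c))"
    by (simp add: mult_ac)
  then show ?thesis using pos by simp
qed

text \<open>
  Each level outside \<open>missed\<close> gives a factor p of the deviation of a child from its share of the
  parent, whose count is known from \<open>A_parent\<close>; the maximum with 1 comes from the power of p in
  that count.
\<close>

lemma A_child_p: "int p ^ (Suc \<alpha> - max 1 (card missed)) dvd cnt A (r ^ c) u"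
proof -
  let ?h = "\<lambda>x. int r * chi (r ^ c) u x - chi (r ^ (c - 1)) u x"
  have h: "?h \<in> level r c" by (rule level_chi_top) (use pos c in auto)
  let ?G = "{1..Suc \<alpha>} - missed"
  have "int p ^ card ?G dvd (\<Sum>x\<in>A. ?h x * 1)"
  proof (rule level_dvd[OF finA pos(1), of ?G 0 "Suc \<alpha>"])
    show "?G \<subseteq> {0<..Suc \<alpha>}" by auto
    fix i and g :: "int \<Rightarrow> int" assume i: "i \<in> ?G" and g: "g \<in> level p i"
    have "vA i 0 c" using i by (auto simp: missed_def)
    from testA[OF this g level_const[of 1] h] show "(\<Sum>x\<in>A. ?h x * g x) = 0" by (simp add: mult.commute)
  qed simp
  moreover have "card ?G = Suc \<alpha> - card missed"
    by (subst card_Diff_subset) (auto simp: missed_def)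
  moreover have "(\<Sum>x\<in>A. ?h x * 1) = int r * cnt A (r ^ c) u - cnt A (r ^ (c - 1)) u"
    by (simp add: sum_subtractf sum_distrib_left)
  ultimately have "int p ^ (Suc \<alpha> - card missed) dvd int r * cnt A (r ^ c) u - cnt A (r ^ (c - 1)) u"
    by simp
  then have 1: "int p ^ (Suc \<alpha> - max 1 (card missed)) dvd int r * cnt A (r ^ c) u - cnt A (r ^ (c - 1)) u"
    by (rule dvd_trans[rotated]) (simp add: le_imp_power_dvd)
  have "int p ^ (Suc \<alpha> - max 1 (card missed)) dvd int p ^ \<alpha>" by (rule le_imp_power_dvd) simp
  then have "int p ^ (Suc \<alpha> - max 1 (card missed)) dvd cnt A (r ^ (c - 1)) u"
    unfolding A_parent by (simp add: mult.assoc)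
  with 1 have "int p ^ (Suc \<alpha> - max 1 (card missed)) dvd int r * cnt A (r ^ c) u"
    by (metis diff_add_cancel dvd_add)
  then show ?thesis using coprimes by (simp add: coprime_dvd_mult_right_iff)
qed

lemma A_child_r: "int r ^ (Suc \<gamma> - c) dvd cnt A (r ^ c) u"
proof -
  have "int r ^ card {c<..Suc \<gamma>} dvd (\<Sum>x\<in>A. 1 * chi (r ^ c) u x)"
  proof (rule level_dvd[OF finA pos(3)])
    fix i and g :: "int \<Rightarrow> int" assume i: "i \<in> {c<..Suc \<gamma>}" and g: "g \<in> level r i"
    have "vA 0 0 i" by (rule vA_00(1)) (use i c in auto)
    from testA[OF this level_const[of 1] level_const[of 1] g] show "(\<Sum>x\<in>A. 1 * g x) = 0" by simp
  qed auto
  then show ?thesis by simp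
qed

definition holes where
  "holes \<longleftrightarrow> (\<forall>u. \<exists>v. [v = u] (mod int (r ^ (c - 1))) \<and> cnt A (r ^ c) v = 0)"

lemma A_parent_split:
  "cnt A (r ^ (c - 1)) u = (\<Sum>e<r. \<Sum>x\<in>A. chi (r ^ c) (u + int (e * r ^ (c - 1))) x)"
  by (subst sum.swap, intro sum.cong refl chi_split) (use pos c in auto)

text \<open>
  On an empty child v of a class, the test function \<open>r * chi (r ^ c) v - chi (r ^ (c - 1)) v\<close> of level
  c restricts on A to minus the indicator of the whole class. So vanishing at level c localises to
  every class modulo \<open>r ^ (c - 1)\<close>, hence holds at every lower level.
\<close>

lemma holes_lift:
  assumes holes "vA i j c" "k < c"
  shows "vA i j k"
proof (rule vanishes_intro)
  fix f g h assume f: "f \<in> level_gen p i" and g: "g \<in> level_gen q j" and h: "h \<in> level_gen r k"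
  have level: "f \<in> level p i" "g \<in> level q j" "h \<in> level r k" using f g h level_gen_subset_level pos by blast+
  have hper: "periodic (r ^ (c - 1)) h"
    by (rule periodic_pow_le[OF level_periodic[OF level(3)]]) (use assms(3) in auto)
  have zero: "(\<Sum>x\<in>A. f x * g x * chi (r ^ (c - 1)) u x) = 0" for u
  proof -
    obtain v where v: "[v = u] (mod int (r ^ (c - 1)))" "cnt A (r ^ c) v = 0"
      using assms(1) by (auto simp: holes_def)
    have "chi (r ^ c) v x = 0" if "x \<in> A" for x
      using v(2) finA that by (simp add: sum_nonneg_eq_0_iff)
    then have "(\<Sum>x\<in>A. f x * g x * chi (r ^ c) v x) = 0" by simp
    moreover have "(\<Sum>x\<in>A. f x * g x * (int r * chi (r ^ c) v x - chi (r ^ (c - 1)) v x)) = 0"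
      by (rule testA[OF assms(2) level(1,2)], rule level_chi_top) (use pos c in auto)
    then have "int r * (\<Sum>x\<in>A. f x * g x * chi (r ^ c) v x) = (\<Sum>x\<in>A. f x * g x * chi (r ^ (c - 1)) v x)"
      by (simp add: sum_distrib_left sum_subtractf right_diff_distrib mult_ac)
    ultimately show ?thesis unfolding chi_cong[OF v(1)] by simp
  qed
  show "(\<Sum>x\<in>A. f x * g x * h x) = 0"
    by (rule sum_periodic_zero[OF _ hper zero]) (use pos in simp)
qed

end

lemma sum_nonneg_int_zero:
  assumes "(\<Sum>s\<in>S. f s) = (0::int)" "finite S" "\<And>s. s \<in> S \<Longrightarrow> 0 \<le> f s" "s \<in> S"
  shows "f s = 0"
  using assms by (simp add: sum_nonneg_eq_0_iff)

lemma exists_zero_of_sum_less: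
  fixes \<rho> :: "int \<Rightarrow> int"
  assumes "(\<Sum>x<p. \<rho> (int x)) < int p" "\<And>x. \<rho> x \<ge> 0"
  shows "\<exists>x. \<rho> x = 0"
proof (rule ccontr)
  assume "\<nexists>x. \<rho> x = 0"
  then have "1 \<le> \<rho> x" for x using assms(2)[of x] by (metis int_one_le_iff_zero_less order_le_less)
  then have "(\<Sum>x<p. 1) \<le> (\<Sum>x<p. \<rho> (int x))" by (intro sum_mono)
  then show False using assms(1) by simp
qed

context three_prime_tiling
begin

text \<open>
  If all r children of a class are inhabited, each contains at least as many elements of A as the
  common divisor D of their sizes. As few p-levels and at most one q-level are missed, D
  exceeds \<open>1 / r\<close> of the parent.
\<close>

lemma holes_aux:
  assumes "p < q" "q < r" "\<not> vB 1 0 c" "\<not> vB 0 1 c"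
  shows holes
proof (rule ccontr)
  interpret s: three_prime_tiling q p r \<beta> \<alpha> \<gamma> b a c A B by (rule swap12)
  assume "\<not> holes"
  then obtain u where u: "\<And>v. [v = u] (mod int (r ^ (c - 1))) \<Longrightarrow> cnt A (r ^ c) v \<noteq> 0"
    unfolding holes_def by blast
  define m where "m = max 1 (card missed)"
  define n where "n = max 1 (card s.missed)"
  have "card missed \<le> card {1..Suc \<alpha>}" by (rule card_mono) (auto simp: missed_def)
  then have m: "1 \<le> m" "m \<le> Suc \<alpha>" by (auto simp: m_def)
  have "q ^ card s.missed \<le> q * p" by (rule s.missed_bound) (use assms in simp)
  also have "q * p < q ^ 2" using assms pos by (simp add: power2_eq_square)
  finally have "card s.missed < 2" using pos power_less_imp_less_exp by blast
  then have n: "n = 1" by (simp add: n_def)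
  (* missed_bound gives p ^ m \<le> p * q if any p-level is missed. *)
  have pm: "p ^ (m - 1) \<le> q"
  proof (cases "card missed = 0")
    case True
    then show ?thesis using pos by (simp add: m_def)
  next
    case False
    then have "p * p ^ (m - 1) = p ^ card missed" by (simp add: m_def power_eq_if)
    also have "\<dots> \<le> p * q" by (rule missed_bound[OF assms(3)])
    finally show ?thesis using pos by simp
  qed
  define D where "D = int p ^ (Suc \<alpha> - m) * int q ^ \<beta> * int r ^ (Suc \<gamma> - c)"
  have D0: "D > 0" using pos by (simp add: D_def)
  have Ddvd: "D dvd cnt A (r ^ c) v" for v
  proof -
    have "int q ^ \<beta> dvd cnt A (r ^ c) v"
      using s.A_child_p[of v] n by (simp add: n_def)
    moreover have "int p ^ (Suc \<alpha> - m) dvd cnt A (r ^ c) v"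
      using A_child_p[of v] by (simp add: m_def)
    ultimately show ?thesis
      unfolding D_def using A_child_r[of v] coprimes
      by (intro divides_mult) (auto simp: coprime_mult_left_iff)
  qed
  have "D \<le> (\<Sum>x\<in>A. chi (r ^ c) (u + int (e * r ^ (c - 1))) x)" for e
  proof -
    have "(\<Sum>x\<in>A. chi (r ^ c) (u + int (e * r ^ (c - 1))) x) \<noteq> 0"
      by (rule u) (simp add: cong_def)
    moreover have "(\<Sum>x\<in>A. chi (r ^ c) (u + int (e * r ^ (c - 1))) x) \<ge> 0" by (intro sum_nonneg) simp
    ultimately show ?thesis using Ddvd[of "u + int (e * r ^ (c - 1))"] by (intro zdvd_imp_le) auto
  qed
  then have "(\<Sum>e<r. D) \<le> (\<Sum>e<r. \<Sum>x\<in>A. chi (r ^ c) (u + int (e * r ^ (c - 1))) x)"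
    by (intro sum_mono)
  also have "\<dots> = int (p ^ \<alpha> * q ^ \<beta> * r ^ (Suc \<gamma> - c))"
    unfolding A_parent_split[symmetric] by (rule A_parent)
  also have "p ^ \<alpha> = p ^ (m - 1) * p ^ (Suc \<alpha> - m)"
    using m by (simp add: power_add[symmetric])
  finally have "D * int r \<le> D * int (p ^ (m - 1))" by (simp add: D_def mult_ac)
  then have "int r \<le> int (p ^ (m - 1))" using D0 by (simp only: mult_le_cancel_left_pos)
  then show False using pm assms by simp
qed

lemma holesI:
  assumes "p < r" "q < r" "\<not> vB 1 0 c" "\<not> vB 0 1 c"
  shows holes
proof (cases "p < q")
  case True
  then show ?thesis using holes_aux assms by blast
next
  case False
  interpret s: three_prime_tiling q p r \<beta> \<alpha> \<gamma> b a c A B by (rule swap12)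
  show ?thesis by (rule s.holes_aux) (use False distinct assms in auto)
qed

lemma holes_vB:
  assumes holes "\<not> vA i j k" "k < c" "i \<le> Suc \<alpha>" "j \<le> Suc \<beta>"
  shows "vB i j c"
  using holes_lift[OF assms(1) _ assms(3)] assms dichotomy[of i j c] c by auto

text \<open>
  By \<open>two_prime_structure\<close> the rows and columns of B are \<open>p * q * \<rho> x\<close> and \<open>p * q * \<sigma> y\<close> with
  joint counts \<open>p * \<rho> x + q * \<sigma> y - r\<close>. An empty row would make q divide r, so all \<open>\<rho> x\<close>,
  \<open>\<sigma> y\<close> are positive with sum r; hence \<open>p, q < r\<close>, and r divides none of them. So B vanishes
  neither at \<open>p * r ^ c\<close> nor at \<open>q * r ^ c\<close>, and there are holes. These force B to vanish at
  \<open>p * q * r ^ c\<close>, \<open>p ^ a * r ^ c\<close> and \<open>q ^ b * r ^ c\<close>, so that the slice has the same structure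
  with total 1 in place of r; but a cell of an empty row and an empty column then has count \<open>-1\<close>.
\<close>

lemma no_vB_110:
  assumes v: "vB 1 1 0" and k: "k < c" "\<not> vA 1 1 k"
  shows False
proof -
  interpret s: three_prime_tiling q p r \<beta> \<alpha> \<gamma> b a c A B by (rule swap12)
  have vanishes: "(\<Sum>x\<in>B. 1 * (f x * g x)) = 0" if "f \<in> level p 1" "g \<in> level q 1" for f g :: "int \<Rightarrow> int"
    using testB[OF v that level_const[of 1]] by simp
  obtain \<rho> \<sigma> where st: "\<And>x. (\<Sum>s\<in>B. 1 * chi p x s) = int p * int q * \<rho> x"
    "\<And>y. (\<Sum>s\<in>B. 1 * chi q y s) = int p * int q * \<sigma> y"
    "\<And>x y. (\<Sum>s\<in>B. 1 * (chi p x s * chi q y s)) = int p * \<rho> x + int q * \<sigma> y - int r"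
    "(\<Sum>x<p. \<rho> (int x)) = int r" "(\<Sum>y<q. \<sigma> (int y)) = int r"
    by (rule two_prime_structure[OF primes(1,2) distinct(1) vanishes, of "int r"])
       (use cardB B_row_dvd s.B_row_dvd in auto)
  have row0: "0 \<le> int p * int q * \<rho> x" "0 \<le> int p * int q * \<sigma> x" for x
    unfolding st(1,2)[symmetric] by (auto intro!: sum_nonneg)
  have pq: "0 < int p * int q" using pos by simp
  have nn: "\<rho> x \<ge> 0" "\<sigma> x \<ge> 0" for x
    using row0[of x] pq by (simp_all only: zero_le_mult_iff) auto
  have \<rho>0: "\<rho> x \<noteq> 0" for x
  proof
    assume 0: "\<rho> x = 0"
    have "1 * chi p x s = 0" if "s \<in> B" for s
      by (rule sum_nonneg_int_zero[OF _ finB _ that]) (use st(1)[of x] 0 in auto)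
    then have "int p * \<rho> x + int q * \<sigma> 0 - int r = 0" unfolding st(3)[symmetric] by simp
    then have "int r = int q * \<sigma> 0" using 0 by simp
    then have "q dvd r" by (metis dvd_triv_left int_dvd_int_iff)
    then show False using primes distinct primes_dvd_imp_eq by blast
  qed
  have \<sigma>0: "\<sigma> y \<noteq> 0" for y
  proof
    assume 0: "\<sigma> y = 0"
    have "1 * chi q y s = 0" if "s \<in> B" for s
      by (rule sum_nonneg_int_zero[OF _ finB _ that]) (use st(2)[of y] 0 in auto)
    then have "int p * \<rho> 0 + int q * \<sigma> y - int r = 0" unfolding st(3)[symmetric] by simp
    then have "int r = int p * \<rho> 0" using 0 by simp
    then have "p dvd r" by (metis dvd_triv_left int_dvd_int_iff)
    then show False using primes distinct primes_dvd_imp_eq by blast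
  qed
  have "\<not> int r < int p" using exists_zero_of_sum_less[of \<rho> p] st(4) nn \<rho>0 by auto
  then have pr: "p < r" using distinct by simp
  have "\<not> int r < int q" using exists_zero_of_sum_less[of \<sigma> q] st(5) nn \<sigma>0 by auto
  then have qr: "q < r" using distinct by simp
  have small: "f (int 0) < int r" if "(\<Sum>x<n. f (int x)) = int r" "\<And>x. f x \<ge> 0" "\<And>x. f x \<noteq> 0" "n > 1"
    for f :: "int \<Rightarrow> int" and n
  proof -
    have "(\<Sum>x\<in>{0, 1}. f (int x)) \<le> (\<Sum>x<n. f (int x))"
      by (rule sum_mono2) (use that in auto)
    then have "f 0 + f 1 \<le> int r" using that(1) by simp
    moreover have "f 1 > 0" using that(2,3)[of 1] by simp
    ultimately show ?thesis by simp
  qed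
  have nd: "\<not> int r dvd int p * int q * f 0" if "0 \<le> f 0" "f 0 \<noteq> 0" "f 0 < int r" for f :: "int \<Rightarrow> int"
  proof
    assume "int r dvd int p * int q * f 0"
    then have "int r dvd f 0"
      using coprimes by (simp add: coprime_dvd_mult_right_iff coprime_commute mult.assoc)
    then show False using that zdvd_imp_le[of "int r" "f 0"] by simp
  qed
  have n1: "\<not> vB 1 0 c"
  proof
    assume "vB 1 0 c"
    from slice_row[OF this, of 0] have "int r dvd int p * int q * \<rho> 0"
      using st(1)[of 0] by (metis dvd_triv_left mult_1 sum.cong)
    then show False using nd[of \<rho>] nn \<rho>0 small[OF st(4) nn(1) \<rho>0 pos(4)] by simp
  qed
  have n2: "\<not> vB 0 1 c"
  proof
    assume "vB 0 1 c"
    then have "vanishes B (q ^ 1 * p ^ 0 * r ^ c)" by simp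
    from s.slice_row[OF this, of 0] have "int r dvd int p * int q * \<sigma> 0"
      using st(2)[of 0] by (metis dvd_triv_left mult_1 sum.cong)
    then show False using nd[of \<sigma>] nn \<sigma>0 small[OF st(5) nn(2) \<sigma>0 pos(5)] by simp
  qed
  have h: holes by (rule holesI[OF pr qr n1 n2])
  have b1: "vB 1 1 c" by (rule holes_vB[OF h k(2,1)]) auto
  have b2: "vB a 0 c" by (rule holes_vB[OF h not_vA_00(1)]) (use a c in auto)
  have b3: "vB 0 b c" by (rule holes_vB[OF h not_vA_00(2)]) (use b c in auto)
  then have b3': "vanishes B (q ^ b * p ^ 0 * r ^ c)" by simp
  have vanishes': "(\<Sum>x\<in>slice. 1 * (f x * g x)) = 0" if "f \<in> level p 1" "g \<in> level q 1" for f g :: "int \<Rightarrow> int"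
    using slice_vanishes_110[OF v b1 that] by simp
  obtain \<rho>' \<sigma>' where st': "\<And>x. (\<Sum>s\<in>slice. 1 * chi p x s) = int p * int q * \<rho>' x"
    "\<And>y. (\<Sum>s\<in>slice. 1 * chi q y s) = int p * int q * \<sigma>' y"
    "\<And>x y. (\<Sum>s\<in>slice. 1 * (chi p x s * chi q y s)) = int p * \<rho>' x + int q * \<sigma>' y - 1"
    "(\<Sum>x<p. \<rho>' (int x)) = 1" "(\<Sum>y<q. \<sigma>' (int y)) = 1"
    by (rule two_prime_structure[OF primes(1,2) distinct(1) vanishes', of 1])
       (use card_slice slice_row_dvd[OF b2] s.slice_row_dvd[OF b3'] a b in auto)
  have row0': "0 \<le> int p * int q * \<rho>' x" "0 \<le> int p * int q * \<sigma>' x" for x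
    unfolding st'(1,2)[symmetric] by (auto intro!: sum_nonneg)
  have nn': "\<rho>' x \<ge> 0" "\<sigma>' x \<ge> 0" for x
    using row0'[of x] pq by (simp_all only: zero_le_mult_iff) auto
  obtain x where x: "\<rho>' x = 0" using exists_zero_of_sum_less[of \<rho>' p] st'(4) nn' pos by auto
  obtain y where y: "\<sigma>' y = 0" using exists_zero_of_sum_less[of \<sigma>' q] st'(5) nn' pos by auto
  have "0 \<le> int p * \<rho>' x + int q * \<sigma>' y - 1"
    unfolding st'(3)[symmetric] by (auto intro!: sum_nonneg)
  then show False using x y by simp
qed

text \<open>
  The form of \<open>no_vB_110\<close> with an arbitrary k < c is used again for the product of all three primes;
  here it is used with \<open>k = 0\<close>.
\<close>

lemma vA_110: "vA 1 1 0"
proof (rule ccontr)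
  assume n: "\<not> vA 1 1 0"
  then have "vB 1 1 0" using dichotomy[of 1 1 0] by auto
  then show False by (rule no_vB_110[of 0]) (use n c in auto)
qed

end

section \<open>Three primes\<close>

text \<open>
  If S misses the class x, the level function \<open>l * chi l x - 1\<close> is \<open>-1\<close> on S.
\<close>

lemma empty_class_sum:
  assumes "l > 0" "finite S" "cnt S l x = 0"
    and "\<And>f. f \<in> level l 1 \<Longrightarrow> (\<Sum>s\<in>S. f s * w s) = (0::int)"
  shows "(\<Sum>s\<in>S. w s) = 0"
proof -
  have z: "chi l x s = 0" if "s \<in> S" for s
    using sum_nonneg_int_zero[OF assms(3,2) _ that] by simp
  have "0 = (\<Sum>s\<in>S. (int l * chi l x s - 1) * w s)"
    by (rule assms(4)[symmetric], rule level_chi1, rule assms)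
  also have "\<dots> = (\<Sum>s\<in>S. - w s)" using z by (intro sum.cong) auto
  finally show ?thesis by (simp add: sum_negf)
qed

lemma sum_rows_card:
  assumes "l > 0"
  shows "(\<Sum>u<l. cnt S l (int u)) = int (card S)"
  using sum_rows[OF assms, of "\<lambda>_. 1" S] by simp

lemma chi_mod: "chi l (int (nat (u mod int l))) = chi l u" if "l > 0"
  by (rule chi_cong) (use that in \<open>simp add: cong_def\<close>)

lemma row_of_sum_eq:
  fixes R :: "int \<Rightarrow> int"
  assumes "(\<Sum>u<l. R (int u)) = int l * n" "\<And>u. R u \<ge> n" "u < l"
  shows "R (int u) = n"
proof -
  have "(\<Sum>u<l. R (int u) - n) = 0" using assms(1) by (simp add: sum_subtractf)
  then have "R (int u) - n = 0"
    using assms by (subst (asm) sum_nonneg_eq_0_iff) auto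
  then show ?thesis by simp
qed

text \<open>
  An empty row removes p from the vanishing condition, so \<open>two_prime_identity\<close> applies to q, r
  and gives column counts congruent to p modulo r. As p < r, they are at least p; their sum is
  \<open>p * q\<close>, so they equal p, which q does not divide.
\<close>

lemma slice_row_nonempty:
  assumes pr: "prime p" "prime q" "prime r" "p \<noteq> q" "p < r" "q \<noteq> r"
    and S: "finite S" "card S = p * q"
    and vanishes: "\<And>f g h. f \<in> level p 1 \<Longrightarrow> g \<in> level q 1 \<Longrightarrow> h \<in> level r 1 \<Longrightarrow> (\<Sum>s\<in>S. f s * g s * h s) = (0::int)"
    and dq: "\<And>y. int q dvd cnt S q y"
  shows "cnt S p x \<noteq> 0"
proof
  assume 0: "cnt S p x = 0"
  have pos: "p > 0" "q > 0" "r > 0" using pr prime_gt_0_nat by auto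
  have cop: "coprime (int q) (int r)" using pr by (simp add: primes_coprime)
  have vanishes2: "(\<Sum>s\<in>S. 1 * (g s * h s)) = 0" if "g \<in> level q 1" "h \<in> level r 1" for g h :: "int \<Rightarrow> int"
    using empty_class_sum[OF pos(1) S(1) 0, of "\<lambda>s. g s * h s"] vanishes[OF _ that] by (simp add: mult.assoc)
  have ge: "int p \<le> cnt S q y" for y
  proof -
    from two_prime_identity[OF pos(2,3) vanishes2, of y 0]
    have "int q * (cnt S q y - int p) = int r * (int q * (\<Sum>s\<in>S. chi q y s * chi r 0 s) - cnt S r 0)"
      by (simp add: S algebra_simps)
    then have "int r dvd int q * (cnt S q y - int p)" by simp
    then have d: "int r dvd int p - cnt S q y"
      using cop by (simp add: coprime_dvd_mult_right_iff coprime_commute dvd_diff_commute)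
    have nn: "0 \<le> cnt S q y" by (intro sum_nonneg) simp
    show ?thesis
    proof (rule ccontr)
      assume "\<not> ?thesis"
      then have "int r \<le> int p - cnt S q y" using d by (intro zdvd_imp_le) auto
      then show False using nn pr by simp
    qed
  qed
  have "cnt S q (int 0) = int p"
    by (rule row_of_sum_eq[of "\<lambda>y. \<Sum>s\<in>S. chi q y s" q]) (use sum_rows_card[OF pos(2), of S] S ge pos in auto)
  then have "int q dvd int p" using dq by metis
  then show False using pr primes_dvd_imp_eq by auto
qed

text \<open>
  All q columns are nonempty multiples of q, which is too much for a set of \<open>p * q < q * q\<close>
  elements.
\<close>

lemma no_slice_with_full_rows:
  assumes pr: "prime p" "prime q" "prime r" "p < q" "q < r"
    and S: "finite S" "card S = p * q"
    and vanishes: "\<And>f g h. f \<in> level p 1 \<Longrightarrow> g \<in> level q 1 \<Longrightarrow> h \<in> level r 1 \<Longrightarrow> (\<Sum>s\<in>S. f s * g s * h s) = (0::int)"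
    and dp: "\<And>x. int p dvd cnt S p x"
    and dq: "\<And>y. int q dvd cnt S q y"
  shows False
proof -
  have "cnt S q y \<noteq> 0" for y
  proof (rule slice_row_nonempty[of q p r])
    fix f g h :: "int \<Rightarrow> int" assume "f \<in> level q 1" "g \<in> level p 1" "h \<in> level r 1"
    then show "(\<Sum>s\<in>S. f s * g s * h s) = 0" using vanishes[of g f h] by (simp add: mult.commute[of "f _"])
  qed (use assms in auto)
  moreover have "0 \<le> cnt S q y" for y by (intro sum_nonneg) simp
  ultimately have "int q \<le> cnt S q y" for y
    using dq[of y] by (intro zdvd_imp_le) (auto simp: order_less_le)
  then have "(\<Sum>y<q. int q) \<le> (\<Sum>y<q. cnt S q (int y))" by (intro sum_mono)
  also have "\<dots> = int p * int q" using sum_rows_card[of q S] S pr by simp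
  finally show False using pr by simp
qed

text \<open>
  A digit pattern splits off one digit at a time, from the top: l times the indicator of digit m
  is 1 plus a function of level m. So \<open>l ^ card F\<close> times the indicator of the pattern is 1 plus
  level functions with levels in F. With \<open>d = 0\<close> this is a statement about vanishing.
\<close>

lemma digits_dvd:
  fixes A :: "int set" and f :: "int \<Rightarrow> int"
  assumes "l > 0" "finite F" "0 \<notin> F" "\<And>i. i \<in> F \<Longrightarrow> 0 \<le> ds i \<and> ds i < int l"
    and "\<And>i g. i \<in> F \<Longrightarrow> g \<in> level l i \<Longrightarrow> d dvd (\<Sum>a\<in>A. f a * g a)"
  shows "d dvd int l ^ card F * (\<Sum>a\<in>A. f a * (\<Prod>i\<in>F. digit_ind l i (ds i) a)) - (\<Sum>a\<in>A. f a)"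
  using assms(2-)
proof (induction F rule: finite_linorder_max_induct)
  case empty
  then show ?case by simp
next
  case (insert m F)
  let ?P = "\<lambda>a. \<Prod>i\<in>F. digit_ind l i (ds i) a"
  have m: "m > 0" "m \<notin> F" using insert by (auto intro: Nat.gr0I)
  have "periodic (l ^ (m - 1)) ?P"
    unfolding periodic_def
  proof (intro allI impI prod.cong refl)
    fix x y i assume xy: "[x = y] (mod int (l ^ (m - 1)))" and i: "i \<in> F"
    have "i \<noteq> 0" using i insert.prems(1) by (metis insertCI)
    then have "periodic (l ^ (m - 1)) (digit_ind l i (ds i))"
      by (intro periodic_pow_le[OF periodic_digit_ind[OF assms(1)]]) (use i insert.hyps(2) in fastforce)+
    then show "digit_ind l i (ds i) x = digit_ind l i (ds i) y" using xy by (rule perD)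
  qed
  then have "(\<lambda>x. ?P x * (int l * digit_ind l m (ds m) x - 1)) \<in> level l m"
    by (rule level_digit_ind[rotated -1]) (use assms(1) m insert.prems in auto)
  then have "d dvd (\<Sum>a\<in>A. f a * (?P a * (int l * digit_ind l m (ds m) a - 1)))"
    by (rule insert.prems(3)[rotated]) simp
  then have "d dvd int l ^ card F * (\<Sum>a\<in>A. f a * (?P a * (int l * digit_ind l m (ds m) a - 1)))"
    by (rule dvd_mult)
  moreover have "d dvd int l ^ card F * (\<Sum>a\<in>A. f a * ?P a) - (\<Sum>a\<in>A. f a)"
    by (rule insert.IH) (use insert.prems in auto)
  ultimately have "d dvd int l ^ card F * (\<Sum>a\<in>A. f a * (?P a * (int l * digit_ind l m (ds m) a - 1)))
     + (int l ^ card F * (\<Sum>a\<in>A. f a * ?P a) - (\<Sum>a\<in>A. f a))" by (rule dvd_add)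
  also have "(\<Sum>a\<in>A. f a * (?P a * (int l * digit_ind l m (ds m) a - 1)))
     = int l * (\<Sum>a\<in>A. f a * (?P a * digit_ind l m (ds m) a)) - (\<Sum>a\<in>A. f a * ?P a)"
    unfolding sum_distrib_left sum_subtractf[symmetric]
    by (intro sum.cong refl) (simp add: algebra_simps)
  finally show ?case using m insert.hyps(1) by (simp add: algebra_simps)
qed

lemma sum_digit_ind_all:
  assumes "l > 0"
  shows "(\<Sum>j<l. digit_ind l i (int j) x) = 1"
proof -
  have d: "0 \<le> digit l i x" "digit l i x < int l" using assms by (auto simp: digit_def)
  have "(\<Sum>j<l. digit_ind l i (int j) x) = (\<Sum>j<l. if j = nat (digit l i x) then 1 else 0)"
    by (intro sum.cong refl) (use d in \<open>auto simp: digit_ind_def\<close>)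
  also have "\<dots> = 1" using d assms by (simp add: nat_less_iff)
  finally show ?thesis .
qed

context three_prime_tiling
begin

lemma row_dvd:
  assumes "vB 1 0 k" "1 \<le> k"
  shows "int p * int r dvd cnt B p x"
proof -
  have "int r dvd (\<Sum>s\<in>B. (int p * chi p x s - 1) * 1)"
  proof (rule dvd_level1[OF finB pos(3), of 0 k])
    fix g :: "int \<Rightarrow> int" assume g: "g \<in> level r k"
    from testB[OF assms(1) level_chi1[OF pos(1)] level_const[of 1] g]
    show "(\<Sum>s\<in>B. (int p * chi p x s - 1) * g s) = 0" by simp
  qed (use assms in auto)
  also have "(\<Sum>s\<in>B. (int p * chi p x s - 1) * 1) = int p * cnt B p x - int r * (int p * int q)"
    by (simp add: sum_subtractf sum_distrib_left cardB)
  finally have "int r dvd int p * cnt B p x"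
    by (metis diff_add_cancel dvd_add dvd_triv_left)
  then have "int r dvd cnt B p x" using coprimes by (simp add: coprime_dvd_mult_right_iff coprime_commute)
  then show ?thesis using B_row_dvd coprimes by (intro divides_mult) auto
qed

lemma row_pos:
  assumes "vB 1 1 1" "\<not> vB 0 1 1"
  shows "cnt B p x > 0"
proof -
  have "cnt B p x \<noteq> 0"
  proof
    assume 0: "cnt B p x = 0"
    have "vB 0 1 1"
    proof (rule vanishes_intro)
      fix f g h assume f: "f \<in> level_gen p 0" and g: "g \<in> level_gen q 1" and h: "h \<in> level_gen r 1"
      have level: "g \<in> level q 1" "h \<in> level r 1" using g h level_gen_subset_level pos by blast+
      have "(\<Sum>s\<in>B. g s * h s) = 0"
        by (rule empty_class_sum[OF pos(1) finB 0]) (use testB[OF assms(1) _ level] in \<open>simp add: mult.assoc\<close>)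
      then show "(\<Sum>s\<in>B. f s * g s * h s) = 0" using f by (simp add: level_gen_def)
    qed
    then show False using assms by simp
  qed
  moreover have "0 \<le> cnt B p x" by (intro sum_nonneg) simp
  ultimately show ?thesis by simp
qed

text \<open>
  Some value j of the k-th base-r digit is taken by at most \<open>p * q\<close> elements of B. Their number
  is divisible by r, as k < c, and by p, by vanishing at \<open>p ^ i * r ^ k\<close>; as q < r, it is 0. A
  value that never occurs removes r ^ k from the vanishing condition, so B would vanish at p ^ i;
  but \<open>i \<noteq> a\<close>.
\<close>

lemma not_vB_i0k:
  assumes "q < r" "1 \<le> i" "i \<le> Suc \<alpha>" "i \<noteq> a" "1 \<le> k" "k < c"
  shows "\<not> vB i 0 k"
proof
  assume v: "vB i 0 k"
  interpret s: three_prime_tiling p r q \<alpha> \<gamma> \<beta> a c b A B by (rule swap23)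
  interpret t: three_prime_tiling r p q \<gamma> \<alpha> \<beta> c a b A B by (rule s.swap12)
  define m where "m j = (\<Sum>s\<in>B. digit_ind r k (int j) s)" for j
  have sum_m: "(\<Sum>j<r. m j) = int r * (int p * int q)"
    unfolding m_def by (subst sum.swap) (simp add: sum_digit_ind_all[OF pos(3)] cardB)
  have "\<exists>j<r. m j \<le> int p * int q"
  proof (rule ccontr)
    assume "\<not> ?thesis"
    then have "(\<Sum>j<r. int p * int q) < (\<Sum>j<r. m j)"
      using pos by (intro sum_strict_mono) auto
    then show False using sum_m by simp
  qed
  then obtain j where j: "j < r" "m j \<le> int p * int q" by blast
  have level: "(\<lambda>x. int r * digit_ind r k (int j) x - 1) \<in> level r k"
    using level_digit_ind[OF pos(3), of k "int j" "\<lambda>_. 1"] j assms by simp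
  have rm: "int r dvd m j"
    unfolding m_def by (rule t.B_count_dvd[OF periodic_digit_ind[OF pos(3)]]) (use assms in auto)
  have "int p dvd (\<Sum>s\<in>B. (int r * digit_ind r k (int j) s - 1) * 1)"
  proof (rule dvd_level1[OF finB pos(1), of 0 i])
    fix g :: "int \<Rightarrow> int" assume g: "g \<in> level p i"
    from testB[OF v g level_const[of 1] level]
    show "(\<Sum>s\<in>B. (int r * digit_ind r k (int j) s - 1) * g s) = 0" by (simp add: mult.commute)
  qed (use assms in auto)
  also have "(\<Sum>s\<in>B. (int r * digit_ind r k (int j) s - 1) * 1) = int r * m j - int p * (int q * int r)"
    by (simp add: sum_subtractf sum_distrib_left m_def cardB)
  finally have "int p dvd int r * m j"
    by (metis diff_add_cancel dvd_add dvd_triv_left)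
  then have "int p dvd m j" using coprimes by (simp add: coprime_dvd_mult_right_iff)
  then have "int p * int r dvd m j" using rm coprimes by (intro divides_mult) auto
  moreover have nn: "m j \<ge> 0" unfolding m_def by (intro sum_nonneg) simp
  moreover have "int p * int q < int p * int r" using assms pos by simp
  ultimately have m0: "m j = 0" using j zdvd_imp_le[of "int p * int r" "m j"] by linarith
  have z: "digit_ind r k (int j) s = 0" if "s \<in> B" for s
    using sum_nonneg_int_zero[OF m0[unfolded m_def] finB _ that] by simp
  have "vB i 0 0"
  proof (rule vanishes_intro)
    fix f g h assume f: "f \<in> level_gen p i" and g: "g \<in> level_gen q 0" and h: "h \<in> level_gen r 0"
    have "f \<in> level p i" using f level_gen_subset_level pos by blast
    from testB[OF v this level_const[of 1] level]
    have "(\<Sum>s\<in>B. f s * 1 * (int r * digit_ind r k (int j) s - 1)) = 0" .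
    also have "(\<Sum>s\<in>B. f s * 1 * (int r * digit_ind r k (int j) s - 1)) = (\<Sum>s\<in>B. - f s)"
      using z by (intro sum.cong) auto
    finally show "(\<Sum>s\<in>B. f s * g s * h s) = 0" using g h by (simp add: level_gen_def sum_negf)
  qed
  then show False using a(5)[OF assms(2-4)] by simp
qed

text \<open>
  Otherwise B vanishes at \<open>p ^ i * r ^ c\<close> and \<open>p ^ i * r ^ k\<close>, so \<open>r ^ 2\<close> divides the differences of
  B between sibling classes modulo p ^ i. One of them is nonzero. It is too small: below level
  \<open>a\<close> it has an additional factor p, and above level \<open>a\<close> the classes have at most
  \<open>card B / p = q * r\<close> elements.
\<close>

lemma vA_i0k_above:
  assumes v: "vB i 0 c" and q: "q < r" and i: "1 \<le> i" "i \<le> Suc \<alpha>" "i \<noteq> a"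
    and k: "c < k" "k \<le> Suc \<gamma>"
  shows "vA i 0 k"
proof (rule ccontr)
  assume "\<not> vA i 0 k"
  then have vk: "vB i 0 k" using dichotomy[of i 0 k] i k by auto
  have "\<not> vB i 0 0" using a(5)[OF i] by simp
  then obtain f where f: "f \<in> level_gen p i" "(\<Sum>x\<in>B. f x) \<noteq> 0"
    using vanishes_intro[of i 0 0 B] by (auto simp: level_gen_def[of q] level_gen_def[of r])
  obtain u v where uv: "f = (\<lambda>x. chi (p ^ i) u x - chi (p ^ i) v x)" "[u = v] (mod int (p ^ (i - 1)))"
    using f(1) i by (auto simp: level_gen_def split: if_splits)
  have level: "f \<in> level p i" using f(1) level_gen_subset_level pos by blast
  define d where "d = (\<Sum>x\<in>B. f x)"
  have d: "d = cnt B (p ^ i) u - cnt B (p ^ i) v"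
    by (simp add: d_def uv sum_subtractf)
  have "int r ^ card {c, k} dvd (\<Sum>x\<in>B. f x * 1)"
  proof (rule level_dvd[OF finB pos(3), of _ 0 "Suc \<gamma>"])
    show "{c, k} \<subseteq> {0<..Suc \<gamma>}" using c k by auto
    fix j and g :: "int \<Rightarrow> int" assume "j \<in> {c, k}" and g: "g \<in> level r j"
    then have "vB i 0 j" using v vk by auto
    from testB[OF this level level_const[of 1] g] show "(\<Sum>x\<in>B. f x * g x) = 0" by simp
  qed simp
  then have rd: "int r ^ 2 dvd d" using k by (simp add: d_def card_insert_if power2_eq_square)
  have nn: "0 \<le> cnt B m t" for m t by (intro sum_nonneg) simp
  have le: "cnt B m t \<le> int p * int q * int r" for m t
    using sum_mono[of B "chi m t" "\<lambda>_. 1"] by (simp add: cardB)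
  have "int p * int r ^ 2 \<le> int p * int q * int r"
  proof (cases "i < a")
    case True
    have "int p dvd d" unfolding d using True by (intro dvd_diff B_count_dvd[of i]) auto
    then have "int p * int r ^ 2 dvd d" using rd coprimes by (intro divides_mult) auto
    then have "int p * int r ^ 2 \<le> \<bar>d\<bar>" using dvd_imp_le_int[of d "int p * int r ^ 2"] f(2) by (simp add: d_def abs_mult)
    also have "\<dots> \<le> int p * int q * int r" unfolding d using nn le by (smt (verit))
    finally show ?thesis .
  next
    case False
    have le': "int p * cnt B (p ^ i) t \<le> int p * int q * int r" for t
    proof -
      have "p ^ a dvd p ^ i" using False by (simp add: le_imp_power_dvd)
      then have "chi (p ^ i) t x \<le> chi (p ^ a) t x" for x
        unfolding chi_def by (auto intro: cong_dvd_modulus simp del: of_nat_power)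
      then have "cnt B (p ^ i) t \<le> cnt B (p ^ a) t" by (intro sum_mono)
      moreover have "(\<Sum>x\<in>B. (int p * chi (p ^ a) t x - chi (p ^ (a - 1)) t x) * 1 * 1) = 0"
        by (rule testB[OF vB_00(1)]) (use level_chi_top pos a in auto)
      then have "int p * cnt B (p ^ a) t = cnt B (p ^ (a - 1)) t"
        by (simp add: sum_subtractf sum_distrib_left)
      ultimately show ?thesis using le[of "p ^ (a - 1)" t] pos
        by (metis mult_left_mono of_nat_0_le_iff order_trans)
    qed
    have "int r ^ 2 \<le> \<bar>d\<bar>" using dvd_imp_le_int[OF _ rd] f(2) by (simp add: d_def)
    then have "int p * int r ^ 2 \<le> int p * \<bar>d\<bar>" using pos by simp
    also have "\<dots> = \<bar>int p * cnt B (p ^ i) u - int p * cnt B (p ^ i) v\<bar>"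
      unfolding d by (simp add: abs_mult right_diff_distrib[symmetric])
    also have "\<dots> \<le> int p * int q * int r"
    proof -
      have "0 \<le> int p * cnt B (p ^ i) t" for t using nn pos by simp
      from this[of u] this[of v] le'[of u] le'[of v] show ?thesis by linarith
    qed
    finally show ?thesis .
  qed
  then have "r \<le> q" using pos by (simp add: power2_eq_square)
  then show False using q by simp
qed

end

text \<open>
  The order of the primes can be prescribed by symmetry. The lemmas in this locale refute its
  assumptions.
\<close>

locale pqr_counterexample = three_prime_tiling +
  assumes order: "p < q" "q < r" and bad: "\<not> vA 1 1 1"
begin

sublocale s: three_prime_tiling q p r \<beta> \<alpha> \<gamma> b a c A B by (rule swap12)

lemma vB_111: "vB 1 1 1"
  using dichotomy[of 1 1 1] bad by auto

lemma not_vB_110: "\<not> vB 1 1 0" "\<not> vB 1 0 1" "\<not> vB 0 1 1"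
proof -
  interpret t: three_prime_tiling p r q \<alpha> \<gamma> \<beta> a c b A B by (rule swap23)
  interpret u: three_prime_tiling q r p \<beta> \<gamma> \<alpha> b c a A B by (rule s.swap23)
  show "\<not> vB 1 1 0" using no_vB_110[of 1] bad c by auto
  show "\<not> vB 1 0 1" using t.no_vB_110[of 1] bad b by (auto simp: mult_ac)
  show "\<not> vB 0 1 1" using u.no_vB_110[of 1] bad a by (auto simp: mult_ac)
qed

lemma rows_pos: "cnt B p x > 0" "cnt B q x > 0"
proof -
  show "cnt B p x > 0" by (rule row_pos[OF vB_111 not_vB_110(3)])
  show "cnt B q x > 0"
    by (rule s.row_pos) (use vB_111 not_vB_110(2) in \<open>auto simp: mult_ac\<close>)
qed

text \<open>
  The q columns of B are nonempty, so they would have at least \<open>q * q * r > card B\<close> elements.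
\<close>

lemma not_qr_dvd_rows: "\<not> (\<forall>y. int q * int r dvd cnt B q y)"
proof
  assume *: "\<forall>y. int q * int r dvd cnt B q y"
  then have "int q * int r \<le> cnt B q y" for y
    using rows_pos(2)[of y] by (intro zdvd_imp_le) auto
  then have "(\<Sum>y<q. int q * int r) \<le> (\<Sum>y<q. cnt B q (int y))" by (intro sum_mono)
  also have "\<dots> = int p * int q * int r" using sum_rows_card[OF pos(2), of B] cardB by simp
  finally have "int q * (int q * int r) \<le> int p * (int q * int r)" by simp
  then show False using order pos by simp
qed

lemma not_vB_01k: "1 \<le> k \<Longrightarrow> \<not> vB 0 1 k"
  using not_qr_dvd_rows s.row_dvd[of k] by auto

lemma vA_01k: "k \<le> Suc \<gamma> \<Longrightarrow> vA 0 1 k"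
  using not_vB_01k[of k] dichotomy[of 0 1 k] vA_00(3)[of 1] b by (cases "k = 0") auto

lemma vA_i0k:
  assumes "1 \<le> i" "i \<le> Suc \<alpha>" "i \<noteq> a" "k < c"
  shows "vA i 0 k"
proof (cases "k = 0")
  case True
  then show ?thesis using vA_00(2)[OF assms(1-3)] by simp
next
  case False
  then show ?thesis using not_vB_i0k[OF order(2) assms(1-3), of k] dichotomy[of i 0 k] assms c by auto
qed

text \<open>
  Otherwise there are holes, and the slice contradicts \<open>no_slice_with_full_rows\<close>.
\<close>

lemma vB_10c: "vB 1 0 c"
proof (rule ccontr)
  assume n: "\<not> vB 1 0 c"
  have h: holes by (rule holesI) (use order n not_vB_01k[of c] c in auto)
  have b1: "vB 1 1 c" by (rule holes_vB[OF h bad]) (use c in auto)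
  have b2: "vB a 0 c" by (rule holes_vB[OF h not_vA_00(1)]) (use a c in auto)
  have b3: "vB 0 b c" by (rule holes_vB[OF h not_vA_00(2)]) (use b c in auto)
  then have b3': "vanishes B (q ^ b * p ^ 0 * r ^ c)" by simp
  show False
    by (rule no_slice_with_full_rows[OF primes order fin_slice _ slice_vanishes_111[OF vB_111 b1] slice_row_dvd[OF b2] s.slice_row_dvd[OF b3']])
      (use card_slice a b in \<open>auto simp flip: of_nat_mult\<close>)
qed

lemma rows_dvd: "int p * int r dvd cnt B p x"
  by (rule row_dvd[OF vB_10c]) (use c in auto)

end

section \<open>Differences in A and B\<close>

lemma chi_pos_iff: "chi m u x > 0 \<longleftrightarrow> [x = u] (mod int m)"
  by (simp add: chi_def)

lemma exists_pos_term:
  fixes f :: "'b \<Rightarrow> int"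
  assumes "(\<Sum>s\<in>S. f s) > 0"
  shows "\<exists>s\<in>S. f s > 0"
  using assms sum_nonpos[of S f] by (metis linorder_not_less)

lemma not_cong_small:
  assumes "e < n" "e' < n" "e \<noteq> e'" "m > 0"
  shows "\<not> [x + int (e * m) = x + int (e' * m)] (mod int (n * m))"
proof
  assume "[x + int (e * m) = x + int (e' * m)] (mod int (n * m))"
  then have "[int (e * m) = int (e' * m)] (mod int (n * m))" by (rule cong_add_lcancel[THEN iffD1])
  then have "[e * m = e' * m] (mod n * m)" using cong_int_iff by blast
  moreover have "e * m < n * m" "e' * m < n * m" using assms by auto
  ultimately have "e * m = e' * m" by (simp add: cong_def)
  then show False using assms by simp
qed

context three_prime_tiling
begin

lemma gcd_eq_rpow:
  fixes d :: int
  assumes "int (r ^ m) dvd d" "\<not> int (r ^ Suc m) dvd d" "\<not> int p dvd d" "\<not> int q dvd d" "m \<le> n"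
  shows "gcd d (int (p ^ i * q ^ j * r ^ n)) = int (r ^ m)"
proof -
  have pr: "prime (int p)" "prime (int q)" "prime (int r)" using primes by auto
  have "coprime d (int p)" "coprime d (int q)"
    using pr assms by (metis coprime_commute prime_imp_coprime)+
  then have cop: "coprime d (int (p ^ i * q ^ j))" by (simp add: coprime_mult_right_iff)
  obtain e where e: "d = int (r ^ m) * e" using assms(1) by blast
  have "\<not> int r dvd e" using assms(2) e by (auto simp: mult_ac)
  then have "coprime e (int (r ^ (n - m)))"
    using pr by (metis coprime_commute coprime_power_right_iff of_nat_power prime_imp_coprime)
  then have ce: "gcd e (int (r ^ (n - m))) = 1" by simp
  have "gcd d (int (p ^ i * q ^ j * r ^ n)) = gcd d (int (r ^ n))"
    unfolding of_nat_mult[of "p ^ i * q ^ j"] by (rule gcd_mult_right_left_cancel[OF cop])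
  also have "int (r ^ n) = int (r ^ m) * int (r ^ (n - m))" using assms(5) by (simp flip: power_add)
  also have "gcd d (int (r ^ m) * int (r ^ (n - m))) = int (r ^ m)"
    unfolding e gcd_mult_left ce by simp
  finally show ?thesis .
qed

text \<open>
  Vanishing at \<open>p * r ^ k\<close> for all \<open>k \<le> K\<close> makes the number of elements of A in a class modulo
  \<open>r ^ K\<close> and a class modulo p independent of the latter.
\<close>

lemma class_meets_rows:
  assumes "\<And>k. k \<le> K \<Longrightarrow> vA 1 0 k" "t \<in> A"
  shows "\<exists>s\<in>A. [s = x] (mod int p) \<and> [s = t] (mod int (r ^ K))"
proof -
  let ?f = "\<lambda>s. chi p x s - chi p t s"
  have level: "?f \<in> level p 1" using level_chi_diff[OF pos(1), of 1 x t] by simp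
  have "int r ^ K * (\<Sum>s\<in>A. ?f s * chi (r ^ K) t s) = (\<Sum>s\<in>A. ?f s)"
  proof (rule level_even[OF pos(3)])
    fix k and g :: "int \<Rightarrow> int" assume k: "1 \<le> k" "k \<le> K" and g: "g \<in> level r k"
    from testA[OF assms(1)[OF k(2)] level level_const[of 1] g]
    show "(\<Sum>s\<in>A. ?f s * g s) = 0" by simp
  qed
  also have "(\<Sum>s\<in>A. ?f s) = 0"
    using testA[OF assms(1)[of 0] level level_const[of 1] level_const[of 1]] by simp
  finally have "(\<Sum>s\<in>A. ?f s * chi (r ^ K) t s) = 0" using pos by simp
  then have eq: "(\<Sum>s\<in>A. chi p x s * chi (r ^ K) t s) = (\<Sum>s\<in>A. chi p t s * chi (r ^ K) t s)"
    by (simp add: left_diff_distrib sum_subtractf)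
  have "chi p t t * chi (r ^ K) t t \<le> (\<Sum>s\<in>A. chi p t s * chi (r ^ K) t s)"
    by (rule member_le_sum[OF assms(2) _ finA]) simp
  then have "(\<Sum>s\<in>A. chi p x s * chi (r ^ K) t s) > 0" unfolding eq by (simp add: chi_def)
  then obtain s where "s \<in> A" "chi p x s * chi (r ^ K) t s > 0" using exists_pos_term by blast
  then show ?thesis by (intro bexI[of _ s]) (auto simp: chi_def of_bool_def split: if_splits)
qed

end

context pqr_counterexample
begin

text \<open>
  Some class modulo \<open>r ^ (c - 1)\<close> has all its children inhabited; each child meets all classes modulo
  q, and the class itself meets all classes modulo p. Take elements w 0, w 1, w 2 in distinct
  children and in distinct classes modulo q. If they agree modulo p, take an element s of the
  class that differs from them modulo p: it shares its child with at most one of them, and its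
  class modulo q with at most one, so the third serves.
\<close>

lemma A_pair:
  assumes "\<not> holes"
  shows "\<exists>s\<in>A. \<exists>t\<in>A. [s = t] (mod int (r ^ (c - 1))) \<and> \<not> [s = t] (mod int (r ^ c)) \<and>
    \<not> [s = t] (mod int p) \<and> \<not> [s = t] (mod int q)"
proof -
  from assms obtain u where u: "\<And>v. [v = u] (mod int (r ^ (c - 1))) \<Longrightarrow> cnt A (r ^ c) v \<noteq> 0"
    unfolding holes_def by blast
  have rc: "r ^ c = r * r ^ (c - 1)" using c by (simp add: power_eq_if)
  have dv: "[s = t] (mod int (r ^ (c - 1)))" if "[s = t] (mod int (r ^ c))" for s t
    using cong_dvd_modulus[OF that] unfolding rc by simp
  define v where "v e = u + int (e * r ^ (c - 1))" for e
  have vu: "[v e = u] (mod int (r ^ (c - 1)))" for e by (simp add: v_def cong_def)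
  have "\<exists>s\<in>A. [s = int e] (mod int q) \<and> [s = v e] (mod int (r ^ c))" for e
  proof -
    have "cnt A (r ^ c) (v e) > 0"
      using u[OF vu[of e]] by (metis chi_nonneg order_less_le sum_nonneg)
    then obtain t where t: "t \<in> A" "[t = v e] (mod int (r ^ c))"
      using exists_pos_term chi_pos_iff by blast
    have "\<exists>s\<in>A. [s = int e] (mod int q) \<and> [s = t] (mod int (r ^ c))"
      by (rule s.class_meets_rows[OF _ t(1)]) (use vA_01k c in auto)
    then show ?thesis using t(2) cong_trans by blast
  qed
  then obtain w where w: "\<And>e. w e \<in> A" "\<And>e. [w e = int e] (mod int q)" "\<And>e. [w e = v e] (mod int (r ^ c))"
    by metis
  have wu: "[w e = u] (mod int (r ^ (c - 1)))" for e
    using dv[OF w(3)] vu cong_trans by blast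
  have q3: "3 \<le> q" "3 \<le> r" using order pos by auto
  have nq: "\<not> [w e = w e'] (mod int q)" if "e < 3" "e' < 3" "e \<noteq> e'" for e e'
  proof
    assume "[w e = w e'] (mod int q)"
    then have "[int e = int e'] (mod int q)" using w(2) cong_sym cong_trans by meson
    then show False using not_cong_small[of e q e' 1 0] that q3 by simp
  qed
  have nr: "\<not> [w e = w e'] (mod int (r ^ c))" if "e < 3" "e' < 3" "e \<noteq> e'" for e e'
  proof
    assume "[w e = w e'] (mod int (r ^ c))"
    then have "[v e = v e'] (mod int (r ^ c))" using w(3) cong_sym cong_trans by meson
    then show False using not_cong_small[of e r e' "r ^ (c - 1)" u] that q3 unfolding v_def rc by simp
  qed
  show ?thesis
  proof (cases "\<exists>e<3. \<exists>e'<3. \<not> [w e = w e'] (mod int p)")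
    case True
    then obtain e e' where e: "e < 3" "e' < 3" "\<not> [w e = w e'] (mod int p)" by blast
    then have "e \<noteq> e'" by auto
    then show ?thesis using e nq nr w(1) wu cong_sym cong_trans by meson
  next
    case False
    have "\<exists>s\<in>A. [s = w 0 + 1] (mod int p) \<and> [s = w 0] (mod int (r ^ (c - 1)))"
    proof (rule class_meets_rows[OF _ w(1)])
      show "vA 1 0 k" if "k \<le> c - 1" for k by (rule vA_i0k) (use a c that in auto)
    qed
    then obtain s where s: "s \<in> A" "[s = w 0 + 1] (mod int p)" "[s = w 0] (mod int (r ^ (c - 1)))"
      by blast
    have sp: "\<not> [s = w e] (mod int p)" if "e < 3" for e
    proof
      assume "[s = w e] (mod int p)"
      moreover have "[w e = w 0] (mod int p)" using False that by auto
      ultimately have "[w 0 + 1 = w 0] (mod int p)" using s(2) cong_sym cong_trans by meson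
      then show False using not_cong_small[of 1 p 0 1 "w 0"] pos by simp
    qed
    have "\<exists>e<3. \<not> [s = w e] (mod int q) \<and> \<not> [s = w e] (mod int (r ^ c))"
    proof (rule ccontr)
      assume *: "\<not> ?thesis"
      have "[s = w e] (mod int q) \<or> [s = w e] (mod int (r ^ c))" if "e < 3" for e
        using * that by blast
      from this[of 0] this[of 1] this[of 2] nq[of 0 1] nq[of 0 2] nq[of 1 2] nr[of 0 1] nr[of 0 2] nr[of 1 2]
      show False by simp (meson cong_sym cong_trans)
    qed
    then obtain e where e: "e < 3" "\<not> [s = w e] (mod int q)" "\<not> [s = w e] (mod int (r ^ c))" by blast
    have "[s = w e] (mod int (r ^ (c - 1)))" using s(3) wu cong_sym cong_trans by meson
    then show ?thesis using e sp[OF e(1)] s(1) w(1) by blast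
  qed
qed

text \<open>
  The difference \<open>\<delta> y\<close> of the counts of B in two sibling classes u, v modulo r ^ c, on the class
  y modulo q, is not identically 0, has sum 0, and is spread evenly over the classes modulo p.
  Pick an element over u where it is positive, and one over v where it is negative, in
  different classes modulo p.
\<close>

lemma B_pair:
  assumes v11: "vB 1 1 c"
  shows "\<exists>s\<in>B. \<exists>t\<in>B. [s = t] (mod int (r ^ (c - 1))) \<and> \<not> [s = t] (mod int (r ^ c)) \<and>
    \<not> [s = t] (mod int p) \<and> \<not> [s = t] (mod int q)"
proof -
  have "\<not> vanishes B (q ^ 1 * p ^ 0 * r ^ c)" using not_vB_01k[of c] c by auto
  then obtain y u v where uv: "[u = v] (mod int (r ^ (c - 1)))"
    "(\<Sum>s\<in>B. (chi (r ^ c) u s - chi (r ^ c) v s) * chi q y s) \<noteq> 0"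
    by (rule s.not_vB_10c)
  define h where "h s = chi (r ^ c) u s - chi (r ^ c) v s" for s
  have h: "h \<in> level r c" unfolding h_def by (rule level_chi_diff) (use pos c uv in auto)
  define \<delta> where "\<delta> y = (\<Sum>s\<in>B. h s * chi q y s)" for y
  define D where "D x y = (\<Sum>s\<in>B. h s * (chi p x s * chi q y s))" for x y
  have pD: "int p * D x y = \<delta> y" for x y
  proof -
    have f: "(\<lambda>s. int p * chi p x s - 1) \<in> level p 1" "(\<lambda>s. int q * chi q y s - 1) \<in> level q 1"
      using level_chi1 pos by auto
    have "(\<Sum>s\<in>B. (int p * chi p x s - 1) * (int q * chi q y s - 1) * h s) = 0"
      by (rule testB[OF v11 f h])
    moreover have "(\<Sum>s\<in>B. (int p * chi p x s - 1) * 1 * h s) = 0"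
      by (rule testB[OF vB_10c f(1) level_const h])
    ultimately have "0 = (\<Sum>s\<in>B. (int p * chi p x s - 1) * (int q * chi q y s - 1) * h s)
       + (\<Sum>s\<in>B. (int p * chi p x s - 1) * 1 * h s)" by simp
    also have "\<dots> = int q * (int p * D x y - \<delta> y)"
      unfolding D_def \<delta>_def sum_distrib_left sum_subtractf[symmetric] sum.distrib[symmetric]
      by (intro sum.cong refl) (simp add: algebra_simps)
    finally show ?thesis using pos by simp
  qed
  have "(\<Sum>y<q. \<delta> (int y)) = (\<Sum>s\<in>B. h s)" unfolding \<delta>_def by (rule sum_rows[OF pos(2)])
  also have "\<dots> = 0" using testB[OF vB_00(3) level_const[of 1] level_const[of 1] h] by simp
  finally have tot: "(\<Sum>y<q. \<delta> (int y)) = 0" .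
  define y' where "y' = nat (y mod int q)"
  have y': "y' < q" "\<delta> (int y') = \<delta> y"
    unfolding y'_def \<delta>_def chi_mod[OF pos(2)] using pos by (auto simp: nat_less_iff)
  have d0: "\<delta> (int y') \<noteq> 0" unfolding y' using uv(2) by (simp add: \<delta>_def h_def)
  have "\<exists>y<q. \<delta> (int y) > 0"
  proof (rule ccontr)
    assume "\<not> ?thesis"
    then have le: "\<delta> (int y) \<le> 0" if "y < q" for y using that by force
    have "- \<delta> (int y') = 0"
      by (intro sum_nonneg_int_zero[of "\<lambda>y. - \<delta> (int y)" "{..<q}"])
        (use tot y'(1) le in \<open>auto simp: sum_negf\<close>)
    then show False using d0 by simp
  qed
  then obtain y1 where y1: "\<delta> (int y1) > 0" by blast
  have "\<exists>y<q. \<delta> (int y) < 0"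
  proof (rule ccontr)
    assume "\<not> ?thesis"
    then have le: "\<delta> (int y) \<ge> 0" if "y < q" for y using that by force
    have "\<delta> (int y') = 0"
      by (intro sum_nonneg_int_zero[of "\<lambda>y. \<delta> (int y)" "{..<q}"])
        (use tot y'(1) le in auto)
    then show False using d0 by simp
  qed
  then obtain y2 where y2: "\<delta> (int y2) < 0" by blast
  have "D 0 (int y1) > 0" using pD[of 0 "int y1"] y1 pos by (metis of_nat_0_less_iff zero_less_mult_pos)
  then obtain s where s: "s \<in> B" "h s * (chi p 0 s * chi q (int y1) s) > 0"
    unfolding D_def using exists_pos_term by blast
  then have s2: "[s = 0] (mod int p)" "[s = int y1] (mod int q)" "[s = u] (mod int (r ^ c))" "\<not> [s = v] (mod int (r ^ c))"
    by (auto simp: h_def chi_def of_bool_def split: if_splits)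
  have "int p * - D 1 (int y2) > 0" using pD[of 1 "int y2"] y2 by simp
  then have "- D 1 (int y2) > 0" using pos by (metis of_nat_0_less_iff zero_less_mult_pos)
  then have "(\<Sum>s\<in>B. - (h s * (chi p 1 s * chi q (int y2) s))) > 0" by (simp add: D_def sum_negf)
  then obtain t where t: "t \<in> B" "- (h t * (chi p 1 t * chi q (int y2) t)) > 0"
    using exists_pos_term by blast
  then have t2: "[t = 1] (mod int p)" "[t = int y2] (mod int q)" "[t = v] (mod int (r ^ c))"
    by (auto simp: h_def chi_def of_bool_def split: if_splits)
  have "\<not> [s = t] (mod int p)"
  proof
    assume "[s = t] (mod int p)"
    then have "[0 = (1::int)] (mod int p)" using s2(1) t2(1) cong_sym cong_trans by meson
    then show False using pos by (auto simp: cong_def)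
  qed
  moreover have "\<not> [s = t] (mod int q)"
  proof
    assume "[s = t] (mod int q)"
    then have "[int y1 = int y2] (mod int q)" using s2(2) t2(2) cong_sym cong_trans by meson
    then have "\<delta> (int y1) = \<delta> (int y2)" by (simp add: \<delta>_def chi_cong)
    then show False using y1 y2 by simp
  qed
  moreover have "\<not> [s = t] (mod int (r ^ c))" using s2(4) t2(3) cong_trans by blast
  moreover have "[s = t] (mod int (r ^ (c - 1)))"
  proof -
    have "int (r ^ (c - 1)) dvd int (r ^ c)" by (simp add: le_imp_power_dvd)
    then have "[s = u] (mod int (r ^ (c - 1)))" "[t = v] (mod int (r ^ (c - 1)))"
      using s2(3) t2(3) cong_dvd_modulus by blast+
    then show ?thesis using uv(1) cong_sym cong_trans by meson
  qed
  ultimately show ?thesis using s(1) t(1) by blast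
qed

text \<open>
  If B vanishes at \<open>q ^ b * r ^ c\<close>, the slice contradicts \<open>no_slice_with_full_rows\<close>. If not, A
  does, so there cannot be holes; then \<open>A_pair\<close> and \<open>B_pair\<close> yield differences in A and in B
  that both have gcd \<open>r ^ (c - 1)\<close> with M.
\<close>

lemma not_vB_11c: "\<not> vB 1 1 c"
proof
  assume v11: "vB 1 1 c"
  have "\<not> vB 0 b c"
  proof
    assume "vB 0 b c"
    then have b3': "vanishes B (q ^ b * p ^ 0 * r ^ c)" by simp
    show False
      by (rule no_slice_with_full_rows[OF primes order fin_slice _ slice_vanishes_111[OF vB_111 v11] slice_row_dvd[OF vB_10c] s.slice_row_dvd[OF b3']])
        (use card_slice a b in \<open>auto simp flip: of_nat_mult\<close>)
  qed
  then have "vA 0 b c" using dichotomy[of 0 b c] b c by auto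
  then have "\<not> holes" using holes_lift[of 0 b 0] not_vA_00(2) c by auto
  from A_pair[OF this] obtain s t where st: "s \<in> A" "t \<in> A" "[s = t] (mod int (r ^ (c - 1)))"
    "\<not> [s = t] (mod int (r ^ c))" "\<not> [s = t] (mod int p)" "\<not> [s = t] (mod int q)" by blast
  from B_pair[OF v11] obtain s' t' where st': "s' \<in> B" "t' \<in> B" "[s' = t'] (mod int (r ^ (c - 1)))"
    "\<not> [s' = t'] (mod int (r ^ c))" "\<not> [s' = t'] (mod int p)" "\<not> [s' = t'] (mod int q)" by blast
  have c1: "Suc (c - 1) = c" using c by simp
  have g: "gcd (x - y) (int (p ^ Suc \<alpha> * q ^ Suc \<beta> * r ^ Suc \<gamma>)) = int (r ^ (c - 1))"
    if "[x = y] (mod int (r ^ (c - 1)))" "\<not> [x = y] (mod int (r ^ c))"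
      "\<not> [x = y] (mod int p)" "\<not> [x = y] (mod int q)" for x y
    using gcd_eq_rpow[of "c - 1" "x - y" "Suc \<gamma>" "Suc \<alpha>" "Suc \<beta>"] that c(2)
    unfolding c1 cong_iff_dvd_diff by linarith
  have "s = t" by (rule gcd_differences[OF st(1,2) st'(1,2)]) (simp only: g[OF st(3-)] g[OF st'(3-)])
  then show False using st(5) by simp
qed

end

section \<open>Pieces of A with prescribed digits\<close>

lemma digit_1_cong: "l > 0 \<Longrightarrow> [digit l 1 x = x] (mod int l)"
  by (simp add: digit_def cong_def)

text \<open>
  Partition according to the digits in F; a function modulo l is constant on each part, because
  the first digit is among them.
\<close>

lemma digits_expand:
  fixes f :: "int \<Rightarrow> int"
  assumes l: "l > 0" and F: "finite F" "1 \<in> F" and f: "periodic l f"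
  shows "f x = (\<Sum>ds\<in>Pi\<^sub>E F (\<lambda>_. {..<l}). f (int (ds 1)) * (\<Prod>i\<in>F. digit_ind l i (int (ds i)) x))"
proof -
  have "1 = (\<Prod>i\<in>F. \<Sum>j<l. digit_ind l i (int j) x)" by (simp add: sum_digit_ind_all[OF l])
  also have "\<dots> = (\<Sum>ds\<in>Pi\<^sub>E F (\<lambda>_. {..<l}). \<Prod>i\<in>F. digit_ind l i (int (ds i)) x)"
    by (rule prod_sum_PiE) (use F in auto)
  finally have "(\<Sum>ds\<in>Pi\<^sub>E F (\<lambda>_. {..<l}). \<Prod>i\<in>F. digit_ind l i (int (ds i)) x) = 1" ..
  then have "f x = (\<Sum>ds\<in>Pi\<^sub>E F (\<lambda>_. {..<l}). f x * (\<Prod>i\<in>F. digit_ind l i (int (ds i)) x))"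
    unfolding sum_distrib_left[symmetric] by simp
  also have "\<dots> = (\<Sum>ds\<in>Pi\<^sub>E F (\<lambda>_. {..<l}). f (int (ds 1)) * (\<Prod>i\<in>F. digit_ind l i (int (ds i)) x))"
  proof (intro sum.cong refl)
    fix ds
    show "f x * (\<Prod>i\<in>F. digit_ind l i (int (ds i)) x) = f (int (ds 1)) * (\<Prod>i\<in>F. digit_ind l i (int (ds i)) x)"
    proof (cases "digit l 1 x = int (ds 1)")
      case True
      then have "f x = f (int (ds 1))" using perD[OF f digit_1_cong[OF l, of x]] by simp
      then show ?thesis by simp
    next
      case False
      then have "digit_ind l 1 (int (ds 1)) x = 0" by (simp add: digit_ind_def)
      then have "(\<Prod>i\<in>F. digit_ind l i (int (ds i)) x) = 0" using F by (meson prod_zero)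
      then show ?thesis by simp
    qed
  qed
  finally show ?thesis .
qed

lemma prod_digit_ind_nonneg: "(\<Prod>i\<in>F. digit_ind l i (ds i) x) \<ge> 0"
  by (intro prod_nonneg) simp

context three_prime_tiling
begin

lemma A_parent_vanishes:
  assumes "\<And>k. k < c \<Longrightarrow> vA i 0 k" "g \<in> level p i"
  shows "(\<Sum>s\<in>A. chi (r ^ (c - 1)) u s * g s) = (0::int)"
proof -
  have "int r ^ (c - 1) * (\<Sum>s\<in>A. g s * chi (r ^ (c - 1)) u s) = (\<Sum>s\<in>A. g s)"
  proof (rule level_even[OF pos(3)])
    fix k and h :: "int \<Rightarrow> int" assume k: "1 \<le> k" "k \<le> c - 1" and h: "h \<in> level r k"
    have "k < c" using k by simp
    from testA[OF assms(1)[OF this] assms(2) level_const[of 1] h]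
    show "(\<Sum>s\<in>A. g s * h s) = 0" by simp
  qed
  also have "(\<Sum>s\<in>A. g s) = 0"
    using testA[OF assms(1)[of 0] assms(2) level_const[of 1] level_const[of 1]] c by simp
  finally show ?thesis using pos by (simp add: mult.commute)
qed

text \<open>
  If A vanishes at \<open>p ^ i * r ^ c\<close>, the sum is \<open>1 / r\<close> of that over the parent class, which is 0.
  If not, \<open>vA_i0k_above\<close> provides vanishing at all levels above c.
\<close>

lemma A_child_r_p:
  assumes v: "\<And>k. k < c \<Longrightarrow> vA i 0 k" and g: "g \<in> level p i"
    and i: "1 \<le> i" "i \<le> Suc \<alpha>" "i \<noteq> a" and q: "q < r"
  shows "int r ^ (Suc \<gamma> - c) dvd (\<Sum>s\<in>A. chi (r ^ c) u s * g s)"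
proof (cases "vA i 0 c")
  case True
  have "(\<Sum>s\<in>A. g s * 1 * (int r * chi (r ^ c) u s - chi (r ^ (c - 1)) u s)) = 0"
    by (rule testA[OF True g]) (use level_chi_top pos c in auto)
  then have "int r * (\<Sum>s\<in>A. chi (r ^ c) u s * g s) = (\<Sum>s\<in>A. chi (r ^ (c - 1)) u s * g s)"
    by (simp add: sum_distrib_left sum_subtractf right_diff_distrib mult_ac)
  then show ?thesis using A_parent_vanishes[OF v g] pos by simp
next
  case False
  then have vB: "vB i 0 c" using dichotomy[of i 0 c] i c by auto
  have "int r ^ card {c<..Suc \<gamma>} dvd (\<Sum>s\<in>A. g s * chi (r ^ c) u s)"
  proof (rule level_dvd[OF finA pos(3)])
    fix k and h :: "int \<Rightarrow> int" assume k: "k \<in> {c<..Suc \<gamma>}" and h: "h \<in> level r k"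
    have "vA i 0 k" by (rule vA_i0k_above[OF vB q i]) (use k in auto)
    from testA[OF this g level_const[of 1] h] show "(\<Sum>s\<in>A. g s * h s) = 0" by simp
  qed auto
  then show ?thesis by (simp add: mult.commute)
qed

end

context pqr_counterexample
begin

text \<open>
  Vanishing at \<open>p * q * r\<close> gives divisibility by r of the alternating sums of cells over rectangles;
  summing over one coordinate and using that r divides the rows leaves two cells.
\<close>

lemma alt_dvd: "int r dvd (\<Sum>s\<in>B. chi p x s * chi q y s) - (\<Sum>s\<in>B. chi p x' s * chi q y s)"
proof -
  let ?f = "\<lambda>s. chi p x s - chi p x' s"
  have f: "?f \<in> level p 1" using level_chi_diff[OF pos(1), of 1 x x'] by simp
  have "int r dvd (\<Sum>s\<in>B. (?f s * (int q * chi q y s - 1)) * 1)"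
  proof (rule dvd_level1[OF finB pos(3), of 0 1])
    fix g :: "int \<Rightarrow> int" assume "g \<in> level r 1"
    from testB[OF vB_111 f level_chi1[OF pos(2)] this]
    show "(\<Sum>s\<in>B. ?f s * (int q * chi q y s - 1) * g s) = 0" .
  qed auto
  also have "(\<Sum>s\<in>B. (?f s * (int q * chi q y s - 1)) * 1)
    = int q * ((\<Sum>s\<in>B. chi p x s * chi q y s) - (\<Sum>s\<in>B. chi p x' s * chi q y s))
      - (cnt B p x - cnt B p x')"
    unfolding sum_distrib_left sum_subtractf[symmetric]
    by (intro sum.cong refl) (simp add: algebra_simps)
  finally have d: "int r dvd int q * ((\<Sum>s\<in>B. chi p x s * chi q y s) - (\<Sum>s\<in>B. chi p x' s * chi q y s))
      - (cnt B p x - cnt B p x')" .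
  have "int r dvd cnt B p x - cnt B p x'"
    using rows_dvd by (intro dvd_diff) (auto dest: dvd_mult_right)
  then have "int r dvd int q * ((\<Sum>s\<in>B. chi p x s * chi q y s) - (\<Sum>s\<in>B. chi p x' s * chi q y s))"
    using d by (metis diff_add_cancel dvd_add)
  then show ?thesis using coprimes by (simp add: coprime_dvd_mult_right_iff coprime_commute)
qed

text \<open>
  By \<open>alt_dvd\<close>, divisibility by r of a cell depends on its column only; if all cells were divisible,
  \<open>q * r\<close> would divide all columns.
\<close>

lemma exists_column: "\<exists>y. \<forall>x. \<not> int r dvd (\<Sum>s\<in>B. chi p x s * chi q y s)"
proof (rule ccontr)
  assume "\<not> ?thesis"
  then have "\<exists>x. int r dvd (\<Sum>s\<in>B. chi p x s * chi q y s)" for y by blast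
  then have *: "int r dvd (\<Sum>s\<in>B. chi p x s * chi q y s)" for x y
    using alt_dvd[of x y] by (metis diff_add_cancel dvd_add)
  have "int r dvd cnt B q y" for y
    unfolding sum_rows[OF pos(1), of "chi q y" B, symmetric]
    by (rule dvd_sum) (use * in \<open>simp only: mult.commute[of "chi q y _"]\<close>)
  then have "int q * int r dvd cnt B q y" for y
    using s.B_row_dvd[of y] coprimes by (intro divides_mult) auto
  then show False using not_qr_dvd_rows by blast
qed

text \<open>
  The mean row is \<open>q * r\<close>, and equality in all rows is excluded because p divides the rows.
\<close>

lemma exists_small_row: "\<exists>x. cnt B p x < int q * int r"
proof (rule ccontr)
  assume "\<not> ?thesis"
  then have "cnt B p (int 0) = int q * int r"
    by (intro row_of_sum_eq[of "\<lambda>x. \<Sum>s\<in>B. chi p x s" p])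
      (use sum_rows_card[OF pos(1), of B] cardB pos in \<open>auto simp: not_less\<close>)
  then have "int p * int r dvd int q * int r" using rows_dvd by metis
  then have "p dvd q" using pos by simp
  then show False using primes distinct primes_dvd_imp_eq by blast
qed

text \<open>
  The other \<open>p - 1\<close> rows have at least \<open>p * r\<close> elements each.
\<close>

lemma row_le: "cnt B p x \<le> int r * (int p * (int q - int p + 1))"
proof -
  define x' where "x' = nat (x mod int p)"
  have x': "x' < p" using pos by (auto simp: x'_def nat_less_iff)
  have ge: "int p * int r \<le> cnt B p y" for y
    using rows_dvd rows_pos by (intro zdvd_imp_le) auto
  have "cnt B p (int x') - int p * int r \<le> (\<Sum>u<p. cnt B p (int u) - int p * int r)"
    by (rule member_le_sum) (use x' ge in auto)
  also have "\<dots> = int p * int q * int r - int p * (int p * int r)"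
    using sum_rows_card[OF pos(1), of B] by (simp add: sum_subtractf cardB)
  finally show ?thesis unfolding x'_def chi_mod[OF pos(1)] by (simp add: algebra_simps)
qed

text \<open>
  At the levels F, A vanishes jointly with \<open>q * r ^ c\<close> (\<open>vA_i1c\<close>), and patterns of digits at these
  levels cut A into pieces on which holes can be found. The pieces are small because only few levels
  are lost to L (\<open>p_pow_L\<close>); the level \<open>a\<close> is lost because A does not vanish at p ^ a.
\<close>

definition L where "L = {i \<in> {2..Suc \<alpha>}. vB i 1 c}"
definition F where "F = {1..Suc \<alpha>} - L - {a}"

text \<open>
  In a row with fewer than \<open>q * r\<close> elements, take a cell whose size r does not divide. It is unevenly
  distributed over the values of the c-th base-r digit. The row is evenly distributed and hence
  has fewer than q elements for each digit value; so the differences within the cell are less than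
  q. One of them is nonzero, and \<open>p ^ card L\<close> divides it.
\<close>

lemma p_pow_L: "p ^ card L < q"
proof -
  obtain x where x: "cnt B p x < int q * int r" using exists_small_row by blast
  obtain y where y: "\<not> int r dvd (\<Sum>s\<in>B. chi p x s * chi q y s)" using exists_column by blast
  define T where "T j = (\<Sum>s\<in>B. chi p x s * chi q y s * digit_ind r c (int j) s)" for j
  have "(\<Sum>j<r. T j) = (\<Sum>s\<in>B. chi p x s * chi q y s)"
    unfolding T_def by (subst sum.swap) (simp add: sum_distrib_left[symmetric] sum_digit_ind_all[OF pos(3)])
  moreover have "(\<Sum>j<r. T j) = int r * T 0" if "\<And>j. j < r \<Longrightarrow> T j = T 0"
  proof -
    have "(\<Sum>j<r. T j) = (\<Sum>j<r. T 0)" by (rule sum.cong[OF refl], rule that) simp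
    then show ?thesis by simp
  qed
  ultimately obtain j where j: "j < r" "T j \<noteq> T 0" using y by (metis dvd_triv_left)
  have row: "int r * (\<Sum>s\<in>B. chi p x s * digit_ind r c (int k) s) = cnt B p x" if "k < r" for k
    by (rule digit_row[OF vB_10c]) (use that in auto)
  let ?h = "\<lambda>s. (int r * digit_ind r c (int j) s - 1) - (int r * digit_ind r c (int 0) s - 1)"
  have h: "?h \<in> level r c"
    by (rule level_diff) (use level_digit_ind[OF pos(3), of c _ "\<lambda>_. 1"] j pos c in auto)
  have "int p ^ card L dvd (\<Sum>s\<in>B. ((int q * chi q y s - 1) * ?h s) * chi p x s)"
  proof (rule level_dvd[OF finB pos(1), of L 1 "Suc \<alpha>"])
    show "L \<subseteq> {1<..Suc \<alpha>}" by (auto simp: L_def)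
    fix i and g :: "int \<Rightarrow> int" assume "i \<in> L" and g: "g \<in> level p i"
    then have "vB i 1 c" by (simp add: L_def)
    from testB[OF this g level_chi1[OF pos(2)] h]
    show "(\<Sum>s\<in>B. ((int q * chi q y s - 1) * ?h s) * g s) = 0" by (simp only: mult_ac)
  qed simp
  also have "(\<Sum>s\<in>B. ((int q * chi q y s - 1) * ?h s) * chi p x s)
     = int q * (int r * (T j - T 0)) - (int r * (\<Sum>s\<in>B. chi p x s * digit_ind r c (int j) s) -
         int r * (\<Sum>s\<in>B. chi p x s * digit_ind r c (int 0) s))"
    unfolding T_def sum_distrib_left sum_subtractf[symmetric]
    by (intro sum.cong refl) (simp add: algebra_simps)
  also have "\<dots> = int q * (int r * (T j - T 0))" unfolding row[OF j(1)] row[OF pos(3)] by simp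
  finally have "int p ^ card L dvd T j - T 0"
    using coprimes by (simp add: coprime_dvd_mult_right_iff)
  then have 1: "int p ^ card L \<le> \<bar>T j - T 0\<bar>" using j dvd_imp_le_int[of "T j - T 0" "int p ^ card L"] by simp
  have T: "0 \<le> T k \<and> T k < int q" if "k < r" for k
  proof
    show "0 \<le> T k" unfolding T_def by (intro sum_nonneg) simp
    have "T k \<le> (\<Sum>s\<in>B. chi p x s * digit_ind r c (int k) s)"
      unfolding T_def by (intro sum_mono mult_right_mono mult_left_le) auto
    then have "int r * T k \<le> int r * (\<Sum>s\<in>B. chi p x s * digit_ind r c (int k) s)" by (intro mult_left_mono) auto
    then have "int r * T k < int r * int q" using x unfolding row[OF that] by (simp add: mult.commute)
    then show "T k < int q" using pos by simp
  qed
  have "int p ^ card L < int q" using 1 T[OF j(1)] T[OF pos(3)] by linarith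
  then show ?thesis by (metis of_nat_less_iff of_nat_power)
qed

lemma fin_L: "finite L" and fin_F: "finite F" "0 \<notin> F" and F1: "1 \<in> F"
  using a by (auto simp: L_def F_def)

lemma FD: "i \<in> F \<Longrightarrow> 1 \<le> i \<and> i \<le> Suc \<alpha> \<and> i \<noteq> a \<and> \<not> vB i 1 c"
  using not_vB_11c by (cases "i = 1") (auto simp: F_def L_def)

lemma card_F_L: "\<alpha> \<le> card F + card L"
proof -
  have "card {1..Suc \<alpha>} \<le> card (F \<union> L \<union> {a})"
    by (rule card_mono) (use fin_L fin_F in \<open>auto simp: F_def\<close>)
  also have "\<dots> \<le> card F + card L + card {a}"
    by (intro order_trans[OF card_Un_le] add_right_mono card_Un_le)
  finally show ?thesis by simp
qed

lemma vA_i1c: "i \<in> insert 0 F \<Longrightarrow> vA i 1 c"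
  using vA_01k[of c] FD[of i] dichotomy[of i 1 c] c by auto

text \<open>
  Each missed level j (1 is not among them) gives a factor q of a nonzero alternating sum of counts of B
  over siblings modulo p ^ i and modulo r ^ c. These four counts are each bounded by the part of a row
  with a given digit, and twice that bound, \<open>2 * K\<close>, is less than \<open>q ^ 2\<close>. For \<open>i = 0\<close> this is
  \<open>missed_bound\<close>.
\<close>

lemma card_Z:
  assumes "i \<in> insert 0 F"
  shows "card {j \<in> {1..Suc \<beta>}. \<not> vA i j c} \<le> 1"
proof (cases "i = 0")
  case True
  have "q ^ card s.missed \<le> q * p"
    by (rule s.missed_bound) (use not_vB_01k[of c] c in auto)
  also have "q * p < q ^ 2" using order pos by (simp add: power2_eq_square)
  finally have "card s.missed < 2" using pos power_less_imp_less_exp by blast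
  moreover have "s.missed = {j \<in> {1..Suc \<beta>}. \<not> vA i j c}" using True by (auto simp: s.missed_def)
  ultimately show ?thesis by simp
next
  case False
  then have i: "i \<in> F" using assms by simp
  note iD = FD[OF i]
  let ?Z = "{j \<in> {1..Suc \<beta>}. \<not> vA i j c}"
  obtain f g h where fgh: "f \<in> level_gen p i" "g \<in> level_gen q 1" "h \<in> level_gen r c" "(\<Sum>s\<in>B. f s * g s * h s) \<noteq> 0"
    using iD vanishes_intro[of i 1 c B] by blast
  obtain X X' where X: "f = (\<lambda>s. chi (p ^ i) X s - chi (p ^ i) X' s)" "[X = X'] (mod int (p ^ (i - 1)))"
    using fgh(1) iD by (auto simp: level_gen_def split: if_splits)
  obtain u v where u: "h = (\<lambda>s. chi (r ^ c) u s - chi (r ^ c) v s)"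
    using fgh(3) c by (auto simp: level_gen_def split: if_splits)
  obtain y y' where "g = (\<lambda>s. chi q y s - chi q y' s)" using fgh(2) by (auto simp: level_gen_def)
  then have "(\<Sum>s\<in>B. f s * g s * h s) = (\<Sum>s\<in>B. (f s * h s) * chi q y s) - (\<Sum>s\<in>B. (f s * h s) * chi q y' s)"
    unfolding sum_subtractf[symmetric] by (intro sum.cong refl) (simp add: algebra_simps)
  then have "(\<Sum>s\<in>B. (f s * h s) * chi q y s) \<noteq> 0 \<or> (\<Sum>s\<in>B. (f s * h s) * chi q y' s) \<noteq> 0"
    using fgh(4) by auto
  then obtain z where z: "(\<Sum>s\<in>B. (f s * h s) * chi q z s) \<noteq> 0" by blast
  have level: "f \<in> level p i" "h \<in> level r c" using fgh level_gen_subset_level pos by blast+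
  have "int q ^ card ?Z dvd (\<Sum>s\<in>B. (f s * h s) * chi q z s)"
  proof (rule level_dvd[OF finB pos(2), of ?Z 1 "Suc \<beta>"])
    show "?Z \<subseteq> {1<..Suc \<beta>}"
    proof
      fix j assume j: "j \<in> ?Z"
      then have "j \<noteq> 1" using vA_i1c[OF assms] by auto
      then show "j \<in> {1<..Suc \<beta>}" using j by auto
    qed
    fix j and k :: "int \<Rightarrow> int" assume j: "j \<in> ?Z" and k: "k \<in> level q j"
    have "vB i j c" using j iD dichotomy[of i j c] c by auto
    from testB[OF this level(1) k level(2)]
    show "(\<Sum>s\<in>B. f s * h s * k s) = 0" by (simp only: mult_ac)
  qed simp
  from dvd_imp_le_int[OF z this]
  have 1: "int q ^ card ?Z \<le> \<bar>\<Sum>s\<in>B. (f s * h s) * chi q z s\<bar>" by simp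
  define E where "E Y w = (\<Sum>s\<in>B. chi (p ^ i) Y s * chi (r ^ c) w s * chi q z s)" for Y w
  define K where "K = int p * (int q - int p + 1)"
  have E: "0 \<le> E Y w \<and> E Y w \<le> K" for Y w
  proof
    show "0 \<le> E Y w" unfolding E_def by (intro sum_nonneg) simp
    have pi: "chi (p ^ i) Y s \<le> chi p Y s" for s
    proof -
      have "int p dvd int (p ^ i)" using iD by (simp add: dvd_power)
      then show ?thesis unfolding chi_def by (auto intro: cong_dvd_modulus simp del: of_nat_power)
    qed
    have rc: "chi (r ^ c) w s \<le> digit_ind r c (digit r c w) s" for s
      using perD[OF periodic_digit[OF pos(3), of c], of s w] c by (simp add: chi_def digit_ind_def)
    have "E Y w \<le> (\<Sum>s\<in>B. chi p Y s * digit_ind r c (digit r c w) s)"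
      unfolding E_def
    proof (rule sum_mono)
      fix s
      have "chi (p ^ i) Y s * chi (r ^ c) w s * chi q z s \<le> chi (p ^ i) Y s * chi (r ^ c) w s"
        by (intro mult_left_le) auto
      also have "\<dots> \<le> chi p Y s * digit_ind r c (digit r c w) s" by (intro mult_mono pi rc) auto
      finally show "chi (p ^ i) Y s * chi (r ^ c) w s * chi q z s \<le> chi p Y s * digit_ind r c (digit r c w) s" .
    qed
    then have "int r * E Y w \<le> int r * (\<Sum>s\<in>B. chi p Y s * digit_ind r c (digit r c w) s)"
      by (intro mult_left_mono) auto
    also have "\<dots> = cnt B p Y"
      by (rule digit_row[OF vB_10c]) (use pos in \<open>auto simp: digit_def\<close>)
    also have "\<dots> \<le> int r * K" unfolding K_def by (rule row_le)
    finally show "E Y w \<le> K" using pos by simp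
  qed
  have "(\<Sum>s\<in>B. (f s * h s) * chi q z s) = (E X u - E X v) - (E X' u - E X' v)"
    unfolding E_def X(1) u sum_subtractf[symmetric] by (intro sum.cong refl) (simp add: algebra_simps)
  then have "\<bar>\<Sum>s\<in>B. (f s * h s) * chi q z s\<bar> \<le> 2 * K"
    using E[of X u] E[of X v] E[of X' u] E[of X' v] by linarith
  also have "2 * K < int q ^ 2"
  proof -
    have "0 < (int q - int p) ^ 2" using order by simp
    moreover have "0 \<le> int p * (int p - 2)" using pos by simp
    ultimately have "0 < (int q - int p) ^ 2 + int p * (int p - 2)" by (rule add_pos_nonneg)
    also have "\<dots> = int q ^ 2 - 2 * K" by (simp add: K_def power2_eq_square algebra_simps)
    finally show ?thesis by simp
  qed
  finally have "int q ^ card ?Z < int q ^ 2" using 1 by (rule le_less_trans[rotated])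
  moreover have "1 < int q" using pos(5) by simp
  ultimately have "card ?Z < 2" by (rule power_less_imp_less_exp[rotated])
  then show ?thesis by linarith
qed

end

context pqr_counterexample
begin

definition N where "N = int q ^ \<beta> * int r ^ (Suc \<gamma> - c)"

abbreviation pattern where "pattern ds s \<equiv> (\<Prod>i\<in>F. digit_ind p i (ds i) s)"

text \<open>
  A vanishes at \<open>p ^ i * r ^ k\<close> for \<open>i \<in> F\<close>, k < c, so inside a class modulo \<open>r ^ (c - 1)\<close> it is
  evenly distributed over the digit patterns.
\<close>

lemma pattern_parent:
  assumes ds: "\<And>i. i \<in> F \<Longrightarrow> 0 \<le> ds i \<and> ds i < int p"
  shows "int p ^ card F * (\<Sum>s\<in>A. chi (r ^ (c - 1)) u s * pattern ds s) = int p ^ \<alpha> * N"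
proof -
  have "0 dvd int p ^ card F * (\<Sum>s\<in>A. chi (r ^ (c - 1)) u s * pattern ds s) - cnt A (r ^ (c - 1)) u"
  proof (rule digits_dvd[OF pos(1) fin_F ds])
    fix i and g :: "int \<Rightarrow> int" assume i: "i \<in> F" and g: "g \<in> level p i"
    have "(\<Sum>s\<in>A. chi (r ^ (c - 1)) u s * g s) = 0"
      by (rule A_parent_vanishes[OF _ g]) (use vA_i0k[of i] FD[OF i] in auto)
    then show "0 dvd (\<Sum>s\<in>A. chi (r ^ (c - 1)) u s * g s)" by simp
  qed
  then show ?thesis using A_parent[of u] by (simp add: N_def mult_ac)
qed

lemma pattern_child_dvd:
  assumes ds: "\<And>i. i \<in> F \<Longrightarrow> 0 \<le> ds i \<and> ds i < int p"
  shows "N dvd (\<Sum>s\<in>A. chi (r ^ c) v s * pattern ds s)"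
proof -
  have cop: "coprime (int q ^ m) (int p ^ n)" "coprime (int r ^ m) (int p ^ n)" for m n
    using coprimes by (auto simp: coprime_commute)
  let ?h = "\<lambda>s. int r * chi (r ^ c) v s - chi (r ^ (c - 1)) v s"
  have h: "?h \<in> level r c" by (rule level_chi_top) (use pos c in auto)
  (* factor q ^ \<beta>: at most one of the Suc \<beta> levels in base q is missed *)
  have q: "int q ^ \<beta> dvd (\<Sum>s\<in>A. ?h s * g s)" if i: "i \<in> insert 0 F" and g: "g \<in> level p i" for i g
  proof -
    let ?Z = "{j \<in> {1..Suc \<beta>}. \<not> vA i j c}"
    have "int q ^ card ({1..Suc \<beta>} - ?Z) dvd (\<Sum>s\<in>A. (?h s * g s) * 1)"
    proof (rule level_dvd[OF finA pos(2), of _ 0 "Suc \<beta>"])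
      fix j and k :: "int \<Rightarrow> int" assume j: "j \<in> {1..Suc \<beta>} - ?Z" and k: "k \<in> level q j"
      have "vA i j c" using j by auto
      from testA[OF this g k h] show "(\<Sum>s\<in>A. (?h s * g s) * k s) = 0" by (simp only: mult_ac)
    qed auto
    moreover have "card ({1..Suc \<beta>} - ?Z) = Suc \<beta> - card ?Z"
      by (subst card_Diff_subset) auto
    then have "\<beta> \<le> card ({1..Suc \<beta>} - ?Z)" using card_Z[OF i] by linarith
    then have "int q ^ \<beta> dvd int q ^ card ({1..Suc \<beta>} - ?Z)" by (rule le_imp_power_dvd)
    ultimately show ?thesis using dvd_trans by simp
  qed
  have "int q ^ \<beta> dvd int p ^ card F * (\<Sum>s\<in>A. ?h s * pattern ds s) - (\<Sum>s\<in>A. ?h s)"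
    by (rule digits_dvd[OF pos(1) fin_F ds]) (use q in auto)
  moreover have "int q ^ \<beta> dvd (\<Sum>s\<in>A. ?h s)" using q[of 0 "\<lambda>_. 1"] by simp
  ultimately have "int q ^ \<beta> dvd int p ^ card F * (\<Sum>s\<in>A. ?h s * pattern ds s)"
    by (rule dvd_of_dvd_diff)
  also have "int p ^ card F * (\<Sum>s\<in>A. ?h s * pattern ds s)
    = int p ^ card F * (int r * (\<Sum>s\<in>A. chi (r ^ c) v s * pattern ds s))
      - int p ^ card F * (\<Sum>s\<in>A. chi (r ^ (c - 1)) v s * pattern ds s)"
    unfolding sum_distrib_left sum_subtractf[symmetric]
    by (intro sum.cong refl) (simp add: algebra_simps)
  also have "int p ^ card F * (\<Sum>s\<in>A. chi (r ^ (c - 1)) v s * pattern ds s) = int p ^ \<alpha> * N"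
    by (rule pattern_parent) (rule ds)
  also have "int p ^ card F * (int r * (\<Sum>s\<in>A. chi (r ^ c) v s * pattern ds s)) - int p ^ \<alpha> * N
    = int p ^ card F * (int r * (\<Sum>s\<in>A. chi (r ^ c) v s * pattern ds s)) - int q ^ \<beta> * (int p ^ \<alpha> * int r ^ (Suc \<gamma> - c))"
    unfolding N_def by (simp only: mult_ac)
  finally have "int q ^ \<beta> dvd int p ^ card F * (int r * (\<Sum>s\<in>A. chi (r ^ c) v s * pattern ds s))"
    by (rule dvd_of_dvd_diff) simp
  then have qd: "int q ^ \<beta> dvd (\<Sum>s\<in>A. chi (r ^ c) v s * pattern ds s)"
    using cop coprimes by (simp add: coprime_dvd_mult_right_iff)
  (* the remaining factor of N comes from the levels above c in base r *)
  have "int r ^ (Suc \<gamma> - c) dvd int p ^ card F * (\<Sum>s\<in>A. chi (r ^ c) v s * pattern ds s) - cnt A (r ^ c) v"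
  proof (rule digits_dvd[OF pos(1) fin_F ds])
    fix i and g :: "int \<Rightarrow> int" assume i: "i \<in> F" and g: "g \<in> level p i"
    show "int r ^ (Suc \<gamma> - c) dvd (\<Sum>s\<in>A. chi (r ^ c) v s * g s)"
      by (rule A_child_r_p[OF _ g]) (use vA_i0k[of i] FD[OF i] order in auto)
  qed
  then have "int r ^ (Suc \<gamma> - c) dvd int p ^ card F * (\<Sum>s\<in>A. chi (r ^ c) v s * pattern ds s)"
    using A_child_r[of v] by (rule dvd_of_dvd_diff)
  then have "int r ^ (Suc \<gamma> - c) dvd (\<Sum>s\<in>A. chi (r ^ c) v s * pattern ds s)"
    using coprime_dvd_mult_right_iff[OF cop(2)] by blast
  then show ?thesis unfolding N_def using qd coprimes by (intro divides_mult) auto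
qed

text \<open>
  By \<open>pattern_parent\<close>, the piece of A given by a pattern and a class modulo \<open>r ^ (c - 1)\<close> has at most
  \<open>p ^ card L * N < r * N\<close> elements, and N divides the number in each child.
\<close>

lemma pattern_hole:
  assumes ds: "\<And>i. i \<in> F \<Longrightarrow> 0 \<le> ds i \<and> ds i < int p"
  shows "\<exists>v. [v = u] (mod int (r ^ (c - 1))) \<and> (\<Sum>s\<in>A. chi (r ^ c) v s * pattern ds s) = 0"
proof (rule ccontr)
  assume no: "\<not> ?thesis"
  define Q where "Q w = (\<Sum>s\<in>A. chi (r ^ (c - 1)) w s * pattern ds s)" for w
  define Q' where "Q' w = (\<Sum>s\<in>A. chi (r ^ c) w s * pattern ds s)" for w
  define v where "v e = u + int (e * r ^ (c - 1))" for e
  have N0: "N > 0" using pos by (simp add: N_def)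
  have "N \<le> Q' (v e)" for e
  proof -
    have "[v e = u] (mod int (r ^ (c - 1)))" by (simp add: v_def cong_def)
    then have "Q' (v e) \<noteq> 0" using no unfolding Q'_def by blast
    moreover have "0 \<le> Q' (v e)" unfolding Q'_def by (intro sum_nonneg mult_nonneg_nonneg prod_digit_ind_nonneg) simp
    ultimately show ?thesis using pattern_child_dvd[of ds "v e", OF ds] unfolding Q'_def[symmetric]
      by (intro zdvd_imp_le) auto
  qed
  then have "(\<Sum>e<r. N) \<le> (\<Sum>e<r. Q' (v e))" by (intro sum_mono)
  also have "(\<Sum>e<r. Q' (v e)) = Q u"
  proof -
    have sp: "(\<Sum>e<r. chi (r ^ c) (u + int (e * r ^ (c - 1))) s) = chi (r ^ (c - 1)) u s" for s
      by (rule chi_split[symmetric]) (use pos c in auto)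
    show ?thesis unfolding Q'_def v_def Q_def
      by (subst sum.swap) (simp only: sum_distrib_right[symmetric] sp)
  qed
  finally have rN: "int r * N \<le> Q u" by simp
  have "int p ^ card F * Q u = int p ^ \<alpha> * N" unfolding Q_def by (rule pattern_parent) (rule ds)
  also have "\<dots> \<le> int p ^ (card F + card L) * N"
    by (intro mult_right_mono power_increasing card_F_L) (use N0 pos in auto)
  finally have "int p ^ card F * Q u \<le> int p ^ card F * (int p ^ card L * N)"
    by (simp add: power_add mult_ac)
  then have "Q u \<le> int p ^ card L * N" using pos by simp
  then have "int r * N \<le> int p ^ card L * N" using rN by simp
  then have "int r \<le> int p ^ card L" using N0 by simp
  also have "\<dots> < int q" using p_pow_L by (metis of_nat_less_iff of_nat_power)
  finally show False using order by simp
qed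

text \<open>
  As in \<open>holes_lift\<close>, a hole of the piece turns vanishing at the levels \<open>p ^ i * q * r ^ c\<close> with
  \<open>i \<in> F\<close> or \<open>i = 0\<close> into vanishing on the piece.
\<close>

lemma pattern_vanishes:
  assumes ds: "\<And>i. i \<in> F \<Longrightarrow> 0 \<le> ds i \<and> ds i < int p" and g: "g \<in> level q 1"
  shows "(\<Sum>s\<in>A. pattern ds s * g s * chi (r ^ (c - 1)) u s) = 0"
proof -
  obtain v where v: "[v = u] (mod int (r ^ (c - 1)))" "(\<Sum>s\<in>A. chi (r ^ c) v s * pattern ds s) = 0"
    using pattern_hole[of ds u, OF ds] by blast
  have z: "chi (r ^ c) v s * pattern ds s = 0" if "s \<in> A" for s
    by (rule sum_nonneg_int_zero[OF v(2) finA _ that]) (intro mult_nonneg_nonneg prod_digit_ind_nonneg chi_nonneg)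
  let ?h = "\<lambda>s. int r * chi (r ^ c) v s - chi (r ^ (c - 1)) v s"
  have h: "?h \<in> level r c" by (rule level_chi_top) (use pos c in auto)
  have vanishes: "(\<Sum>s\<in>A. (g s * ?h s) * f s) = 0" if "i \<in> insert 0 F" "f \<in> level p i" for i f
    using testA[OF vA_i1c[OF that(1)] that(2) g h] by (simp only: mult_ac)
  have "0 dvd int p ^ card F * (\<Sum>s\<in>A. (g s * ?h s) * pattern ds s) - (\<Sum>s\<in>A. g s * ?h s)"
    by (rule digits_dvd[OF pos(1) fin_F ds]) (use vanishes in auto)
  moreover have "(\<Sum>s\<in>A. g s * ?h s) = 0" using vanishes[of 0 "\<lambda>_. 1"] by simp
  ultimately have "(\<Sum>s\<in>A. (g s * ?h s) * pattern ds s) = 0" using pos by simp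
  also have "(\<Sum>s\<in>A. (g s * ?h s) * pattern ds s) = (\<Sum>s\<in>A. - (pattern ds s * g s * chi (r ^ (c - 1)) v s))"
  proof (rule sum.cong[OF refl])
    fix s assume "s \<in> A"
    have "g s * ?h s * pattern ds s = int r * g s * (chi (r ^ c) v s * pattern ds s) - pattern ds s * g s * chi (r ^ (c - 1)) v s"
      by (simp add: algebra_simps)
    then show "g s * ?h s * pattern ds s = - (pattern ds s * g s * chi (r ^ (c - 1)) v s)"
      unfolding z[OF \<open>s \<in> A\<close>] by simp
  qed
  finally show ?thesis unfolding chi_cong[OF v(1)] by (simp add: sum_negf)
qed

text \<open>
  A function modulo p is constant on digit patterns, since \<open>1 \<in> F\<close>, and one modulo r is constant
  on classes modulo \<open>r ^ (c - 1)\<close>, since \<open>c \<ge> 2\<close>. Summing \<open>pattern_vanishes\<close> over both, A vanishes at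
  \<open>p * q * r\<close>.
\<close>

lemma no_counterexample: False
proof -
  have "vA 1 1 1"
  proof (rule vanishes_intro)
    fix f g h assume "f \<in> level_gen p 1" "g \<in> level_gen q 1" "h \<in> level_gen r 1"
    then have level: "f \<in> level p 1" "g \<in> level q 1" "h \<in> level r 1" using level_gen_subset_level pos by blast+
    have hper: "periodic (r ^ (c - 1)) h"
      by (rule periodic_pow_le[OF level_periodic[OF level(3)]]) (use c in auto)
    have fper: "periodic p f" using level_periodic[OF level(1)] by simp
    show "(\<Sum>s\<in>A. f s * g s * h s) = 0"
    proof (rule sum_periodic_zero[OF _ hper])
      show "0 < r ^ (c - 1)" using pos by simp
      fix u
      have "(\<Sum>s\<in>A. f s * g s * chi (r ^ (c - 1)) u s)
        = (\<Sum>s\<in>A. \<Sum>ds\<in>Pi\<^sub>E F (\<lambda>_. {..<p}). f (int (ds 1)) * (pattern (\<lambda>i. int (ds i)) s * g s * chi (r ^ (c - 1)) u s))"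
        (is "_ = (\<Sum>s\<in>A. \<Sum>ds\<in>?P. ?T s ds)")
      proof (rule sum.cong[OF refl])
        fix s
        have "f s * (g s * chi (r ^ (c - 1)) u s)
          = (\<Sum>ds\<in>?P. f (int (ds 1)) * pattern (\<lambda>i. int (ds i)) s) * (g s * chi (r ^ (c - 1)) u s)"
          using digits_expand[OF pos(1) fin_F(1) F1 fper, of s] by simp
        then show "f s * g s * chi (r ^ (c - 1)) u s = (\<Sum>ds\<in>?P. ?T s ds)"
          unfolding sum_distrib_right by (simp only: mult.assoc)
      qed
      also have "\<dots> = (\<Sum>ds\<in>?P. f (int (ds 1)) * (\<Sum>s\<in>A. pattern (\<lambda>i. int (ds i)) s * g s * chi (r ^ (c - 1)) u s))"
        by (subst sum.swap) (simp only: sum_distrib_left)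
      also have "\<dots> = (\<Sum>ds\<in>?P. 0)"
      proof (rule sum.cong[OF refl])
        fix ds assume "ds \<in> ?P"
        then have "(\<Sum>s\<in>A. pattern (\<lambda>i. int (ds i)) s * g s * chi (r ^ (c - 1)) u s) = 0"
          by (intro pattern_vanishes level(2)) (auto simp: PiE_iff)
        then show "f (int (ds 1)) * (\<Sum>s\<in>A. pattern (\<lambda>i. int (ds i)) s * g s * chi (r ^ (c - 1)) u s) = 0" by simp
      qed
      finally show "(\<Sum>s\<in>A. f s * g s * chi (r ^ (c - 1)) u s) = 0" by simp
    qed
  qed
  then show False using bad by simp
qed

end

context three_prime_tiling
begin

lemma vA_111_aux:
  assumes "p < q" "q < r"
  shows "vA 1 1 1"
proof (rule ccontr)
  assume n: "\<not> vA 1 1 1"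
  interpret pqr_counterexample p q r \<alpha> \<beta> \<gamma> a b c A B
    by unfold_locales (use assms n in auto)
  show False by (rule no_counterexample)
qed

lemma vA_all: "vA 1 1 0" "vA 1 0 1" "vA 0 1 1" "vA 1 1 1"
proof -
  interpret s: three_prime_tiling q p r \<beta> \<alpha> \<gamma> b a c A B by (rule swap12)
  interpret t: three_prime_tiling p r q \<alpha> \<gamma> \<beta> a c b A B by (rule swap23)
  interpret u: three_prime_tiling q r p \<beta> \<gamma> \<alpha> b c a A B by (rule s.swap23)
  interpret v: three_prime_tiling r p q \<gamma> \<alpha> \<beta> c a b A B by (rule t.swap12)
  interpret w: three_prime_tiling r q p \<gamma> \<beta> \<alpha> c b a A B by (rule u.swap12)
  show "vA 1 1 0" by (rule vA_110)
  show "vA 1 0 1" using t.vA_110 by simp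
  show "vA 0 1 1" using u.vA_110 by simp
  consider "p < q" "q < r" | "p < r" "r < q" | "q < p" "p < r" | "q < r" "r < p"
    | "r < p" "p < q" | "r < q" "q < p"
    using distinct by linarith
  then show "vA 1 1 1"
  proof cases
    case 1 then show ?thesis by (rule vA_111_aux)
  next
    case 2 from t.vA_111_aux[OF this] show ?thesis by (simp add: mult_ac)
  next
    case 3 from s.vA_111_aux[OF this] show ?thesis by (simp add: mult_ac)
  next
    case 4 from u.vA_111_aux[OF this] show ?thesis by (simp add: mult_ac)
  next
    case 5 from v.vA_111_aux[OF this] show ?thesis by (simp add: mult_ac)
  next
    case 6 from w.vA_111_aux[OF this] show ?thesis by (simp add: mult_ac)
  qed
qed

end

section \<open>Exceptional prime powers and the theorem\<close>

context three_primes
begin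

text \<open>
  Each level at which A vanishes contributes a factor p to \<open>card A\<close>.
\<close>

lemma card_prime_power_levels:
  assumes "finite A" "card A = p ^ n * m" "\<not> p dvd m"
  shows "card {i \<in> {1..k}. vanishes A (p ^ i)} \<le> n"
proof -
  have l: "p > 0" "p > 1" using primes prime_gt_0_nat prime_gt_1_nat by auto
  let ?G = "{i \<in> {1..k}. vanishes A (p ^ i)}"
  have "int p ^ card ?G dvd (\<Sum>x\<in>A. 1 * 1)"
  proof (rule level_dvd[OF assms(1) l(1), of _ 0 k])
    fix i and g :: "int \<Rightarrow> int" assume "i \<in> ?G" and g: "g \<in> level p i"
    then have "vanishes A (p ^ i * q ^ 0 * r ^ 0)" by simp
    from vanishes_test[OF this g level_const[of 1] level_const[of 1]]
    show "(\<Sum>x\<in>A. 1 * g x) = 0" by simp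
  qed auto
  then have "int (p ^ card ?G) dvd int (p ^ n * m)" using assms(2) by simp
  then have "p ^ card ?G dvd p ^ n * m" by (simp only: int_dvd_int_iff)
  moreover have "coprime (p ^ card ?G) m"
    using primes assms(3) by (simp add: prime_imp_coprime)
  ultimately have "p ^ card ?G dvd p ^ n" by (simp add: coprime_dvd_mult_left_iff)
  then show ?thesis using l by (simp add: power_dvd_imp_le)
qed

text \<open>
  Of the \<open>n + 1\<close> powers of p that divide M, at most n belong to A and at most one to B, and by
  the dichotomy each belongs to one of them.
\<close>

lemma unique_level:
  assumes t: "tiling A B M"
    and A: "card A = p ^ n * m" "\<not> p dvd m" and B: "card B = p * m'" "\<not> p dvd m'"
    and vanishes: "vanishes A p"
  obtains e where "2 \<le> e" "e \<le> Suc n" "vanishes B (p ^ e)" "\<not> vanishes A (p ^ e)"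
    "\<And>i. 1 \<le> i \<Longrightarrow> i \<le> Suc n \<Longrightarrow> i \<noteq> e \<Longrightarrow> vanishes A (p ^ i) \<and> \<not> vanishes B (p ^ i)"
proof -
  have fin: "finite A" "finite B" and M: "M = p ^ n * m * (p * m')"
    using t A B by (auto simp: tiling_def)
  let ?SA = "{i \<in> {1..Suc n}. vanishes A (p ^ i)}" and ?SB = "{i \<in> {1..Suc n}. vanishes B (p ^ i)}"
  have cA: "card ?SA \<le> n" by (rule card_prime_power_levels[OF fin(1) A])
  have cB: "card ?SB \<le> 1" by (rule card_prime_power_levels[OF fin(2), of 1 m']) (use B in auto)
  have "i \<in> ?SA \<union> ?SB" if i: "i \<in> {1..Suc n}" for i
  proof -
    have "p ^ i dvd p ^ Suc n" by (rule le_imp_power_dvd) (use i in simp)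
    also have "p ^ Suc n dvd M" unfolding M by (simp add: mult_ac)
    finally have "p ^ i dvd M" .
    moreover have "p ^ i > 1" by (rule one_less_power) (use i prime_gt_1_nat[OF primes(1)] in auto)
    ultimately have "vanishes A (p ^ i) \<or> vanishes B (p ^ i)" by (rule tiling_dichotomy[OF t])
    then show ?thesis using i by blast
  qed
  then have "{1..Suc n} \<subseteq> ?SA \<union> ?SB" by (rule subsetI)
  moreover have "?SA \<union> ?SB \<subseteq> {1..Suc n}" by auto
  ultimately have un: "?SA \<union> ?SB = {1..Suc n}" by (rule equalityI[rotated])
  have "card ?SA + card ?SB = card (?SA \<union> ?SB) + card (?SA \<inter> ?SB)"
    by (rule card_Un_Int) auto
  then have c: "Suc n + card (?SA \<inter> ?SB) = card ?SA + card ?SB" unfolding un by simp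
  then have "card ?SB = 1" "card (?SA \<inter> ?SB) = 0" using cA cB by linarith+
  then have "?SA \<inter> ?SB = {}" by simp
  from \<open>card ?SB = 1\<close> obtain e where e: "?SB = {e}" by (rule card_1_singletonE)
  have eB: "e \<in> ?SB" using e by blast
  then have nA: "\<not> vanishes A (p ^ e)" using \<open>?SA \<inter> ?SB = {}\<close> by blast
  have "e \<noteq> 1" using nA vanishes by auto
  show ?thesis
  proof
    show "2 \<le> e" "e \<le> Suc n" "vanishes B (p ^ e)" "\<not> vanishes A (p ^ e)" using eB nA \<open>e \<noteq> 1\<close> by auto
    fix i assume i: "1 \<le> i" "i \<le> Suc n" "i \<noteq> e"
    have "i \<notin> ?SB" using e i(3) by blast
    moreover have "i \<in> ?SA \<union> ?SB" unfolding un using i by simp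
    ultimately show "vanishes A (p ^ i) \<and> \<not> vanishes B (p ^ i)" using i by auto
  qed
qed

end

theorem theorem1p1:
  fixes p q r :: nat and \<alpha> \<beta> \<gamma> :: nat and A B :: "int set"
  assumes "prime p" "prime q" "prime r"
    and "p \<noteq> q" "p \<noteq> r" "q \<noteq> r"
    and "finite A" "finite B"
    and "card A = p ^ \<alpha> * q ^ \<beta> * r ^ \<gamma>"
    and "card B = p * q * r"
    and "M = card A * card B"
    and "tiles_cyclic A B M"
    and "laurent_of_poly (cyclotomic p) dvd char_poly_set A"
    and "laurent_of_poly (cyclotomic q) dvd char_poly_set A"
    and "laurent_of_poly (cyclotomic r) dvd char_poly_set A"
  shows "laurent_of_poly (cyclotomic (p * q)) dvd char_poly_set A \<and>
         laurent_of_poly (cyclotomic (p * r)) dvd char_poly_set A \<and>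
         laurent_of_poly (cyclotomic (q * r)) dvd char_poly_set A \<and>
         laurent_of_poly (cyclotomic (p * q * r)) dvd char_poly_set A"
proof -
  have t: "tiling A B M" by (rule tiles_cyclic_tiling) fact
  have vanishes: "vanishes A p" "vanishes A q" "vanishes A r"
    using assms(13-15) by (simp_all only: cyclotomic_dvd_iff_vanishes[OF \<open>finite A\<close>])
  have M: "M = p ^ Suc \<alpha> * q ^ Suc \<beta> * r ^ Suc \<gamma>"
    unfolding \<open>M = card A * card B\<close> assms(9,10) by simp
  have nd: "\<not> l dvd l' ^ i * l'' ^ j"
    if "prime l" "prime l'" "prime l''" "l \<noteq> l'" "l \<noteq> l''" for l l' l'' i j :: nat
  proof
    assume "l dvd l' ^ i * l'' ^ j"
    then have "l dvd l' \<or> l dvd l''" using that(1) by (metis prime_dvd_mult_iff prime_dvd_power)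
    then show False using that primes_dvd_imp_eq by blast
  qed
  interpret t: three_primes p q r using assms by unfold_locales auto
  interpret u: three_primes q r p using assms by unfold_locales auto
  interpret v: three_primes r p q using assms by unfold_locales auto
  obtain a where a: "2 \<le> a" "a \<le> Suc \<alpha>" "vanishes B (p ^ a)" "\<not> vanishes A (p ^ a)"
    "\<And>i. 1 \<le> i \<Longrightarrow> i \<le> Suc \<alpha> \<Longrightarrow> i \<noteq> a \<Longrightarrow> vanishes A (p ^ i) \<and> \<not> vanishes B (p ^ i)"
    by (rule t.unique_level[OF t, of \<alpha> "q ^ \<beta> * r ^ \<gamma>" "q * r"])
       (use assms nd[of p q r \<beta> \<gamma>] nd[of p q r 1 1] vanishes in auto)
  obtain b where b: "2 \<le> b" "b \<le> Suc \<beta>" "vanishes B (q ^ b)" "\<not> vanishes A (q ^ b)"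
    "\<And>i. 1 \<le> i \<Longrightarrow> i \<le> Suc \<beta> \<Longrightarrow> i \<noteq> b \<Longrightarrow> vanishes A (q ^ i) \<and> \<not> vanishes B (q ^ i)"
    by (rule u.unique_level[OF t, of \<beta> "p ^ \<alpha> * r ^ \<gamma>" "p * r"])
       (use assms nd[of q p r \<alpha> \<gamma>] nd[of q p r 1 1] vanishes in \<open>auto simp: mult_ac\<close>)
  obtain c where c: "2 \<le> c" "c \<le> Suc \<gamma>" "vanishes B (r ^ c)" "\<not> vanishes A (r ^ c)"
    "\<And>i. 1 \<le> i \<Longrightarrow> i \<le> Suc \<gamma> \<Longrightarrow> i \<noteq> c \<Longrightarrow> vanishes A (r ^ i) \<and> \<not> vanishes B (r ^ i)"
    by (rule v.unique_level[OF t, of \<gamma> "p ^ \<alpha> * q ^ \<beta>" "p * q"])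
       (use assms nd[of r p q \<alpha> \<beta>] nd[of r p q 1 1] vanishes in \<open>auto simp: mult_ac\<close>)
  interpret three_prime_tiling p q r \<alpha> \<beta> \<gamma> a b c A B
  proof unfold_locales
    fix i j k assume ijk: "i \<le> Suc \<alpha>" "j \<le> Suc \<beta>" "k \<le> Suc \<gamma>" "(i, j, k) \<noteq> (0, 0, 0)"
    have "p ^ i * q ^ j * r ^ k dvd M"
      unfolding M using ijk by (intro mult_dvd_mono le_imp_power_dvd)
    moreover have "p ^ i * q ^ j * r ^ k > 1"
    proof -
      have "p > 1" "q > 1" "r > 1" using assms prime_gt_1_nat by auto
      then have "p ^ i * q ^ j * r ^ k \<noteq> 1" "p ^ i * q ^ j * r ^ k \<noteq> 0" using ijk(4) by auto
      then show ?thesis by linarith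
    qed
    ultimately show "vanishes A (p ^ i * q ^ j * r ^ k) \<or> vanishes B (p ^ i * q ^ j * r ^ k)"
      by (rule tiling_dichotomy[OF t])
  next
    fix x x' y y' assume "x \<in> A" "x' \<in> A" "y \<in> B" "y' \<in> B"
      "gcd (x - x') (int (p ^ Suc \<alpha> * q ^ Suc \<beta> * r ^ Suc \<gamma>))
        = gcd (y - y') (int (p ^ Suc \<alpha> * q ^ Suc \<beta> * r ^ Suc \<gamma>))"
    then show "x = x'" unfolding M[symmetric] by (rule tiling_gcd_differences[OF t])
  qed (use assms a b c in auto)
  show ?thesis
    unfolding cyclotomic_dvd_iff_vanishes[OF \<open>finite A\<close>] using vA_all by simp
qed

end
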